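(* Let $D\geq 2$ and let $f:\widehat{\mathbb C}\to\widehat{\mathbb C}$ be a postcritically finite rational map of degree $D$. Let $\Sigma_f$ be the set of eigenvalues of $f_*:\mathcal Q_f\to\mathcal Q_f$. If $\lambda\in\Sigma_f$, then $\lambda$ is an algebraic number. If $\lambda\in\Sigma_f$ is an algebraic integer, then either $\lambda=0$, or $f$ is a Lattès map and $$\lambda\in\left\{\pm1,\ \pm \mathrm i,\ \tfrac12\pm \mathrm i\tfrac{\sqrt3}{2},\ -\tfrac12\pm \mathrm i\tfrac{\sqrt3}{2}\right\}.$$
   Context: $\widehat{\mathbb C}$ is the Riemann sphere. For a rational map $f$ with critical set $\mathcal C_f$, the postcritical set is $\mathcal P_f=\bigcup_{n\geq1}f^{\circ n}(\mathcal C_f)$; $f$ is postcritically finite if $\mathcal P_f$ is finite. A meromorphic quadratic differential on $\widehat{\mathbb C}$ is $\mathbf q=q(z)\,(\mathrm dz)^2$ with $q$ a rational function (orders at $\infty$ are computed in the coordinate $w=1/z$, so $(\mathrm dz)^2$ has a pole of order $4$ at $\infty$). $\mathcal Q_f$ is the complex vector space of meromorphic quadratic differentials on $\widehat{\mathbb C}$ with at worst simple poles, all contained in $\mathcal P_f$. The pushforward operator is $f_*\mathbf q=r\,(\mathrm dz)^2$ with $r(y)=\sum_{x\in f^{-1}(y)}\frac{q(x)}{f'(x)^2}$ (for generic $y$; this extends to a meromorphic quadratic differential), and it maps $\mathcal Q_f$ to itself. An eigenvalue is a scalar for which there is a nonzero eigenvector. $f$ is a Lattès map if there are a complex torus $\mathcal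 T=\mathbb C/\Lambda$ ($\Lambda\subset\mathbb C$ a lattice of rank $2$), an affine map $L:\mathcal T\to\mathcal T$ and a finite (holomorphic) branched cover $\Theta:\mathcal T\to\widehat{\mathbb C}$ such that $\Theta\circ L=f\circ\Theta$. *)

theory Defs
  imports
    "HOL-Complex_Analysis.Complex_Analysis"
    "HOL-Computational_Algebra.Computational_Algebra"
    "HOL-Computational_Algebra.Field_as_Ring"
begin

section \<open>The Riemann sphere\<close>

text \<open>The one-point compactification of the plane; \<open>None\<close> is the point at infinity.\<close>

type_synonym riemann_sphere = "complex option"

text \<open>
  The standard holomorphic atlas, centred: \<open>sphere_param a\<close> parametrises a neighbourhood of \<open>a\<close>
  by a neighbourhood of \<open>0\<close>, using \<open>z - a\<close> at a finite point and \<open>1/z\<close> at infinity, and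
  \<open>sphere_coord a\<close> is the corresponding coordinate.  The value of the latter outside its chart
  domain (third equation, and \<open>Some 0\<close> in the second one) is irrelevant.
\<close>

fun sphere_param :: "riemann_sphere \<Rightarrow> complex \<Rightarrow> riemann_sphere" where
  "sphere_param (Some a) w = Some (a + w)"
| "sphere_param None w = (if w = 0 then None else Some (1 / w))"

fun sphere_coord :: "riemann_sphere \<Rightarrow> riemann_sphere \<Rightarrow> complex" where
  "sphere_coord (Some a) (Some z) = z - a"
| "sphere_coord None (Some z) = 1 / z"
| "sphere_coord (Some a) None = 0"
| "sphere_coord None None = 0"

definition holomorphic_to_sphere :: "(complex \<Rightarrow> riemann_sphere) \<Rightarrow> bool" where
  "holomorphic_to_sphere h \<longleftrightarrow>
     (\<forall>z. \<exists>g. g analytic_on {z} \<and> (\<forall>\<^sub>F x in nhds z. h x = sphere_param (h z) (g x)))"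


section \<open>Rational maps\<close>

text \<open>The self-map of the sphere induced by \<open>p/q\<close>, for coprime \<open>p\<close> and \<open>q\<close>.\<close>

fun sphere_quotient :: "complex poly \<Rightarrow> complex poly \<Rightarrow> riemann_sphere \<Rightarrow> riemann_sphere" where
  "sphere_quotient p q (Some z) = (if poly q z = 0 then None else Some (poly p z / poly q z))"
| "sphere_quotient p q None =
     (if degree p > degree q then None else Some (coeff p (degree q) / lead_coeff q))"

definition rational_map :: "nat \<Rightarrow> (riemann_sphere \<Rightarrow> riemann_sphere) \<Rightarrow> bool" where
  "rational_map D f \<longleftrightarrow>
     (\<exists>p q. coprime p q \<and> q \<noteq> 0 \<and> D = max (degree p) (degree q) \<and> f = sphere_quotient p q)"

definition critical_set :: "(riemann_sphere \<Rightarrow> riemann_sphere) \<Rightarrow> riemann_sphere set" where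
  "critical_set f = {x. deriv (\<lambda>w. sphere_coord (f x) (f (sphere_param x w))) 0 = 0}"

definition postcritical_set :: "(riemann_sphere \<Rightarrow> riemann_sphere) \<Rightarrow> riemann_sphere set" where
  "postcritical_set f = (\<Union>n\<in>{1..}. (f ^^ n) ` critical_set f)"

definition postcritically_finite :: "(riemann_sphere \<Rightarrow> riemann_sphere) \<Rightarrow> bool" where
  "postcritically_finite f \<longleftrightarrow> finite (postcritical_set f)"


section \<open>Meromorphic quadratic differentials\<close>

text \<open>
  The differential \<open>q(z) (dz)\<^sup>2\<close> is represented by the rational function \<open>q\<close>, an element of the
  field of fractions of the polynomial ring; \<open>quot_of_fract\<close> yields the reduced numerator and
  denominator.
\<close>

type_synonym quadratic_differential = "complex poly fract"

definition qd_numer :: "quadratic_differential \<Rightarrow> complex poly" where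
  "qd_numer q = fst (quot_of_fract q)"

definition qd_denom :: "quadratic_differential \<Rightarrow> complex poly" where
  "qd_denom q = snd (quot_of_fract q)"

definition qd_eval :: "quadratic_differential \<Rightarrow> complex \<Rightarrow> complex" where
  "qd_eval q z = poly (qd_numer q) z / poly (qd_denom q) z"

definition qd_scale :: "complex \<Rightarrow> quadratic_differential \<Rightarrow> quadratic_differential" where
  "qd_scale c q = to_fract [:c:] * q"

text \<open>
  Order of vanishing of a nonzero differential (negative at poles).  At infinity, in the
  coordinate \<open>w = 1/z\<close>, the differential is \<open>q(1/w) w\<^sup>-\<^sup>4 (dw)\<^sup>2\<close>.
\<close>

fun qd_order :: "quadratic_differential \<Rightarrow> riemann_sphere \<Rightarrow> int" where
  "qd_order q (Some z) = int (order z (qd_numer q)) - int (order z (qd_denom q))"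
| "qd_order q None = int (degree (qd_denom q)) - int (degree (qd_numer q)) - 4"

definition Q_space :: "(riemann_sphere \<Rightarrow> riemann_sphere) \<Rightarrow> quadratic_differential set" where
  "Q_space f = {q. q = 0 \<or>
     (\<forall>x. qd_order q x \<ge> -1 \<and> (qd_order q x < 0 \<longrightarrow> x \<in> postcritical_set f))}"


section \<open>The pushforward operator\<close>

definition finite_deriv :: "(riemann_sphere \<Rightarrow> riemann_sphere) \<Rightarrow> complex \<Rightarrow> complex" where
  "finite_deriv f x = deriv (\<lambda>z. the (f (Some z))) x"

text \<open>
  \<open>has_pushforward f q r\<close> means \<open>f\<^sub>* q = r\<close>.  Generic points are all but finitely many; in
  particular a finite value of \<open>f\<close> at infinity is disregarded, so that the sum over finite
  preimages is the sum over all preimages.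
\<close>

definition has_pushforward ::
  "(riemann_sphere \<Rightarrow> riemann_sphere) \<Rightarrow> quadratic_differential \<Rightarrow> quadratic_differential \<Rightarrow> bool" where
  "has_pushforward f q r \<longleftrightarrow>
     (\<forall>\<^sub>F y in cofinite.
        qd_eval r y = (\<Sum>x | f (Some x) = Some y. qd_eval q x / (finite_deriv f x)\<^sup>2))"

lemma has_pushforward_unique:
  assumes "has_pushforward f q r" "has_pushforward f q s"
  shows "r = s"
proof -
  have nz: "qd_denom t \<noteq> 0" for t by (simp add: qd_denom_def)
  have ev: "\<forall>\<^sub>F y in cofinite. poly (qd_denom t) y \<noteq> 0" for t
    using poly_roots_finite[OF nz[of t]] by (simp add: eventually_cofinite)
  have "\<forall>\<^sub>F y in cofinite. qd_eval r y = qd_eval s y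
      \<and> poly (qd_denom r) y \<noteq> 0 \<and> poly (qd_denom s) y \<noteq> 0"
    using assms ev[of r] ev[of s] unfolding has_pushforward_def by eventually_elim auto
  then have "\<forall>\<^sub>F y in cofinite.
      poly (qd_numer r * qd_denom s - qd_numer s * qd_denom r) y = 0"
    by eventually_elim (auto simp: qd_eval_def frac_eq_eq)
  then have "finite (UNIV - {y. poly (qd_numer r * qd_denom s - qd_numer s * qd_denom r) y = 0})"
    by (simp add: eventually_cofinite set_diff_eq)
  then have "qd_numer r * qd_denom s = qd_numer s * qd_denom r"
    using poly_roots_finite[of "qd_numer r * qd_denom s - qd_numer s * qd_denom r"]
      infinite_UNIV_char_0[where 'a = complex]
    by (metis finite_Diff2 right_minus_eq)
  then have "Fract (qd_numer r) (qd_denom r) = Fract (qd_numer s) (qd_denom s)"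
    using nz by (simp add: eq_fract)
  then show ?thesis
    by (simp add: qd_numer_def qd_denom_def Fract_quot_of_fract)
qed

definition pushforward_eigenvalues :: "(riemann_sphere \<Rightarrow> riemann_sphere) \<Rightarrow> complex set" where
  "pushforward_eigenvalues f =
     {c. \<exists>q\<in>Q_space f. q \<noteq> 0 \<and> has_pushforward f q (qd_scale c q)}"


section \<open>Lattes maps\<close>

definition lattice_rank2 :: "complex set \<Rightarrow> bool" where
  "lattice_rank2 \<Lambda> \<longleftrightarrow>
     (\<exists>u v. u \<noteq> v \<and> independent {u, v} \<and> \<Lambda> = {of_int m * u + of_int n * v | m n. True})"

text \<open>The torus is the set of cosets; its complex structure is the one making \<open>torus_proj\<close> a local
  biholomorphism, so holomorphy of a map on it is holomorphy of its lift to the plane.\<close>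

definition torus_proj :: "complex set \<Rightarrow> complex \<Rightarrow> complex set" where
  "torus_proj \<Lambda> z = (\<lambda>w. z + w) ` \<Lambda>"

definition torus :: "complex set \<Rightarrow> complex set set" where
  "torus \<Lambda> = range (torus_proj \<Lambda>)"

definition torus_affine :: "complex set \<Rightarrow> (complex set \<Rightarrow> complex set) \<Rightarrow> bool" where
  "torus_affine \<Lambda> L \<longleftrightarrow> (\<exists>a b. \<forall>z. L (torus_proj \<Lambda> z) = torus_proj \<Lambda> (a * z + b))"

definition torus_branched_cover :: "complex set \<Rightarrow> (complex set \<Rightarrow> riemann_sphere) \<Rightarrow> bool" where
  "torus_branched_cover \<Lambda> \<Theta> \<longleftrightarrow>
     holomorphic_to_sphere (\<Theta> \<circ> torus_proj \<Lambda>) \<and>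
     \<Theta> ` torus \<Lambda> = UNIV \<and>
     (\<forall>y. finite {t \<in> torus \<Lambda>. \<Theta> t = y})"

definition lattes_map :: "(riemann_sphere \<Rightarrow> riemann_sphere) \<Rightarrow> bool" where
  "lattes_map f \<longleftrightarrow>
     (\<exists>\<Lambda> L \<Theta>. lattice_rank2 \<Lambda> \<and> torus_affine \<Lambda> L \<and> torus_branched_cover \<Lambda> \<Theta> \<and>
        (\<forall>t\<in>torus \<Lambda>. \<Theta> (L t) = f (\<Theta> t)))"

end

theory Submission
  imports Defs
begin

text \<open>
  Write \<open>q = N/M\<close> for an eigendifferential with eigenvalue \<open>c\<close>.  The area of \<open>\<bar>q\<bar>\<close> is finite and is not
  increased by \<open>f\<^sub>*\<close>, so \<open>\<bar>c\<bar> \<le> 1\<close>.  The eigenvalue equation is algebraic in the coefficients of \<open>f\<close>,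
  \<open>q\<close> and in \<open>c\<close>, so every field embedding of a countable algebraically closed field containing them
  into \<open>\<complex>\<close> yields another eigenvalue.  A transcendental \<open>c\<close> could be moved out of the unit disc;
  if \<open>c\<close> is an algebraic integer, all its conjugates lie in the unit disc and their product is a
  nonzero integer unless \<open>c = 0\<close>, so \<open>\<bar>c\<bar> = 1\<close>.

  If \<open>\<bar>c\<bar> = 1\<close> there is equality in the triangle inequality, which forces \<open>f\<^sup>*q = (deg f/c) q\<close>.
  Comparing orders, \<open>q\<close> has order \<open>0\<close> or \<open>-1\<close> at some fixed point with nonzero multiplier.
  Integrating \<open>\<surd>q\<close> there and extending by \<open>f\<close> gives \<open>\<phi> : \<complex> \<rightarrow> sphere\<close> with \<open>\<phi>(\<rho>z) = f(\<phi>(z))\<close>,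
  \<open>\<phi>\<^sup>*q = dz\<^sup>2\<close> and \<open>\<rho>\<^sup>2 = deg f/c\<close>.  Fibres of \<open>\<phi>\<close> are at most two orbits of its group of periods
  \<open>\<Lambda>\<close>, and finiteness of the area makes \<open>\<Lambda>\<close> a lattice, so \<open>f\<close> is a Lattes map.  Finally
  \<open>\<rho>\<Lambda> \<subseteq> \<Lambda>\<close> makes the trace \<open>\<rho> + cnj \<rho>\<close> an integer when \<open>c\<close> is not real; then \<open>c = cnj \<rho>/\<rho>\<close> has
  rational, hence integral, trace of modulus less than \<open>2\<close>.
\<close>

subsection \<open>Change of variables for finite-to-one holomorphic maps\<close>


text \<open>The area bound must be available for every conjugate of the eigenvalue. Hence the
  analysis is carried out for bare polynomials \<open>P\<close>, \<open>Q\<close>, \<open>N\<close>,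
  \<open>M\<close> under conditions that a field embedding preserves: coprimality, a squarefree
  \<open>M\<close>, a degree gap, and an identity off a finite set.

  An embedding is in general discontinuous and is only built on a countable field \<open>K\<close>,
  so the eigenvalue equation cannot be transported at arbitrary points. It is transported at points
  of \<open>K\<close> fixed by the embedding, where algebraic closedness keeps the fibre inside
  \<open>K\<close>, and then spread over the plane by the identity theorem; this is why the
  pushforward is shown to be holomorphic off a finite set. Countability leaves room in the plane for
  the image of each new transcendental element.

  The factor \<open>deg f / c\<close> reflects
  \<open>f\<^sub>* f\<^sup>* q = deg f \<cdot> q\<close>: the summands of the pushforward at
  \<open>y\<close> turn out to be equal, so each is the \<open>deg f\<close>-th part of
  \<open>c q(y)\<close>. The "two" in "at most two orbits" is the choice of sign of
  \<surd>q.\<close>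

definition vec_to_complex :: "real^2 \<Rightarrow> complex" where
  "vec_to_complex v = Complex (vec_nth v 1) (vec_nth v 2)"

definition complex_to_vec :: "complex \<Rightarrow> real^2" where
  "complex_to_vec z = vector [Re z, Im z]"

lemma vec_to_complex_inverse [simp]: "complex_to_vec (vec_to_complex v) = v"
  by (simp add: vec_to_complex_def complex_to_vec_def vec_eq_iff forall_2)

lemma complex_to_vec_inverse [simp]: "vec_to_complex (complex_to_vec z) = z"
  by (simp add: vec_to_complex_def complex_to_vec_def)

lemma linear_vec_to_complex: "linear vec_to_complex"
  by (rule linearI) (auto simp: vec_to_complex_def complex_eq_iff)

lemma linear_complex_to_vec: "linear complex_to_vec"
  by (rule linearI) (auto simp: complex_to_vec_def vec_eq_iff forall_2)

lemma bounded_linear_vec_to_complex: "bounded_linear vec_to_complex"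
  using linear_vec_to_complex by (rule linear_conv_bounded_linear[THEN iffD1])

lemma bounded_linear_complex_to_vec: "bounded_linear complex_to_vec"
  using linear_complex_to_vec by (rule linear_conv_bounded_linear[THEN iffD1])

lemma vec_to_complex_measurable [measurable]: "vec_to_complex \<in> borel_measurable borel"
  by (intro borel_measurable_continuous_onI linear_continuous_on bounded_linear_vec_to_complex)

lemma complex_to_vec_measurable [measurable]: "complex_to_vec \<in> borel_measurable borel"
  by (intro borel_measurable_continuous_onI linear_continuous_on bounded_linear_complex_to_vec)

text \<open>The Jacobian formula for differentiable images is stated on \<open>real^2\<close>;
  equality of the two Lebesgue measures, checked on boxes, carries it over to the complex
  plane.\<close>

lemma distr_vec_to_complex: "distr lborel borel vec_to_complex = lborel"
proof (rule lborel_eqI[symmetric])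
  fix l u :: complex
  assume le: "\<And>b. b \<in> Basis \<Longrightarrow> l \<bullet> b \<le> u \<bullet> b"
  have eq: "vec_to_complex -` box l u = box (complex_to_vec l) (complex_to_vec u)"
    by (auto simp: vec_to_complex_def complex_to_vec_def mem_box_cart forall_2 in_box_complex_iff)
  have le2: "Re l \<le> Re u" "Im l \<le> Im u"
    using le[of 1] le[of \<i>] by (auto simp: Basis_complex_def inner_complex_def)
  have "emeasure (distr lborel borel vec_to_complex) (box l u)
      = emeasure lborel (box (complex_to_vec l) (complex_to_vec u))"
    by (subst emeasure_distr) (auto simp: eq)
  also have "\<dots> = (\<Prod>b\<in>Basis. (complex_to_vec u - complex_to_vec l) \<bullet> b)"
  proof (rule emeasure_lborel_box)
    fix b :: "real^2" assume "b \<in> Basis"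
    then obtain i where "b = axis i 1" by (auto simp: Basis_vec_def)
    then show "complex_to_vec l \<bullet> b \<le> complex_to_vec u \<bullet> b"
      using le2 exhaust_2[of i] by (auto simp: complex_to_vec_def inner_axis)
  qed
  also have "(Basis :: (real^2) set) = {axis 1 1, axis 2 1}"
    by (auto simp: Basis_vec_def) (metis exhaust_2)
  also have "(\<Prod>b\<in>{axis 1 1, axis 2 1}. (complex_to_vec u - complex_to_vec l) \<bullet> b) = (\<Prod>b\<in>Basis. (u - l) \<bullet> b)"
    by (simp add: axis_eq_axis Basis_complex_def inner_axis complex_to_vec_def inner_complex_def)
  finally show "emeasure (distr lborel borel vec_to_complex) (box l u) = (\<Prod>b\<in>Basis. (u - l) \<bullet> b)" .
qed simp

lemma emeasure_lborel_complex_to_vec_image: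
  assumes "A \<in> sets borel"
  shows "emeasure lborel (complex_to_vec ` A) = emeasure lborel A"
proof -
  have "complex_to_vec ` A = vec_to_complex -` A \<inter> space lborel"
    by (auto simp: image_iff) (metis vec_to_complex_inverse)
  moreover have "emeasure lborel A = emeasure (distr lborel borel vec_to_complex) A"
    by (simp add: distr_vec_to_complex)
  ultimately show ?thesis
    using assms by (simp add: emeasure_distr)
qed

lemma sets_complex_to_vec_image:
  assumes "A \<in> sets borel"
  shows "complex_to_vec ` A \<in> sets borel"
proof -
  have "complex_to_vec ` A = vec_to_complex -` A \<inter> space borel"
    by (auto simp: image_iff) (metis vec_to_complex_inverse)
  then show ?thesis using assms by (metis measurable_sets vec_to_complex_measurable)
qed

text \<open>The real derivative of \<open>g\<close> is multiplication by the complex number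
  \<open>g'\<close>, whose determinant is \<open>|g'|^2\<close>. Both sides may be infinite.\<close>

lemma emeasure_holomorphic_image:
  assumes hol: "g holomorphic_on V" and V: "open V" and inj: "inj_on g V"
    and S: "S \<subseteq> V" "S \<in> sets borel" and gS: "g ` S \<in> sets borel"
  shows "emeasure lborel (g ` S) = (\<integral>\<^sup>+x. ennreal ((cmod (deriv g x))\<^sup>2) * indicator S x \<partial>lborel)"
proof -
  define f where "f = complex_to_vec \<circ> g \<circ> vec_to_complex"
  define f' where "f' v = complex_to_vec \<circ> (\<lambda>h. deriv g (vec_to_complex v) * vec_to_complex h)" for v
  define T where "T = complex_to_vec ` S"
  define J where "J v = (cmod (deriv g (vec_to_complex v)))\<^sup>2" for v
  have der: "(f has_derivative f' v) (at v within T)" if "v \<in> T" for v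
  proof -
    from that S have v: "vec_to_complex v \<in> V" by (auto simp: T_def)
    have "(g has_field_derivative deriv g (vec_to_complex v)) (at (vec_to_complex v))"
      using hol V v by (rule holomorphic_derivI)
    then have "(g has_derivative (*) (deriv g (vec_to_complex v))) (at (vec_to_complex v))"
      by (simp add: has_field_derivative_def)
    from diff_chain_at[OF bounded_linear_imp_has_derivative[OF bounded_linear_vec_to_complex] this]
    have "((g \<circ> vec_to_complex) has_derivative (\<lambda>h. deriv g (vec_to_complex v) * vec_to_complex h)) (at v)"
      by (simp add: o_def)
    from diff_chain_at[OF this bounded_linear_imp_has_derivative[OF bounded_linear_complex_to_vec]]
    show ?thesis unfolding f_def f'_def by (simp add: o_assoc has_derivative_at_withinI)
  qed
  have injf: "inj_on f T"
    unfolding f_def T_def inj_on_def using inj S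
    by (auto simp: inj_on_def) (metis complex_to_vec_inverse subsetD)
  have det: "\<bar>det (matrix (f' v))\<bar> = J v" for v
    unfolding det_2 matrix_def f'_def J_def
    by (auto simp: complex_to_vec_def vec_to_complex_def axis_def cmod_power2)
       (simp add: power2_eq_square)
  have T: "T \<in> sets borel" unfolding T_def by (rule sets_complex_to_vec_image) fact
  then have Tl: "T \<in> sets lebesgue" by simp
  have fT: "f ` T = complex_to_vec ` (g ` S)"
    unfolding f_def T_def by (simp add: image_comp o_def)
  have fTb: "f ` T \<in> sets borel" unfolding fT by (rule sets_complex_to_vec_image) fact
  note H = has_measure_differentiable_image[OF Tl der injf, unfolded det]
  define I where "I = (\<integral>\<^sup>+x. ennreal ((cmod (deriv g x))\<^sup>2) * indicator S x \<partial>lborel)"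
  have Jm: "(\<lambda>v. indicator T v * J v) \<in> borel_measurable borel"
  proof -
    have "(\<lambda>x. indicator S x * (cmod (deriv g x))\<^sup>2) \<in> borel_measurable borel"
    proof -
      have "continuous_on S (\<lambda>x. (cmod (deriv g x))\<^sup>2)"
        by (intro continuous_intros holomorphic_on_imp_continuous_on
             holomorphic_on_subset[OF holomorphic_deriv[OF hol V] S(1)])
      from borel_measurable_continuous_on_indicator[OF S(2) this]
      show ?thesis by simp
    qed
    then have "(\<lambda>v. (\<lambda>x. indicator S x * (cmod (deriv g x))\<^sup>2) (vec_to_complex v)) \<in> borel_measurable borel"
      by measurable
    also have "(\<lambda>v. (\<lambda>x. indicator S x * (cmod (deriv g x))\<^sup>2) (vec_to_complex v)) = (\<lambda>v. indicator T v * J v)"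
      by (auto simp: fun_eq_iff J_def T_def indicator_def image_iff)
    finally show ?thesis .
  qed
  have I: "I = (\<integral>\<^sup>+v. ennreal (indicator T v * J v) \<partial>lborel)"
  proof -
    have "I = (\<integral>\<^sup>+x. ennreal (indicator S x * (cmod (deriv g x))\<^sup>2) \<partial>distr lborel borel vec_to_complex)"
      unfolding I_def distr_vec_to_complex
      by (intro nn_integral_cong) (auto simp: indicator_def)
    also have "\<dots> = (\<integral>\<^sup>+v. ennreal (indicator S (vec_to_complex v) * (cmod (deriv g (vec_to_complex v)))\<^sup>2) \<partial>lborel)"
    proof -
      have "continuous_on S (\<lambda>x. (cmod (deriv g x))\<^sup>2)"
        by (intro continuous_intros holomorphic_on_imp_continuous_on
             holomorphic_on_subset[OF holomorphic_deriv[OF hol V] S(1)])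
      from borel_measurable_continuous_on_indicator[OF S(2) this]
      have "(\<lambda>x. ennreal (indicator S x * (cmod (deriv g x))\<^sup>2)) \<in> borel_measurable borel" by simp
      then show ?thesis by (subst nn_integral_distr) auto
    qed
    also have "\<dots> = (\<integral>\<^sup>+v. ennreal (indicator T v * J v) \<partial>lborel)"
    proof (rule nn_integral_cong)
      fix v
      have "indicator S (vec_to_complex v) = (indicator T v :: real)"
        by (auto simp: T_def indicator_def image_iff)
      then show "ennreal (indicator S (vec_to_complex v) * (cmod (deriv g (vec_to_complex v)))\<^sup>2)
          = ennreal (indicator T v * J v)" by (simp add: J_def)
    qed
    finally show ?thesis .
  qed
  have ind: "(\<lambda>v. indicator T v * J v) = (\<lambda>v. if v \<in> T then J v else 0)"
    by (auto simp: indicator_def)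
  have E: "emeasure lborel (g ` S) = emeasure lborel (f ` T)"
    unfolding fT using gS by (simp add: emeasure_lborel_complex_to_vec_image)
  have "emeasure lborel (f ` T) = I"
  proof (cases "I < \<infinity>")
    case True
    then obtain r where r: "I = ennreal r" "0 \<le> r" by (cases I rule: ennreal_cases) auto
    have "((\<lambda>v. indicator T v * J v) has_integral r) UNIV"
      by (rule nn_integral_has_integral[OF Jm]) (use r I in \<open>auto simp: J_def\<close>)
    then have "(J has_integral r) T"
      unfolding ind by (subst (asm) has_integral_restrict_UNIV)
    with H[of r] have "f ` T \<in> lmeasurable" "measure lebesgue (f ` T) = r" by auto
    then have "emeasure lebesgue (f ` T) = ennreal r"
      by (metis emeasure_eq_measure2 fmeasurableD2 fmeasurableD emeasure_eq_ennreal_measure top.not_eq_extremum less_top)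
    then show ?thesis using r fTb by simp
  next
    case False
    \<comment> \<open>A finite measure would make the image \<open>lmeasurable\<close>, and the
      equivalence \<open>H\<close> would then give the Jacobian a finite integral.\<close>
    have "emeasure lborel (f ` T) = \<infinity>"
    proof (rule ccontr)
      assume "\<not> ?thesis"
      then have "f ` T \<in> lmeasurable"
        using fTb by (auto simp: fmeasurable_def top.not_eq_extremum)
      with H[of "measure lebesgue (f ` T)"] have *: "(J has_integral measure lebesgue (f ` T)) T" by auto
      have "((\<lambda>v. indicator T v * J v) has_integral measure lebesgue (f ` T)) UNIV"
        unfolding ind using * by (subst has_integral_restrict_UNIV)
      from nn_integral_has_integral_lborel[OF Jm _ this] have "I = ennreal (measure lebesgue (f ` T))"
        unfolding I by (auto simp: J_def)
      with False show False by simp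
    qed
    with False show ?thesis by (simp add: less_top[symmetric])
  qed
  with E show ?thesis by (simp add: I_def)
qed


text \<open>The inverse is holomorphic on the open image; extended by 0 it is a total measurable
  function, and images of Borel sets become preimages under it.\<close>

lemma holomorphic_inj_image_facts:
  assumes hol: "g holomorphic_on V" and V: "open V" and inj: "inj_on g V"
  defines "k \<equiv> (\<lambda>y. if y \<in> g ` V then the_inv_into V g y else 0)"
  shows "k \<in> borel_measurable borel" "A \<in> sets borel \<Longrightarrow> A \<subseteq> V \<Longrightarrow> g ` A \<in> sets borel"
proof -
  obtain k0 where k0: "k0 holomorphic_on (g ` V)" "\<And>z. z \<in> V \<Longrightarrow> k0 (g z) = z"
    using holomorphic_has_inverse[OF hol V inj] by metis
  have op: "open (g ` V)" using open_mapping_thm3[OF hol V inj] .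
  have keq: "k = (\<lambda>y. if y \<in> g ` V then k0 y else 0)"
    using k0 inj by (auto simp: k_def the_inv_into_f_f fun_eq_iff)
  have "(\<lambda>y. indicator (g ` V) y *\<^sub>R k0 y) \<in> borel_measurable borel"
    using op k0(1) by (intro borel_measurable_continuous_on_indicator holomorphic_on_imp_continuous_on) auto
  also have "(\<lambda>y. indicator (g ` V) y *\<^sub>R k0 y) = k"
    unfolding keq by (auto simp: indicator_def fun_eq_iff)
  finally show km: "k \<in> borel_measurable borel" .
  show "g ` A \<in> sets borel" if A: "A \<in> sets borel" "A \<subseteq> V"
  proof -
    have "g ` A = g ` V \<inter> (k -` A \<inter> space borel)"
      using A k0 unfolding keq by auto
    also have "\<dots> \<in> sets borel"
      using measurable_sets[OF km A(1)] op by (intro sets.Int) auto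
    finally show ?thesis .
  qed
qed

text \<open>Passage from sets to functions: the measure with density \<open>|g'|^2\<close> on
  \<open>S\<close> is pushed forward by \<open>g\<close> to Lebesgue measure on the image of
  \<open>S\<close>. The default value 0 of the inverse is hidden by the indicator.\<close>

lemma nn_integral_holomorphic_inj:
  assumes hol: "g holomorphic_on V" and V: "open V" and inj: "inj_on g V"
    and S: "S \<subseteq> V" "S \<in> sets borel" and h [measurable]: "h \<in> borel_measurable borel"
  defines "\<phi> \<equiv> (\<lambda>y. h (if y \<in> g ` V then the_inv_into V g y else 0) * indicator (g ` S) y)"
  shows "(\<integral>\<^sup>+x. h x * ennreal ((cmod (deriv g x))\<^sup>2) * indicator S x \<partial>lborel) = (\<integral>\<^sup>+y. \<phi> y \<partial>lborel)"
    and "\<phi> \<in> borel_measurable borel"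
proof -
  define k where "k = (\<lambda>y. if y \<in> g ` V then the_inv_into V g y else 0)"
  note facts = holomorphic_inj_image_facts[OF hol V inj, folded k_def]
  note [measurable] = facts(1) S(2)
  have gS [measurable]: "g ` S \<in> sets borel" using facts(2) S by blast
  have "\<phi> = (\<lambda>y. h (k y) * indicator (g ` S) y)" by (simp add: \<phi>_def k_def)
  then show "\<phi> \<in> borel_measurable borel" by simp
  define J where "J x = ennreal ((cmod (deriv g x))\<^sup>2) * indicator S x" for x
  have J [measurable]: "J \<in> borel_measurable borel"
  proof -
    have "continuous_on S (\<lambda>x. (cmod (deriv g x))\<^sup>2)"
      by (intro continuous_intros holomorphic_on_imp_continuous_on
          holomorphic_on_subset[OF holomorphic_deriv[OF hol V] S(1)])
    from borel_measurable_continuous_on_indicator[OF S(2) this]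
    have "(\<lambda>x. ennreal (indicator S x *\<^sub>R (cmod (deriv g x))\<^sup>2)) \<in> borel_measurable borel" by simp
    also have "(\<lambda>x. ennreal (indicator S x *\<^sub>R (cmod (deriv g x))\<^sup>2)) = J"
      by (auto simp: J_def indicator_def)
    finally show ?thesis .
  qed
  define G where "G = (\<lambda>x. indicator V x *\<^sub>R g x)"
  have G [measurable]: "G \<in> borel_measurable borel"
    unfolding G_def using V hol
    by (intro borel_measurable_continuous_on_indicator holomorphic_on_imp_continuous_on) auto
  have eq: "distr (density lborel J) borel G = density lborel (indicator (g ` S))"
  proof (rule measure_eqI)
    fix A assume "A \<in> sets (distr (density lborel J) borel G)"
    then have A [measurable]: "A \<in> sets borel" by simp
    define B where "B = S \<inter> (G -` A \<inter> space borel)"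
    have B: "B \<in> sets borel" "B \<subseteq> V"
      unfolding B_def using S measurable_sets[OF G A] by auto
    have gB: "g ` B = A \<inter> g ` S" using S unfolding B_def G_def by (auto simp: indicator_def)
    have "emeasure (distr (density lborel J) borel G) A = emeasure (density lborel J) (G -` A \<inter> space borel)"
      by (subst emeasure_distr) auto
    also have "\<dots> = (\<integral>\<^sup>+x. J x * indicator (G -` A \<inter> space borel) x \<partial>lborel)"
      by (subst emeasure_density) (use measurable_sets[OF G A] in auto)
    also have "\<dots> = (\<integral>\<^sup>+x. ennreal ((cmod (deriv g x))\<^sup>2) * indicator B x \<partial>lborel)"
      by (intro nn_integral_cong) (auto simp: J_def B_def indicator_def)
    also have "\<dots> = emeasure lborel (g ` B)"
      using emeasure_holomorphic_image[OF hol V inj B(2,1) facts(2)[OF B]] by simp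
    also have "\<dots> = emeasure (density lborel (indicator (g ` S))) A"
      unfolding gB by (subst emeasure_density) (auto simp: indicator_inter_arith[symmetric] Int_commute)
    finally show "emeasure (distr (density lborel J) borel G) A = emeasure (density lborel (indicator (g ` S))) A" .
  qed simp
  have "(\<integral>\<^sup>+y. \<phi> y \<partial>lborel) = (\<integral>\<^sup>+y. h (k y) \<partial>density lborel (indicator (g ` S)))"
    unfolding \<open>\<phi> = (\<lambda>y. h (k y) * indicator (g ` S) y)\<close>
    by (subst nn_integral_density) (auto simp: mult.commute)
  also have "\<dots> = (\<integral>\<^sup>+x. h (k (G x)) \<partial>density lborel J)"
    unfolding eq[symmetric] by (subst nn_integral_distr) auto
  also have "\<dots> = (\<integral>\<^sup>+x. J x * h (k (G x)) \<partial>lborel)"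
    by (subst nn_integral_density) auto
  also have "\<dots> = (\<integral>\<^sup>+x. h x * ennreal ((cmod (deriv g x))\<^sup>2) * indicator S x \<partial>lborel)"
    using S inj by (intro nn_integral_cong)
      (auto simp: J_def indicator_def G_def k_def the_inv_into_f_f subset_iff mult.commute)
  finally show "(\<integral>\<^sup>+x. h x * ennreal ((cmod (deriv g x))\<^sup>2) * indicator S x \<partial>lborel) = (\<integral>\<^sup>+y. \<phi> y \<partial>lborel)" ..
qed

section \<open>Integration over fibres\<close>

definition fibre_integral ::
  "complex set \<Rightarrow> (complex \<Rightarrow> complex) \<Rightarrow> (complex \<Rightarrow> ennreal) \<Rightarrow> complex \<Rightarrow> ennreal" where
  "fibre_integral U g h y = (\<integral>\<^sup>+x. h x * indicator {x\<in>U. g x = y} x \<partial>count_space UNIV)"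

text \<open>The area formula with multiplicity. By Lindelof, \<open>U\<close> is a countable union
  of open sets on which \<open>g\<close> is injective; cutting \<open>S\<close> into disjoint Borel
  pieces subordinate to them reduces to the injective case. Summation by counting measure admits
  infinite fibres and commutes with the sum over the pieces.\<close>

lemma nn_integral_fibre_integral:
  assumes hol: "g holomorphic_on U" and U: "open U" and nz: "\<And>x. x \<in> U \<Longrightarrow> deriv g x \<noteq> 0"
    and S: "S \<in> sets borel" "S \<subseteq> U"
    and h [measurable]: "h \<in> borel_measurable borel"
  shows "(\<integral>\<^sup>+x. h x * ennreal ((cmod (deriv g x))\<^sup>2) * indicator S x \<partial>lborel)
           = (\<integral>\<^sup>+y. fibre_integral S g h y \<partial>lborel)"
    and "fibre_integral S g h \<in> borel_measurable borel"
proof -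
  define F where "F = {V. open V \<and> V \<subseteq> U \<and> inj_on g V}"
  have "\<Union>F = U"
  proof
    show "U \<subseteq> \<Union>F"
    proof
      fix x assume x: "x \<in> U"
      obtain r where "r > 0" "ball x r \<subseteq> U" "inj_on g (ball x r)"
        using has_complex_derivative_locally_injective[OF hol x U nz[OF x]] by metis
      then show "x \<in> \<Union>F" unfolding F_def by (intro UnionI[of "ball x r"]) auto
    qed
  qed (auto simp: F_def)
  moreover obtain F' where F': "F' \<subseteq> F" "countable F'" "\<Union>F' = \<Union>F"
    using Lindelof[of F] F_def by auto
  \<comment> \<open>The empty set is inserted so that the countable subcover is non-empty, as its
    enumeration by \<open>from_nat_into\<close> requires.\<close>
  ultimately have "\<Union>(insert {} F') = U" by simp
  define V where "V = from_nat_into (insert {} F')"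
  have ran: "range V = insert {} F'"
    unfolding V_def using F'(2) by (intro range_from_nat_into) auto
  have V: "open (V n)" "V n \<subseteq> U" "inj_on g (V n)" for n
  proof -
    have "V n \<in> insert {} F'" using ran by auto
    then have "V n = {} \<or> V n \<in> F" using F'(1) by auto
    then show "open (V n)" "V n \<subseteq> U" "inj_on g (V n)" by (auto simp: F_def)
  qed
  have UV: "(\<Union>n. V n) = U" using ran \<open>\<Union>(insert {} F') = U\<close> by simp
  define A where "A n = disjointed V n \<inter> S" for n
  have disj: "disjoint_family A"
    using disjoint_family_disjointed[of V] by (auto simp: A_def disjoint_family_on_def)
  have UA: "(\<Union>n. A n) = S" unfolding A_def using UN_disjointed_eq[of V] UV S(2) by auto
  have AV: "A n \<subseteq> V n" for n using disjointed_subset[of V n] by (auto simp: A_def)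
  have Ab [measurable]: "A n \<in> sets borel" for n
    unfolding A_def using sets.range_disjointed_sets[of V borel] V(1) S(1) by (auto simp: image_subset_iff)
  have holV: "g holomorphic_on V n" for n using hol V(2) holomorphic_on_subset by blast
  define \<phi> where "\<phi> n y = h (if y \<in> g ` V n then the_inv_into (V n) g y else 0) * indicator (g ` A n) y" for n y
  note inj = nn_integral_holomorphic_inj[OF holV V(1) V(3) AV Ab h]
  have \<phi>m [measurable]: "\<phi> n \<in> borel_measurable borel" for n
    using inj(2)[of n] by (simp add: \<phi>_def[abs_def])
  have ind: "indicator S x = (\<Sum>n. indicator (A n) x :: ennreal)" for x
    using suminf_indicator[OF disj, of x] UA by simp
  have \<phi>eq: "\<phi> n y = (\<integral>\<^sup>+x. h x * indicator {x\<in>A n. g x = y} x \<partial>count_space UNIV)" for n y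
  proof (cases "y \<in> g ` A n")
    case True
    then obtain x where x: "x \<in> A n" "g x = y" by auto
    with AV V(3)[of n] have eq: "{x\<in>A n. g x = y} = {x}" by (auto simp: inj_on_def subset_iff)
    have "(\<integral>\<^sup>+x. h x * indicator {x\<in>A n. g x = y} x \<partial>count_space UNIV) = h x"
      unfolding eq by (subst nn_integral_indicator_singleton) auto
    moreover have "the_inv_into (V n) g y = x"
      using x AV V(3)[of n] the_inv_into_f_f[of g "V n" x] by auto
    ultimately show ?thesis using True AV by (auto simp: \<phi>_def)
  next
    case False
    then have "{x\<in>A n. g x = y} = {}" by auto
    then show ?thesis using False by (simp add: \<phi>_def)
  qed
  have Feq: "fibre_integral S g h y = (\<Sum>n. \<phi> n y)" for y
  proof -
    have "fibre_integral S g h y = (\<integral>\<^sup>+x. (\<Sum>n. h x * indicator {x\<in>A n. g x = y} x) \<partial>count_space UNIV)"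
      unfolding fibre_integral_def
    proof (intro nn_integral_cong)
      fix x
      have "indicator {x\<in>S. g x = y} x = indicator S x * (indicator {x. g x = y} x :: ennreal)"
        by (auto simp: indicator_def)
      also have "\<dots> = (\<Sum>n. indicator (A n) x * indicator {x. g x = y} x)"
        unfolding ind by simp
      also have "(\<lambda>n. indicator (A n) x * indicator {x. g x = y} x) = (\<lambda>n. indicator {x\<in>A n. g x = y} x :: ennreal)"
        by (auto simp: indicator_def)
      finally show "h x * indicator {x\<in>S. g x = y} x = (\<Sum>n. h x * indicator {x\<in>A n. g x = y} x)"
        by simp
    qed
    also have "\<dots> = (\<Sum>n. \<phi> n y)"
      unfolding \<phi>eq by (rule nn_integral_suminf) auto
    finally show ?thesis .
  qed
  show "fibre_integral S g h \<in> borel_measurable borel"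
    unfolding Feq[abs_def] by measurable
  have Jm: "(\<lambda>x. h x * ennreal ((cmod (deriv g x))\<^sup>2) * indicator (A n) x) \<in> borel_measurable lborel" for n
  proof -
    have "continuous_on (A n) (\<lambda>x. (cmod (deriv g x))\<^sup>2)"
      by (intro continuous_intros holomorphic_on_imp_continuous_on
          holomorphic_on_subset[OF holomorphic_deriv[OF hol U]]) (use AV V in blast)
    from borel_measurable_continuous_on_indicator[OF Ab this]
    have "(\<lambda>x. h x * ennreal (indicator (A n) x *\<^sub>R (cmod (deriv g x))\<^sup>2)) \<in> borel_measurable borel" by simp
    also have "(\<lambda>x. h x * ennreal (indicator (A n) x *\<^sub>R (cmod (deriv g x))\<^sup>2))
       = (\<lambda>x. h x * ennreal ((cmod (deriv g x))\<^sup>2) * indicator (A n) x)"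
      by (auto simp: indicator_def)
    finally show ?thesis by simp
  qed
  have "(\<integral>\<^sup>+x. h x * ennreal ((cmod (deriv g x))\<^sup>2) * indicator S x \<partial>lborel)
      = (\<integral>\<^sup>+x. (\<Sum>n. h x * ennreal ((cmod (deriv g x))\<^sup>2) * indicator (A n) x) \<partial>lborel)"
    unfolding ind by simp
  also have "\<dots> = (\<Sum>n. \<integral>\<^sup>+x. h x * ennreal ((cmod (deriv g x))\<^sup>2) * indicator (A n) x \<partial>lborel)"
    by (rule nn_integral_suminf) (rule Jm)
  also have "\<dots> = (\<Sum>n. \<integral>\<^sup>+y. \<phi> n y \<partial>lborel)"
    unfolding inj(1) \<phi>_def ..
  also have "\<dots> = (\<integral>\<^sup>+y. (\<Sum>n. \<phi> n y) \<partial>lborel)"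
    by (rule nn_integral_suminf[symmetric]) simp
  finally show "(\<integral>\<^sup>+x. h x * ennreal ((cmod (deriv g x))\<^sup>2) * indicator S x \<partial>lborel)
           = (\<integral>\<^sup>+y. fibre_integral S g h y \<partial>lborel)"
    by (simp add: Feq)
qed

subsection \<open>Integrability of rational functions with simple poles\<close>


text \<open>Every point of \<open>T\<close> has at least one preimage in \<open>U\<close>, so
  \<open>k\<close> is at most its sum over the fibre. Only a bound is wanted, so the substitution
  \<open>g\<close> may cover \<open>T\<close> several times.\<close>

lemma nn_integral_image_le:
  assumes hol: "g holomorphic_on U" and U: "open U" and nz: "\<And>x. x \<in> U \<Longrightarrow> deriv g x \<noteq> 0"
    and k [measurable]: "k \<in> borel_measurable borel" and T: "T \<subseteq> g ` U"
  shows "(\<integral>\<^sup>+y. k y * indicator T y \<partial>lborel)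
           \<le> (\<integral>\<^sup>+x. k (g x) * ennreal ((cmod (deriv g x))\<^sup>2) * indicator U x \<partial>lborel)"
proof -
  \<comment> \<open>Truncation by the indicator makes the composite Borel on the whole plane;
    \<open>g\<close> is controlled only on \<open>U\<close>.\<close>
  define h where "h x = k (indicator U x *\<^sub>R g x)" for x
  have [measurable]: "(\<lambda>x. indicator U x *\<^sub>R g x) \<in> borel_measurable borel"
    using U hol by (intro borel_measurable_continuous_on_indicator holomorphic_on_imp_continuous_on) auto
  have h: "h \<in> borel_measurable borel" unfolding h_def by measurable
  have "(\<integral>\<^sup>+y. k y * indicator T y \<partial>lborel) \<le> (\<integral>\<^sup>+y. fibre_integral U g h y \<partial>lborel)"
  proof (intro nn_integral_mono)
    fix y
    show "k y * indicator T y \<le> fibre_integral U g h y"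
    proof (cases "y \<in> T")
      case True
      then obtain x where x: "x \<in> U" "g x = y" using T by auto
      have "k y = (\<integral>\<^sup>+x'. h x' * indicator {x} x' \<partial>count_space UNIV)"
        using x by (subst nn_integral_indicator_singleton) (auto simp: h_def)
      also have "\<dots> \<le> fibre_integral U g h y"
        unfolding fibre_integral_def using x
        by (intro nn_integral_mono mult_left_mono) (auto simp: indicator_def)
      finally show ?thesis using True by simp
    qed simp
  qed
  also have "\<dots> = (\<integral>\<^sup>+x. h x * ennreal ((cmod (deriv g x))\<^sup>2) * indicator U x \<partial>lborel)"
    using nn_integral_fibre_integral(1)[OF hol U nz _ _ h, of U] U by simp
  also have "\<dots> = (\<integral>\<^sup>+x. k (g x) * ennreal ((cmod (deriv g x))\<^sup>2) * indicator U x \<partial>lborel)"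
    by (intro nn_integral_cong) (auto simp: h_def indicator_def)
  finally show ?thesis .
qed

text \<open>The substitution \<open>z = a + w^2\<close> has Jacobian \<open>4 |w|^2\<close>, which
  turns the density \<open>1 / |z - a|\<close> into the constant 4 on a bounded disc.\<close>

lemma nn_integral_inverse_norm_ball_finite:
  "(\<integral>\<^sup>+z. ennreal (1 / cmod (z - a)) * indicator (ball a r - {a}) z \<partial>lborel) < \<infinity>"
proof -
  define U where "U = ball (0::complex) (sqrt r) - {0}"
  have "(\<integral>\<^sup>+z. ennreal (1 / cmod (z - a)) * indicator (ball a r - {a}) z \<partial>lborel)
     \<le> (\<integral>\<^sup>+w. ennreal (1 / cmod ((a + w\<^sup>2) - a)) * ennreal ((cmod (deriv (\<lambda>w. a + w\<^sup>2) w))\<^sup>2) * indicator U w \<partial>lborel)"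
  proof (rule nn_integral_image_le)
    show "ball a r - {a} \<subseteq> (\<lambda>w. a + w\<^sup>2) ` U"
    proof
      fix z assume z: "z \<in> ball a r - {a}"
      have "z = a + (csqrt (z - a))\<^sup>2" by simp
      moreover have "csqrt (z - a) \<in> U"
        using z by (auto simp: U_def norm_csqrt dist_norm norm_minus_commute)
      ultimately show "z \<in> (\<lambda>w. a + w\<^sup>2) ` U" by blast
    qed
    show "deriv (\<lambda>w. a + w\<^sup>2) w \<noteq> 0" if "w \<in> U" for w
    proof -
      have "deriv (\<lambda>w. a + w\<^sup>2) w = 2 * w"
        by (rule DERIV_imp_deriv) (auto intro!: derivative_eq_intros)
      with that show ?thesis by (simp add: U_def)
    qed
  qed (auto simp: U_def intro!: holomorphic_intros)
  also have "\<dots> \<le> (\<integral>\<^sup>+w. 4 * indicator U w \<partial>lborel)"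
  proof (intro nn_integral_mono)
    fix w
    have "deriv (\<lambda>w. a + w\<^sup>2) w = 2 * w"
      by (rule DERIV_imp_deriv) (auto intro!: derivative_eq_intros)
    then show "ennreal (1 / cmod ((a + w\<^sup>2) - a)) * ennreal ((cmod (deriv (\<lambda>w. a + w\<^sup>2) w))\<^sup>2) * indicator U w
        \<le> 4 * indicator U w"
      by (auto simp: U_def indicator_def norm_mult norm_power ennreal_mult[symmetric] power_mult_distrib)
  qed
  also have "\<dots> = 4 * emeasure lborel U"
    by (subst nn_integral_cmult_indicator) (auto simp: U_def)
  also have "\<dots> < \<infinity>"
    using emeasure_bounded_finite[of U] by (auto simp: U_def ennreal_mult_less_top bounded_subset[OF bounded_ball])
  finally show ?thesis .
qed

text \<open>The substitution \<open>z = 1 / w\<close> has Jacobian \<open>|w|^(-4)\<close> and turns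
  \<open>|z|^(-3)\<close> into \<open>|w|^(-1)\<close> near 0, the case just treated.\<close>

lemma nn_integral_inverse_cube_finite:
  assumes R: "R > 0"
  shows "(\<integral>\<^sup>+z. ennreal (1 / cmod z ^ 3) * indicator (- cball 0 R) z \<partial>lborel) < \<infinity>"
proof -
  define U where "U = ball (0::complex) (1 / R) - {0}"
  have "(\<integral>\<^sup>+z. ennreal (1 / cmod z ^ 3) * indicator (- cball 0 R) z \<partial>lborel)
     \<le> (\<integral>\<^sup>+w. ennreal (1 / cmod (1 / w) ^ 3) * ennreal ((cmod (deriv (\<lambda>w. 1 / w) w))\<^sup>2) * indicator U w \<partial>lborel)"
  proof (rule nn_integral_image_le)
    show "- cball 0 R \<subseteq> (\<lambda>w. 1 / w) ` U"
    proof
      fix z assume z: "z \<in> - cball (0::complex) R"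
      then have "cmod z > R" by (simp add: not_le)
      then have "1 / z \<in> U" using R by (auto simp: U_def norm_divide intro!: divide_strict_left_mono mult_pos_pos)
      then show "z \<in> (\<lambda>w. 1 / w) ` U" by (intro image_eqI[of _ _ "1 / z"]) auto
    qed
    show "deriv (\<lambda>w. 1 / w) x \<noteq> 0" if "x \<in> U" for x
      using that by (auto simp: U_def divide_inverse)
  qed (auto simp: U_def intro!: holomorphic_intros)
  also have "\<dots> \<le> (\<integral>\<^sup>+w. ennreal (1 / cmod (w - 0)) * indicator (ball 0 (1 / R) - {0}) w \<partial>lborel)"
  proof (intro nn_integral_mono)
    fix w :: complex
    have "cmod w ^ 3 * (cmod (- inverse (w\<^sup>2)))\<^sup>2 = 1 / cmod w" if "w \<noteq> 0"
    proof -
      have "cmod (- inverse (w\<^sup>2)) = 1 / (cmod w)\<^sup>2" by (simp add: norm_inverse norm_power norm_divide inverse_eq_divide)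
      with that show ?thesis by (simp add: power2_eq_square power3_eq_cube)
    qed
    then show "ennreal (1 / cmod (1 / w) ^ 3) * ennreal ((cmod (deriv (\<lambda>w. 1 / w) w))\<^sup>2) * indicator U w
        \<le> ennreal (1 / cmod (w - 0)) * indicator (ball 0 (1 / R) - {0}) w"
      by (auto simp: U_def indicator_def ennreal_mult[symmetric] divide_inverse norm_inverse power_inverse)
  qed
  also have "\<dots> < \<infinity>" by (rule nn_integral_inverse_norm_ball_finite)
  finally show ?thesis .
qed


text \<open>A squarefree denominator bounds the integrand near \<open>a\<close> by a multiple of
  \<open>1 / |z - a|\<close>. The degree gap says that \<open>q dz^2\<close> has at most a simple
  pole at infinity and bounds it far out by a multiple of \<open>1 / |z|^3\<close>. Compactness of a
  disc combines the two estimates.\<close>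

lemma rational_nn_integral_finite:
  fixes N M :: "complex poly"
  assumes sq: "rsquarefree M" and deg: "degree N + 3 \<le> degree M"
  shows "(\<integral>\<^sup>+z. ennreal (cmod (poly N z / poly M z)) \<partial>lborel) < \<infinity>"
proof -
  have M0: "M \<noteq> 0" using sq by (auto simp: rsquarefree_def)
  define q where "q z = cmod (poly N z / poly M z)" for z
  have qm [measurable]: "q \<in> borel_measurable borel"
  proof -
    have "poly p \<in> borel_measurable borel" for p :: "complex poly"
      by (intro borel_measurable_continuous_onI continuous_intros)
    note [measurable] = this[of N] this[of M]
    show ?thesis unfolding q_def by measurable
  qed
  have loc: "\<exists>r>0. (\<integral>\<^sup>+z. ennreal (q z) * indicator (ball a r) z \<partial>lborel) < \<infinity>" for a
  proof -
    obtain M1 where M1: "M = [:-a, 1:] ^ order a M * M1" "\<not> [:-a, 1:] dvd M1"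
      using order_decomp[OF M0] by metis
    have nz: "poly M1 a \<noteq> 0" using M1(2) by (simp add: poly_eq_0_iff_dvd)
    have ord: "order a M \<le> 1" using sq unfolding rsquarefree_def by (metis le_numeral_extra(4) zero_le)
    define K where "K = cmod (poly N a / poly M1 a) + 1"
    have "K > 0" by (simp add: K_def add_nonneg_pos)
    have "isCont (\<lambda>z. cmod (poly N z / poly M1 z)) a" using nz by (intro continuous_intros) auto
    then have "\<forall>\<^sub>F z in at a. cmod (poly N z / poly M1 z) < K"
      unfolding isCont_def by (rule order_tendstoD) (simp add: K_def)
    then have "\<forall>\<^sub>F z in nhds a. cmod (poly N z / poly M1 z) < K"
      by (simp add: eventually_nhds_conv_at K_def)
    then obtain r where r: "r > 0" "\<And>z. dist z a < r \<Longrightarrow> cmod (poly N z / poly M1 z) < K"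
      by (auto simp: eventually_nhds_metric)
    \<comment> \<open>With radius at most 1, \<open>cmod (z - a) ^ order a M\<close> is at least
      \<open>cmod (z - a)\<close> whether the order is 0 or 1.\<close>
    define s where "s = min r 1"
    have s: "s > 0" "s \<le> r" "s \<le> 1" using r(1) by (auto simp: s_def)
    have bound: "q z \<le> K / cmod (z - a)" if z: "z \<in> ball a s - {a}" for z
    proof -
      have d: "dist z a < r" "0 < cmod (z - a)" "cmod (z - a) \<le> 1"
        using z s by (auto simp: dist_commute dist_norm norm_minus_commute)
      have "q z = cmod (poly N z / poly M1 z) / cmod (z - a) ^ order a M"
        unfolding q_def by (subst M1(1)) (simp add: norm_divide norm_mult norm_power mult.commute)
      also have "\<dots> \<le> K / cmod (z - a) ^ order a M"
        using r(2)[OF d(1)] by (intro divide_right_mono) auto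
      also have "\<dots> \<le> K / cmod (z - a)"
      proof -
        have "cmod (z - a) ^ 1 \<le> cmod (z - a) ^ order a M"
          using d ord by (intro power_decreasing) auto
        then show ?thesis using d \<open>K > 0\<close> by (intro divide_left_mono) auto
      qed
      finally show ?thesis .
    qed
    have "(\<integral>\<^sup>+z. ennreal (q z) * indicator (ball a s) z \<partial>lborel)
        \<le> (\<integral>\<^sup>+z. ennreal K * (ennreal (1 / cmod (z - a)) * indicator (ball a s - {a}) z) \<partial>lborel)"
    proof (rule nn_integral_mono_AE)
      have "AE z in lborel. z \<noteq> a" by (rule AE_lborel_singleton)
      then show "AE z in lborel. ennreal (q z) * indicator (ball a s) z
         \<le> ennreal K * (ennreal (1 / cmod (z - a)) * indicator (ball a s - {a}) z)"
      proof eventually_elim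
        case (elim z)
        show ?case
          using bound[of z] elim \<open>K > 0\<close>
          by (auto simp: indicator_def ennreal_mult[symmetric] intro!: ennreal_leI)
      qed
    qed
    also have "\<dots> = ennreal K * (\<integral>\<^sup>+z. ennreal (1 / cmod (z - a)) * indicator (ball a s - {a}) z \<partial>lborel)"
    proof (rule nn_integral_cmult)
      have [measurable]: "ball a s - {a} \<in> sets borel" by (intro borel_open) auto
      show "(\<lambda>x. ennreal (1 / cmod (x - a)) * indicator (ball a s - {a}) x) \<in> borel_measurable lborel"
        by measurable
    qed
    also have "\<dots> < \<infinity>"
      using nn_integral_inverse_norm_ball_finite[of a s] by (simp add: ennreal_mult_less_top)
    finally show ?thesis using s(1) by blast
  qed
  have "\<exists>R>0. \<exists>K\<ge>0. \<forall>z. cmod z > R \<longrightarrow> q z \<le> K * (1 / cmod z ^ 3)"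
  proof -
    \<comment> \<open>\<open>k\<close> is the limit of \<open>z^3 q(z)\<close> at infinity, zero
      unless the degree gap is exactly 3; subtracting it pushes the degree of the numerator below
      that of \<open>M\<close>.\<close>
    define A k where "A = monom 1 3 * N" and "k = coeff A (degree M) / lead_coeff M"
    define B where "B = A - smult k M"
    have "degree A \<le> degree M"
      unfolding A_def using degree_mult_le[of "monom 1 3" N] deg by (simp add: degree_monom_eq)
    then have "degree B \<le> degree M"
      unfolding B_def by (intro degree_diff_le) (auto intro: order_trans[OF degree_smult_le])
    moreover have "coeff B (degree M) = 0" using M0 by (simp add: B_def k_def)
    ultimately have "degree B < degree M"
      using deg by (metis add_gr_0 degree_0 leading_coeff_0_iff less_le_trans nat_less_le zero_less_numeral)
    from poly_divide_tendsto_0_at_infinity[OF this]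
    have "\<forall>\<^sub>F z in at_infinity. cmod (poly B z / poly M z) < 1"
      by (rule order_tendstoD[OF tendsto_norm_zero]) simp
    moreover have "\<forall>\<^sub>F z in at_infinity. poly M z \<noteq> 0"
    proof -
      have "degree M > 0" using deg by simp
      from filterlim_poly_at_infinity[OF this] show ?thesis
        by (rule eventually_mono[OF filterlim_at_infinity_imp_eventually_ne]) auto
    qed
    ultimately have "\<forall>\<^sub>F z in at_infinity. cmod (poly A z / poly M z) \<le> cmod k + 1"
    proof eventually_elim
      case (elim z)
      then have "poly A z / poly M z = k + poly B z / poly M z" by (simp add: B_def field_simps)
      then show ?case using elim norm_triangle_ineq[of k "poly B z / poly M z"] by simp
    qed
    moreover define K where "K = cmod k + 1"
    ultimately have K: "K > 0" "\<forall>\<^sub>F z in at_infinity. cmod (poly A z / poly M z) \<le> K"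
      by (auto simp: add_nonneg_pos)
    then obtain R where R: "\<And>z. cmod z \<ge> R \<Longrightarrow> cmod (poly A z / poly M z) \<le> K"
      by (auto simp: eventually_at_infinity)
    have "q z \<le> K * (1 / cmod z ^ 3)" if "cmod z > max R 1" for z
    proof -
      have pos: "0 < cmod z ^ 3" using that by (intro zero_less_power) linarith
      have "q z * cmod z ^ 3 = cmod (poly A z / poly M z)"
        by (simp add: q_def A_def poly_monom norm_mult norm_divide norm_power)
      also have "\<dots> \<le> K" using R[of z] that by simp
      finally show ?thesis using pos by (simp add: pos_le_divide_eq)
    qed
    then show ?thesis using K(1) by (intro exI[of _ "max R 1"] conjI exI[of _ K]) auto
  qed
  then obtain R K where R: "R > 0" and K: "K \<ge> 0" "\<And>z. cmod z > R \<Longrightarrow> q z \<le> K * (1 / cmod z ^ 3)" by blast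
  obtain r where r: "\<And>a. r a > 0" "\<And>a. (\<integral>\<^sup>+z. ennreal (q z) * indicator (ball a (r a)) z \<partial>lborel) < \<infinity>"
    using loc by metis
  have "cball (0::complex) R \<subseteq> (\<Union>a\<in>cball 0 R. ball a (r a))" using r(1) by auto
  then obtain A where A: "A \<subseteq> cball 0 R" "finite A" "cball (0::complex) R \<subseteq> (\<Union>a\<in>A. ball a (r a))"
    using compactE_image[OF compact_cball, of "cball 0 R" "\<lambda>a. ball a (r a)"] by (metis open_ball)
  have "(\<integral>\<^sup>+z. ennreal (q z) \<partial>lborel) \<le>
     (\<integral>\<^sup>+z. (\<Sum>a\<in>A. ennreal (q z) * indicator (ball a (r a)) z)
         + ennreal K * (ennreal (1 / cmod z ^ 3) * indicator (- cball 0 R) z) \<partial>lborel)"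
  proof (rule nn_integral_mono)
    fix z
    show "ennreal (q z) \<le> (\<Sum>a\<in>A. ennreal (q z) * indicator (ball a (r a)) z)
         + ennreal K * (ennreal (1 / cmod z ^ 3) * indicator (- cball 0 R) z)"
    proof (cases "cmod z \<le> R")
      case True
      then obtain a where a: "a \<in> A" "z \<in> ball a (r a)" using A by auto
      have "ennreal (q z) = (\<Sum>a\<in>{a}. ennreal (q z) * indicator (ball a (r a)) z)" using a by simp
      also have "\<dots> \<le> (\<Sum>a\<in>A. ennreal (q z) * indicator (ball a (r a)) z)"
        using a A by (intro sum_mono2) auto
      finally show ?thesis by (simp add: add_increasing2)
    next
      case False
      then have "ennreal (q z) \<le> ennreal K * (ennreal (1 / cmod z ^ 3) * indicator (- cball 0 R) z)"
        using K by (auto simp: ennreal_mult[symmetric] intro!: ennreal_leI)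
      then show ?thesis by (simp add: add_increasing)
    qed
  qed
  also have "\<dots> = (\<Sum>a\<in>A. \<integral>\<^sup>+z. ennreal (q z) * indicator (ball a (r a)) z \<partial>lborel)
      + ennreal K * (\<integral>\<^sup>+z. ennreal (1 / cmod z ^ 3) * indicator (- cball 0 R) z \<partial>lborel)"
  proof -
    have b [measurable]: "ball a s \<in> sets borel" "- cball 0 R \<in> sets (borel :: complex measure)" for a :: complex and s
      by (intro borel_open; auto)+
    have m [measurable]: "(\<lambda>z. ennreal (q z) * indicator (ball a (r a)) z) \<in> borel_measurable lborel"
      "(\<lambda>z::complex. ennreal (1 / cmod z ^ 3) * indicator (- cball 0 R) z) \<in> borel_measurable lborel" for a
      by measurable
    have "(\<integral>\<^sup>+z. (\<Sum>a\<in>A. ennreal (q z) * indicator (ball a (r a)) z) \<partial>lborel)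
        = (\<Sum>a\<in>A. \<integral>\<^sup>+z. ennreal (q z) * indicator (ball a (r a)) z \<partial>lborel)"
      by (rule nn_integral_sum) (rule m)
    moreover have "(\<integral>\<^sup>+z. ennreal K * (ennreal (1 / cmod z ^ 3) * indicator (- cball 0 R) z) \<partial>(lborel :: complex measure))
        = ennreal K * (\<integral>\<^sup>+z. ennreal (1 / cmod z ^ 3) * indicator (- cball 0 R) z \<partial>lborel)"
      by (rule nn_integral_cmult) (rule m)
    ultimately show ?thesis
      by (subst nn_integral_add) (auto intro!: borel_measurable_sum m borel_measurable_times_ennreal)
  qed
  also have "\<dots> < \<infinity>"
    using r(2) nn_integral_inverse_cube_finite[OF R] A(2)
    by (auto simp: ennreal_mult_less_top sum_Inf)
  finally show ?thesis by (simp add: q_def)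
qed

subsection \<open>Eigendifferentials of rational maps\<close>


lemma open_complex_not_real:
  assumes "open S" "z \<in> S"
  shows "\<exists>w\<in>S. Im w \<noteq> 0"
proof (cases "Im z = 0")
  case True
  obtain e where e: "e > 0" "cball z e \<subseteq> S"
    using assms open_contains_cball by blast
  have "z + \<i> * of_real e \<in> cball z e"
    using e(1) by (simp add: dist_complex_def norm_mult)
  moreover have "Im (z + \<i> * of_real e) \<noteq> 0" using True e(1) by simp
  ultimately show ?thesis using e(2) by blast
qed (use assms in blast)

locale coprime_fraction =
  fixes P Q :: "complex poly"
  assumes coprime: "coprime P Q" and Q_nonzero: "Q \<noteq> 0"
    and degree_pos: "max (degree P) (degree Q) \<ge> 1"
begin

definition D :: nat where "D = max (degree P) (degree Q)"

text \<open>The Wronskian: the derivative of \<open>P / Q\<close> is \<open>W / Q^2\<close>.\<close>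

definition W :: "complex poly" where "W = pderiv P * Q - P * pderiv Q"

definition ratio :: "complex \<Rightarrow> complex" where "ratio x = poly P x / poly Q x"

definition fibre :: "complex \<Rightarrow> complex set" where "fibre y = {x. poly P x = y * poly Q x}"

definition regular :: "complex poly \<Rightarrow> complex set" where
  "regular M = {x. poly (Q * W * M) x \<noteq> 0}"

text \<open>\<open>coeff P D / coeff Q D\<close> is the value at infinity, over which a preimage
  escapes from the plane; the others are critical values and images of roots of \<open>M\<close>.
  Division by zero may add a spurious 0, which is harmless as the set stays finite.\<close>

definition exceptional :: "complex poly \<Rightarrow> complex set" where
  "exceptional M = insert (coeff P D / coeff Q D) (ratio ` {x. poly (W * M) x = 0})"

text \<open>The summand \<open>q(x) / f'(x)^2\<close> of the pushforward.\<close>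

definition push_weight :: "complex poly \<Rightarrow> complex poly \<Rightarrow> complex \<Rightarrow> complex" where
  "push_weight N M x = (poly N x / poly M x) / (poly W x / (poly Q x)\<^sup>2)\<^sup>2"

lemma no_common_root: "poly P x \<noteq> 0 \<or> poly Q x \<noteq> 0"
proof (rule ccontr)
  assume "\<not> ?thesis"
  then have "[:-x, 1:] dvd P" "[:-x, 1:] dvd Q" by (auto simp: poly_eq_0_iff_dvd)
  then have "is_unit [:-x, 1:]" using coprime by (metis coprime_common_divisor)
  then show False by (simp add: is_unit_pCons_iff)
qed

text \<open>A vanishing Wronskian gives \<open>Q dvd pderiv Q\<close> by coprimality, so
  \<open>Q\<close> is constant, and then so is \<open>P\<close>.\<close>

lemma W_nonzero: "W \<noteq> 0"
proof
  assume "W = 0"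
  then have eq: "pderiv P * Q = P * pderiv Q" by (simp add: W_def)
  have "Q dvd pderiv Q"
    using coprime eq by (metis coprime_commute coprime_dvd_mult_right_iff dvd_triv_right)
  have dQ: "degree Q = 0"
  proof (rule ccontr)
    assume "degree Q \<noteq> 0"
    then show False using \<open>Q dvd pderiv Q\<close>
      by (metis degree_pderiv diff_less dvd_imp_degree_le not_less pderiv_eq_0_iff zero_less_one neq0_conv)
  qed
  then have "pderiv Q = 0" by (simp add: pderiv_eq_0_iff)
  with eq Q_nonzero have "pderiv P = 0" by simp
  then have "degree P = 0" by (simp add: pderiv_eq_0_iff)
  with dQ degree_pos show False by simp
qed

lemma finite_exceptional: "M \<noteq> 0 \<Longrightarrow> finite (exceptional M)"
  unfolding exceptional_def using poly_roots_finite[of "W * M"] W_nonzero by auto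

lemma open_regular: "open (regular M)"
proof -
  have "open ((\<lambda>x. poly (Q * W * M) x) -` (- {0}))"
    by (intro open_vimage continuous_intros)
  also have "(\<lambda>x. poly (Q * W * M) x) -` (- {0}) = regular M" by (auto simp: regular_def)
  finally show ?thesis .
qed

lemma finite_compl_regular: "M \<noteq> 0 \<Longrightarrow> finite (- regular M)"
  using poly_roots_finite[of "Q * W * M"] W_nonzero Q_nonzero
  by (simp add: regular_def Collect_neg_eq[symmetric])

lemma ratio_derivative:
  assumes "poly Q x \<noteq> 0"
  shows "(ratio has_field_derivative (poly W x / (poly Q x)\<^sup>2)) (at x)"
  unfolding ratio_def[abs_def] W_def using assms
  by (auto intro!: derivative_eq_intros simp: power2_eq_square divide_simps algebra_simps)

lemma ratio_holomorphic: "ratio holomorphic_on regular M"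
  unfolding ratio_def[abs_def] by (intro holomorphic_intros) (auto simp: regular_def)

lemma deriv_ratio: "poly Q x \<noteq> 0 \<Longrightarrow> deriv ratio x = poly W x / (poly Q x)\<^sup>2"
  by (rule DERIV_imp_deriv) (rule ratio_derivative)

lemma push_weight_holomorphic: "push_weight N M holomorphic_on regular M"
  unfolding push_weight_def[abs_def] by (intro holomorphic_intros) (auto simp: regular_def)

lemma fibre_Q_nonzero: "x \<in> fibre y \<Longrightarrow> poly Q x \<noteq> 0"
  using no_common_root[of x] by (auto simp: fibre_def)

lemma fibre_iff: "x \<in> fibre y \<longleftrightarrow> poly Q x \<noteq> 0 \<and> ratio x = y"
  using fibre_Q_nonzero[of x y] by (auto simp: fibre_def ratio_def field_simps)

lemma fibre_regular:
  assumes "y \<notin> exceptional M" "x \<in> fibre y"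
  shows "x \<in> regular M"
  using assms fibre_iff[of x y] by (auto simp: exceptional_def regular_def)

text \<open>As \<open>y\<close> is not the value at infinity, \<open>P - y Q\<close> keeps its full
  degree \<open>D\<close>; at a root of it, \<open>W\<close> equals \<open>Q\<close> times its
  derivative, so a multiple root would be critical.\<close>

lemma fibre_card:
  assumes "y \<notin> exceptional M"
  shows "finite (fibre y)" "card (fibre y) = D"
proof -
  define p where "p = P - smult y Q"
  have fib: "fibre y = {x. poly p x = 0}" by (auto simp: fibre_def p_def)
  have "coeff p D \<noteq> 0"
  proof
    assume "coeff p D = 0"
    then have eq: "coeff P D = y * coeff Q D" by (simp add: p_def)
    have "coeff Q D \<noteq> 0"
    proof
      assume *: "coeff Q D = 0"
      with eq have "coeff P D = 0" by simp
      with * show False using degree_pos Q_nonzero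
        by (metis D_def leading_coeff_0_iff max_def degree_0 not_one_le_zero)
    qed
    with eq have "y = coeff P D / coeff Q D" by simp
    with assms show False by (simp add: exceptional_def)
  qed
  moreover have "degree p \<le> D"
    unfolding p_def D_def by (intro degree_diff_le) (auto intro: order_trans[OF degree_smult_le])
  ultimately have degp: "degree p = D" by (simp add: le_antisym le_degree)
  have "rsquarefree p"
    unfolding rsquarefree_roots
  proof (intro allI notI)
    fix a assume a: "poly p a = 0 \<and> poly (pderiv p) a = 0"
    then have "a \<in> fibre y" by (simp add: fib)
    then have "a \<in> regular M" using assms fibre_regular by blast
    moreover have "poly W a = 0"
      using a by (auto simp: W_def p_def pderiv_diff pderiv_smult algebra_simps)
    ultimately show False by (simp add: regular_def)
  qed
  have p0: "p \<noteq> 0" using \<open>coeff p D \<noteq> 0\<close> by auto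
  show "finite (fibre y)" unfolding fib using poly_roots_finite[OF p0] .
  have "degree p = degree (smult (lead_coeff p) (\<Prod>z|poly p z = 0. [:-z, 1:]))"
    using complex_poly_decompose_rsquarefree[OF \<open>rsquarefree p\<close>] by simp
  also have "\<dots> = card (fibre y)"
    unfolding fib using p0 by (simp add: degree_prod_sum_eq)
  finally show "card (fibre y) = D" using degp by simp
qed

text \<open>Inverse branches starting at the points of one fibre stay in discs too far apart to
  collide, so they give \<open>D\<close> distinct points of each nearby fibre. That fibre has
  exactly \<open>D\<close> points, so the count alone shows that these are all.\<close>

lemma local_branches:
  assumes M: "M \<noteq> 0" and y0: "y0 \<notin> exceptional M"
  obtains \<epsilon> k where "\<epsilon> > 0" "ball y0 \<epsilon> \<inter> exceptional M = {}"
    "\<And>x. x \<in> fibre y0 \<Longrightarrow> k x holomorphic_on ball y0 \<epsilon>"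
    "\<And>y. y \<in> ball y0 \<epsilon> \<Longrightarrow> bij_betw (\<lambda>x. k x y) (fibre y0) (fibre y)"
proof -
  note fin = fibre_card[OF y0]
  obtain d where d: "d > 0" "\<And>x x'. x \<in> fibre y0 \<Longrightarrow> x' \<in> fibre y0 \<Longrightarrow> x \<noteq> x' \<Longrightarrow> 2 * d \<le> dist x x'"
  proof -
    obtain e where e: "e > 0" "\<And>x x'. x \<in> fibre y0 \<Longrightarrow> x' \<in> fibre y0 \<Longrightarrow> x \<noteq> x' \<Longrightarrow> e \<le> dist x x'"
    proof (cases "\<exists>x\<in>fibre y0. \<exists>x'\<in>fibre y0. x \<noteq> x'")
      case True
      define E where "E = (\<lambda>(x, x'). dist x x') ` {(x, x') \<in> fibre y0 \<times> fibre y0. x \<noteq> x'}"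
      have "finite {(x, x') \<in> fibre y0 \<times> fibre y0. x \<noteq> x'}"
        by (rule finite_subset[of _ "fibre y0 \<times> fibre y0"]) (use fin in auto)
      then have E: "finite E" "E \<noteq> {}" unfolding E_def using True by auto
      then have "Min E \<in> E" by (rule Min_in)
      then have "Min E > 0" by (auto simp: E_def)
      moreover have "Min E \<le> dist x x'" if "x \<in> fibre y0" "x' \<in> fibre y0" "x \<noteq> x'" for x x'
        using that by (intro Min_le E) (auto simp: E_def)
      ultimately show thesis using that by blast
    next
      case False
      then show thesis using that[of 1] by auto
    qed
    then show thesis using that[of "e / 2"] by auto
  qed
  have "\<exists>r. \<forall>x\<in>fibre y0. r x > 0 \<and> ball x (r x) \<subseteq> ball x d \<inter> regular M \<and> inj_on ratio (ball x (r x))"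
  proof (intro bchoice ballI)
    fix x assume x: "x \<in> fibre y0"
    then have xr: "x \<in> regular M" using y0 fibre_regular by blast
    then have "deriv ratio x \<noteq> 0" using deriv_ratio[of x] by (auto simp: regular_def)
    moreover have "ratio holomorphic_on (ball x d \<inter> regular M)"
      using ratio_holomorphic holomorphic_on_subset by blast
    moreover have "x \<in> ball x d \<inter> regular M" "open (ball x d \<inter> regular M)"
      using d(1) xr open_regular by auto
    ultimately show "\<exists>r. r > 0 \<and> ball x r \<subseteq> ball x d \<inter> regular M \<and> inj_on ratio (ball x r)"
      using has_complex_derivative_locally_injective by metis
  qed
  then obtain r where r: "\<And>x. x \<in> fibre y0 \<Longrightarrow> r x > 0"
      "\<And>x. x \<in> fibre y0 \<Longrightarrow> ball x (r x) \<subseteq> ball x d \<inter> regular M"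
      "\<And>x. x \<in> fibre y0 \<Longrightarrow> inj_on ratio (ball x (r x))" by blast
  have hol: "ratio holomorphic_on ball x (r x)" if "x \<in> fibre y0" for x
    using ratio_holomorphic r(2)[OF that] holomorphic_on_subset by blast
  have "\<exists>k. \<forall>x\<in>fibre y0. k x holomorphic_on ratio ` ball x (r x) \<and> (\<forall>z\<in>ball x (r x). k x (ratio z) = z)"
  proof (intro bchoice ballI)
    fix x assume x: "x \<in> fibre y0"
    show "\<exists>k. k holomorphic_on ratio ` ball x (r x) \<and> (\<forall>z\<in>ball x (r x). k (ratio z) = z)"
      using holomorphic_has_inverse[OF hol[OF x] open_ball r(3)[OF x]] by metis
  qed
  then obtain k where k: "\<And>x. x \<in> fibre y0 \<Longrightarrow> k x holomorphic_on ratio ` ball x (r x)"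
     "\<And>x z. x \<in> fibre y0 \<Longrightarrow> z \<in> ball x (r x) \<Longrightarrow> k x (ratio z) = z" by blast
  define O1 where "O1 = (\<Inter>x\<in>fibre y0. ratio ` ball x (r x)) \<inter> (- exceptional M)"
  have "open O1"
    unfolding O1_def using fin(1) hol r(3) finite_exceptional[OF M]
    by (intro open_Int open_INT ballI) (auto intro!: open_mapping_thm3 finite_imp_closed)
  moreover have "y0 \<in> O1"
    unfolding O1_def using y0 r(1) fibre_iff by (auto intro!: image_eqI)
  ultimately obtain \<epsilon> where \<epsilon>: "\<epsilon> > 0" "ball y0 \<epsilon> \<subseteq> O1"
    using open_contains_ball by blast
  show thesis
  proof (rule that[of \<epsilon> k])
    show "ball y0 \<epsilon> \<inter> exceptional M = {}" using \<epsilon>(2) by (auto simp: O1_def)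
    show "k x holomorphic_on ball y0 \<epsilon>" if "x \<in> fibre y0" for x
      using k(1)[OF that] \<epsilon>(2) that by (auto simp: O1_def elim!: holomorphic_on_subset)
    fix y assume y: "y \<in> ball y0 \<epsilon>"
    have kb: "k x y \<in> ball x (r x) \<and> ratio (k x y) = y" if "x \<in> fibre y0" for x
    proof -
      from y \<epsilon>(2) that have "y \<in> ratio ` ball x (r x)" unfolding O1_def by blast
      then obtain z where "z \<in> ball x (r x)" "y = ratio z" by blast
      then show ?thesis using k(2)[OF that] by metis
    qed
    have inj: "inj_on (\<lambda>x. k x y) (fibre y0)"
    proof (rule inj_onI, rule ccontr)
      fix x x' assume x: "x \<in> fibre y0" "x' \<in> fibre y0" "k x y = k x' y" "x \<noteq> x'"
      have "dist x (k x y) < d" "dist x' (k x y) < d"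
        using kb[OF x(1)] kb[OF x(2)] r(2)[OF x(1)] r(2)[OF x(2)] x(3) by (metis Int_iff mem_ball subsetD)+
      then show False using d(2)[OF x(1,2,4)] dist_triangle2[of x x' "k x y"] by (simp add: dist_commute)
    qed
    have sub: "(\<lambda>x. k x y) ` fibre y0 \<subseteq> fibre y"
    proof
      fix z assume "z \<in> (\<lambda>x. k x y) ` fibre y0"
      then obtain x where x: "x \<in> fibre y0" "z = k x y" by auto
      with kb[OF x(1)] r(2)[OF x(1)] have "z \<in> regular M" "ratio z = y" by auto
      then show "z \<in> fibre y" by (auto simp: fibre_iff regular_def)
    qed
    have "y \<notin> exceptional M" using y \<epsilon>(2) by (auto simp: O1_def)
    note fy = fibre_card[OF this]
    have "(\<lambda>x. k x y) ` fibre y0 = fibre y"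
      using sub fy fin(2) card_image[OF inj] by (intro card_subset_eq) auto
    with inj show "bij_betw (\<lambda>x. k x y) (fibre y0) (fibre y)" by (simp add: bij_betw_def)
  qed (use \<epsilon> in auto)
qed

text \<open>Near a non-exceptional value the sum runs over \<open>D\<close> holomorphic branches.
  This regularity allows an identity known along a convergent sequence of values to be
  continued.\<close>

lemma fibre_sum_holomorphic:
  assumes M: "M \<noteq> 0" and w: "w holomorphic_on regular M"
  shows "(\<lambda>y. \<Sum>x\<in>fibre y. w x) holomorphic_on - exceptional M"
proof -
  have op: "open (- exceptional M)" using finite_exceptional[OF M] by (simp add: finite_imp_closed open_Compl)
  have "\<exists>\<epsilon>>0. (\<lambda>y. \<Sum>x\<in>fibre y. w x) holomorphic_on ball y0 \<epsilon>" if y0: "y0 \<in> - exceptional M" for y0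
  proof -
    obtain \<epsilon> k where k: "\<epsilon> > 0" "ball y0 \<epsilon> \<inter> exceptional M = {}"
      "\<And>x. x \<in> fibre y0 \<Longrightarrow> k x holomorphic_on ball y0 \<epsilon>"
      "\<And>y. y \<in> ball y0 \<epsilon> \<Longrightarrow> bij_betw (\<lambda>x. k x y) (fibre y0) (fibre y)"
      using local_branches[OF M, of y0] y0 by blast
    have "(\<lambda>y. \<Sum>x\<in>fibre y0. w (k x y)) holomorphic_on ball y0 \<epsilon>"
    proof (rule holomorphic_on_sum)
      fix x assume x: "x \<in> fibre y0"
      have "k x ` ball y0 \<epsilon> \<subseteq> regular M"
      proof
        fix z assume "z \<in> k x ` ball y0 \<epsilon>"
        then obtain y where y: "y \<in> ball y0 \<epsilon>" "z = k x y" by blast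
        then have "z \<in> fibre y" using bij_betw_apply[OF k(4)[OF y(1)] x] by simp
        then show "z \<in> regular M" using k(2) y(1) fibre_regular by blast
      qed
      with holomorphic_on_compose_gen[OF k(3)[OF x] w]
      show "(\<lambda>y. w (k x y)) holomorphic_on ball y0 \<epsilon>" by (simp add: o_def image_subset_iff_funcset)
    qed
    also have "?this \<longleftrightarrow> (\<lambda>y. \<Sum>x\<in>fibre y. w x) holomorphic_on ball y0 \<epsilon>"
    proof (rule holomorphic_cong)
      fix y assume "y \<in> ball y0 \<epsilon>"
      then show "(\<Sum>x\<in>fibre y0. w (k x y)) = (\<Sum>x\<in>fibre y. w x)"
        using sum.reindex_bij_betw[OF k(4), of y w] by simp
    qed simp
    finally show ?thesis using k(1) by blast
  qed
  then show ?thesis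
    using op by (meson analytic_on_analytic_at analytic_on_def analytic_imp_holomorphic)
qed

end


section \<open>Area of an eigendifferential\<close>

locale eigen_differential = coprime_fraction P Q for P Q :: "complex poly" +
  fixes N M :: "complex poly" and c :: complex
  assumes N_nonzero: "N \<noteq> 0" and rsquarefree_M: "rsquarefree M"
    and degree_N_M: "degree N + 3 \<le> degree M"
    and eigen: "\<forall>\<^sub>F y in cofinite. c * (poly N y / poly M y) = (\<Sum>x\<in>fibre y. push_weight N M x)"
begin

abbreviation qd :: "complex \<Rightarrow> complex" where "qd x \<equiv> poly N x / poly M x"

lemma M_nonzero: "M \<noteq> 0" using rsquarefree_M by (auto simp: rsquarefree_def)

lemma AE_cofinite:
  assumes "\<forall>\<^sub>F y::complex in cofinite. R y"
  shows "AE y in lborel. R y"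
proof (rule AE_I')
  show "{y. \<not> R y} \<in> null_sets lborel"
    using assms by (intro finite_imp_null_set_lborel) (simp add: eventually_cofinite)
qed auto

lemma eventually_not_exceptional: "\<forall>\<^sub>F y in cofinite. y \<notin> exceptional M"
  using finite_exceptional[OF M_nonzero] by (simp add: eventually_cofinite)

lemma poly_measurable [measurable]: "poly p \<in> borel_measurable borel" for p :: "complex poly"
  by (intro borel_measurable_continuous_onI continuous_intros)

lemma push_weight_measurable [measurable]: "push_weight N M \<in> borel_measurable borel"
  unfolding push_weight_def[abs_def] by measurable

definition fibre_norm :: "complex \<Rightarrow> ennreal" where
  "fibre_norm = fibre_integral (regular M) ratio (\<lambda>x. ennreal (cmod (push_weight N M x)))"

lemma deriv_ratio_nonzero: "x \<in> regular M \<Longrightarrow> deriv ratio x \<noteq> 0"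
  using deriv_ratio[of x] by (auto simp: regular_def)

lemma regular_borel: "regular M \<in> sets borel" using open_regular by auto

lemma fibre_norm_measurable [measurable]: "fibre_norm \<in> borel_measurable borel"
  unfolding fibre_norm_def
  by (rule nn_integral_fibre_integral(2)[OF ratio_holomorphic open_regular deriv_ratio_nonzero regular_borel order_refl]) auto

text \<open>The Jacobian \<open>|f'|^2\<close> cancels the denominators of the weights, so summing
  \<open>|q| / |f'|^2\<close> over fibres and integrating recovers the area of
  \<open>q\<close>.\<close>

lemma nn_integral_qd: "(\<integral>\<^sup>+y. fibre_norm y \<partial>lborel) = (\<integral>\<^sup>+x. ennreal (cmod (qd x)) \<partial>lborel)"
proof -
  have "(\<integral>\<^sup>+y. fibre_norm y \<partial>lborel) = (\<integral>\<^sup>+x. ennreal (cmod (push_weight N M x)) * ennreal ((cmod (deriv ratio x))\<^sup>2)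
      * indicator (regular M) x \<partial>lborel)"
    unfolding fibre_norm_def
    by (rule nn_integral_fibre_integral(1)[OF ratio_holomorphic open_regular deriv_ratio_nonzero regular_borel order_refl, symmetric]) auto
  also have "\<dots> = (\<integral>\<^sup>+x. ennreal (cmod (qd x)) \<partial>lborel)"
  proof (rule nn_integral_cong_AE)
    have "\<forall>\<^sub>F x in cofinite. x \<in> regular M"
      using finite_compl_regular[OF M_nonzero] by (simp add: eventually_cofinite Compl_eq)
    from AE_cofinite[OF this]
    show "AE x in lborel. ennreal (cmod (push_weight N M x)) * ennreal ((cmod (deriv ratio x))\<^sup>2)
      * indicator (regular M) x = ennreal (cmod (qd x))"
    proof eventually_elim
      case (elim x)
      then show ?case
        by (simp add: regular_def deriv_ratio push_weight_def ennreal_mult[symmetric] norm_mult norm_divide norm_power)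
    qed
  qed
  finally show ?thesis .
qed

lemma fibre_norm_eq:
  assumes "y \<notin> exceptional M"
  shows "fibre_norm y = ennreal (\<Sum>x\<in>fibre y. cmod (push_weight N M x))"
proof -
  have "{x \<in> regular M. ratio x = y} = fibre y"
    using fibre_regular[OF assms] by (auto simp: fibre_iff regular_def)
  then have "fibre_norm y = (\<integral>\<^sup>+x. ennreal (cmod (push_weight N M x)) \<partial>count_space (fibre y))"
    unfolding fibre_norm_def fibre_integral_def by (simp add: nn_integral_count_space_indicator)
  also have "\<dots> = ennreal (\<Sum>x\<in>fibre y. cmod (push_weight N M x))"
    using fibre_card(1)[OF assms] by (simp add: nn_integral_count_space_finite)
  finally show ?thesis .
qed

lemma qd_finite: "(\<integral>\<^sup>+x. ennreal (cmod (qd x)) \<partial>lborel) < \<infinity>"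
  by (rule rational_nn_integral_finite[OF rsquarefree_M degree_N_M])

lemma qd_positive: "(\<integral>\<^sup>+x. ennreal (cmod (qd x)) \<partial>lborel) > 0"
proof (rule ccontr)
  assume "\<not> ?thesis"
  then have "(\<integral>\<^sup>+x. ennreal (cmod (qd x)) \<partial>lborel) = 0" by simp
  then have "AE x in lborel. ennreal (cmod (qd x)) = 0" by (subst (asm) nn_integral_0_iff_AE) auto
  moreover have "AE x in lborel. qd x \<noteq> 0"
  proof (rule AE_cofinite)
    have "{x. qd x = 0} \<subseteq> {x. poly (N * M) x = 0}" by auto
    then show "\<forall>\<^sub>F x in cofinite. qd x \<noteq> 0"
      using poly_roots_finite[of "N * M"] N_nonzero M_nonzero
      by (auto simp: eventually_cofinite intro: finite_subset)
  qed
  ultimately have "AE x in (lborel :: complex measure). False"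
    by eventually_elim simp
  then have "emeasure (lborel :: complex measure) UNIV = 0"
    by (simp add: eventually_False trivial_limit_def[symmetric] ae_filter_eq_bot_iff)
  then show False by simp
qed

lemma cmod_le_fibre_norm: "\<forall>\<^sub>F y in cofinite. ennreal (cmod (c * qd y)) \<le> fibre_norm y"
  using eigen eventually_not_exceptional
proof eventually_elim
  case (elim y)
  then show ?case unfolding fibre_norm_eq[OF elim(2)] elim(1) by (intro ennreal_leI norm_sum)
qed

text \<open>The triangle inequality on each fibre, integrated, reads \<open>|c| I \<le> I\<close>
  for the area \<open>I\<close>, which may be cancelled because it is finite and positive.\<close>

theorem cmod_eigenvalue_le_1: "cmod c \<le> 1"
proof -
  define I where "I = enn2real (\<integral>\<^sup>+x. ennreal (cmod (qd x)) \<partial>lborel)"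
  have I: "(\<integral>\<^sup>+x. ennreal (cmod (qd x)) \<partial>lborel) = ennreal I" "I > 0"
    using qd_finite qd_positive by (auto simp: I_def enn2real_positive_iff)
  have "ennreal (cmod c) * (\<integral>\<^sup>+x. ennreal (cmod (qd x)) \<partial>lborel) = (\<integral>\<^sup>+y. ennreal (cmod (c * qd y)) \<partial>lborel)"
    by (subst nn_integral_cmult[symmetric]) (simp_all add: norm_mult ennreal_mult del: times_divide_eq_right)
  also have "\<dots> \<le> (\<integral>\<^sup>+y. fibre_norm y \<partial>lborel)"
    by (rule nn_integral_mono_AE) (rule AE_cofinite[OF cmod_le_fibre_norm])
  finally have "ennreal (cmod c) * ennreal I \<le> ennreal I" by (simp add: nn_integral_qd I)
  then have "cmod c * I \<le> I" using I(2) by (simp add: ennreal_mult[symmetric])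
  then show ?thesis using I(2) by simp
qed


text \<open>For \<open>|c| = 1\<close> the two sides of the pointwise inequality have the same
  finite integral.\<close>

lemma AE_fibre_norm_eq:
  assumes "cmod c = 1"
  shows "AE y in lborel. fibre_norm y = ennreal (cmod (c * qd y))"
proof -
  have eq: "(\<integral>\<^sup>+y. ennreal (cmod (c * qd y)) \<partial>lborel) = (\<integral>\<^sup>+y. fibre_norm y \<partial>lborel)"
    unfolding nn_integral_qd using assms by (simp add: norm_mult del: times_divide_eq_right)
  have fin: "(\<integral>\<^sup>+y. fibre_norm y \<partial>lborel) < \<infinity>" unfolding nn_integral_qd by (rule qd_finite)
  have le: "AE y in lborel. ennreal (cmod (c * qd y)) \<le> fibre_norm y"
    by (rule AE_cofinite[OF cmod_le_fibre_norm])
  have "(\<integral>\<^sup>+y. fibre_norm y - ennreal (cmod (c * qd y)) \<partial>lborel)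
      = (\<integral>\<^sup>+y. fibre_norm y \<partial>lborel) - (\<integral>\<^sup>+y. ennreal (cmod (c * qd y)) \<partial>lborel)"
    using fin le eq by (intro nn_integral_diff) (simp_all add: less_top del: times_divide_eq_right)
  also have "\<dots> = 0" using fin unfolding eq by simp
  finally have "AE y in lborel. fibre_norm y - ennreal (cmod (c * qd y)) = 0"
    by (subst (asm) nn_integral_0_iff_AE) auto
  with le show ?thesis
    by eventually_elim (metis diff_eq_0_iff_ennreal antisym_conv less_imp_le)
qed

text \<open>Pairing with \<open>cnj s\<close>, where \<open>s\<close> is the sum, turns the equality
  into a vanishing sum of non-negative terms. For \<open>s = 0\<close> the quotient is 0 by
  convention.\<close>

lemma norm_sum_eq_imp_aligned:
  fixes w :: "'b \<Rightarrow> complex"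
  assumes "finite A" "cmod (\<Sum>x\<in>A. w x) = (\<Sum>x\<in>A. cmod (w x))" "x \<in> A"
  shows "Im (w x / (\<Sum>x\<in>A. w x)) = 0"
proof -
  define s where "s = (\<Sum>x\<in>A. w x)"
  have le: "Re (cnj s * w x) \<le> cmod s * cmod (w x)" for x
    using complex_Re_le_cmod[of "cnj s * w x"] by (simp add: norm_mult)
  have "(\<Sum>x\<in>A. cmod s * cmod (w x) - Re (cnj s * w x)) = cmod s * cmod s - Re (cnj s * s)"
    using assms(2) by (simp add: sum_subtractf sum_distrib_left[symmetric] s_def Re_sum[symmetric] del: Re_sum)
  also have "\<dots> = 0" by (simp add: complex_norm_square[symmetric] power2_eq_square cmod_def)
  finally have "cmod s * cmod (w x) - Re (cnj s * w x) = 0"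
    using assms(1,3) le by (subst (asm) sum_nonneg_eq_0_iff) auto
  then have "Re (cnj s * w x) = cmod (cnj s * w x)" by (simp add: norm_mult)
  then have "Im (cnj s * w x) = 0" using cmod_power2[of "cnj s * w x"] by simp
  moreover have "w x / s = cnj s * w x / of_real ((cmod s)\<^sup>2)"
    by (subst complex_norm_square) (simp add: divide_simps)
  ultimately show ?thesis by (simp add: s_def Im_divide_of_real)
qed

lemma finite_fibre: "finite (fibre y)"
proof -
  have "P - smult y Q \<noteq> 0"
  proof
    assume "P - smult y Q = 0"
    then have P: "P = smult y Q" by simp
    then have "Q dvd P" by (simp add: dvd_smult)
    then have "is_unit Q" using coprime by (metis coprime_common_divisor dvd_refl)
    then have "degree Q = 0" by (simp add: is_unit_iff_degree Q_nonzero)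
    moreover from this have "degree P = 0" unfolding P using degree_smult_le[of y Q] by simp
    ultimately show False using degree_pos by simp
  qed
  from poly_roots_finite[OF this] show ?thesis by (simp add: fibre_def)
qed

section \<open>The pullback equation\<close>

definition base :: "complex set" where
  "base = {x \<in> regular M. poly (N * M) (ratio x) \<noteq> 0}"

lemma finite_compl_base: "finite (- base)"
proof -
  have "- base \<subseteq> - regular M \<union> (\<Union>y\<in>{y. poly (N * M) y = 0}. fibre y)"
    by (auto simp: base_def fibre_iff regular_def)
  moreover have "finite {y. poly (N * M) y = 0}"
    using N_nonzero M_nonzero by (intro poly_roots_finite) auto
  ultimately show ?thesis
    using finite_compl_regular[OF M_nonzero] finite_fibre by (elim finite_subset) blast
qed

lemma open_base: "open base"
  using finite_compl_base by (metis finite_imp_closed open_Compl double_complement)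

lemma connected_base: "connected base"
  using connected_open_delete_finite[of UNIV "- base"] finite_compl_base
  by (simp add: Compl_eq_Diff_UNIV[symmetric] connected_UNIV)

text \<open>The share of the point \<open>x\<close> in the pushforward at \<open>ratio x\<close>; it
  turns out to be the constant \<open>1 / D\<close>.\<close>

definition quotient :: "complex \<Rightarrow> complex" where
  "quotient x = push_weight N M x / (c * qd (ratio x))"

lemma quotient_holomorphic:
  assumes "c \<noteq> 0"
  shows "quotient holomorphic_on base"
proof -
  have "push_weight N M holomorphic_on base" "ratio holomorphic_on base"
    using push_weight_holomorphic[of N M] ratio_holomorphic[of M]
    by (auto simp: base_def elim!: holomorphic_on_subset)
  then show ?thesis
    unfolding quotient_def[abs_def] using assms
    by (intro holomorphic_intros holomorphic_on_compose_gen[of ratio _ "poly _" UNIV, unfolded o_def])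
       (auto simp: base_def)
qed

lemma AE_quotient_real:
  assumes "cmod c = 1"
  shows "AE y in lborel. \<forall>x\<in>fibre y. Im (quotient x) = 0"
  using AE_fibre_norm_eq[OF assms] AE_cofinite[OF eigen] AE_cofinite[OF eventually_not_exceptional]
proof eventually_elim
  case (elim y)
  show ?case
  proof
    fix x assume x: "x \<in> fibre y"
    then have "ratio x = y" by (simp add: fibre_iff)
    have "cmod (\<Sum>x\<in>fibre y. push_weight N M x) = (\<Sum>x\<in>fibre y. cmod (push_weight N M x))"
      using elim(1) unfolding fibre_norm_eq[OF elim(3)] elim(2) by (simp add: sum_nonneg)
    from norm_sum_eq_imp_aligned[OF finite_fibre this x] show "Im (quotient x) = 0"
      unfolding quotient_def \<open>ratio x = y\<close> elim(2) .
  qed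
qed

text \<open>Reality is known over almost every value \<open>y\<close>. If it failed at
  \<open>x0\<close> it would fail on a disc around \<open>x0\<close>, and the image of that disc
  under \<open>ratio\<close> is open, hence not null.\<close>

lemma quotient_real:
  assumes c: "cmod c = 1" and x0: "x0 \<in> base"
  shows "Im (quotient x0) = 0"
proof (rule ccontr)
  assume nz: "Im (quotient x0) \<noteq> 0"
  have "c \<noteq> 0" using c by auto
  define V where "V = base \<inter> quotient -` {z. Im z \<noteq> 0}"
  have "open {z. Im z \<noteq> 0}" by (intro open_Collect_neq continuous_intros)
  then have "open V"
    unfolding V_def
    by (intro continuous_open_preimage holomorphic_on_imp_continuous_on quotient_holomorphic open_base \<open>c \<noteq> 0\<close>)
  moreover have "x0 \<in> V" using x0 nz by (simp add: V_def)
  moreover have holV: "ratio holomorphic_on V"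
    using ratio_holomorphic[of M] by (rule holomorphic_on_subset) (auto simp: V_def base_def)
  moreover have "deriv ratio x0 \<noteq> 0" using x0 deriv_ratio_nonzero by (auto simp: base_def)
  ultimately obtain r where r: "r > 0" "ball x0 r \<subseteq> V" "inj_on ratio (ball x0 r)"
    using has_complex_derivative_locally_injective by metis
  have op: "open (ratio ` ball x0 r)"
    using holomorphic_on_subset[OF holV r(2)] r(3) by (intro open_mapping_thm3) auto
  have "AE y in lborel. y \<in> ratio ` ball x0 r \<longrightarrow> y \<in> {}"
    using AE_quotient_real[OF c]
  proof eventually_elim
    case (elim y)
    show ?case
    proof
      assume "y \<in> ratio ` ball x0 r"
      then obtain x where "x \<in> ball x0 r" "y = ratio x" by blast
      moreover from this have "x \<in> V" using r(2) by blast
      ultimately show "y \<in> {}" using elim by (auto simp: V_def base_def regular_def fibre_iff)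
    qed
  qed
  then have "AE y\<in>ratio ` ball x0 r in lebesgue. y \<in> {}" by (rule AE_completion)
  from mem_closed_if_AE_lebesgue_open[OF op closed_empty this, of "ratio x0"] r(1)
  show False by auto
qed

text \<open>A real-valued holomorphic function on a connected open set is constant by the open
  mapping theorem. Summing the constant share \<open>t\<close> over the \<open>D\<close> points of a
  fibre gives \<open>D t = 1\<close>.\<close>

lemma pullback_equation:
  assumes c: "cmod c = 1" and x: "x \<in> base"
  shows "of_nat D * qd x = c * qd (ratio x) * (poly W x / (poly Q x)\<^sup>2)\<^sup>2"
proof -
  have "c \<noteq> 0" using c by auto
  have "quotient constant_on base"
  proof (rule ccontr)
    assume "\<not> ?thesis"
    then have op: "open (quotient ` base)"
      using open_mapping_thm[OF quotient_holomorphic[OF \<open>c \<noteq> 0\<close>] open_base connected_base open_base order_refl] by blast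
    with x obtain w where "w \<in> quotient ` base" "Im w \<noteq> 0"
      using open_complex_not_real[OF op] by blast
    then show False using quotient_real[OF c] by auto
  qed
  then obtain t where t: "\<And>x. x \<in> base \<Longrightarrow> quotient x = t" by (auto simp: constant_on_def)
  \<comment> \<open>One generic \<open>y\<close> determines \<open>t\<close>: its fibre lies in
    \<open>base\<close>, has \<open>D\<close> points and satisfies the eigenvalue equation.\<close>
  have "\<forall>\<^sub>F y in cofinite. y \<notin> ratio ` (- base)"
    using finite_compl_base by (simp add: eventually_cofinite)
  with eigen eventually_not_exceptional
  have "\<forall>\<^sub>F y in cofinite. y \<notin> ratio ` (- base) \<and> y \<notin> exceptional M \<and> c * qd y = (\<Sum>x\<in>fibre y. push_weight N M x)"
    by eventually_elim auto
  then have "finite {y. \<not> (y \<notin> ratio ` (- base) \<and> y \<notin> exceptional M \<and> c * qd y = (\<Sum>x\<in>fibre y. push_weight N M x))}"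
    by (simp add: eventually_cofinite)
  from ex_new_if_finite[OF infinite_UNIV_char_0 this]
  obtain y where y: "y \<notin> ratio ` (- base)" "y \<notin> exceptional M" "c * qd y = (\<Sum>x\<in>fibre y. push_weight N M x)"
    by blast
  have fb: "x \<in> base" "push_weight N M x = t * (c * qd y)" if "x \<in> fibre y" for x
  proof -
    show xb: "x \<in> base" using that y(1) by (auto simp: fibre_iff)
    from t[OF xb] that \<open>c \<noteq> 0\<close> xb show "push_weight N M x = t * (c * qd y)"
      by (auto simp: quotient_def fibre_iff base_def)
  qed
  have "card (fibre y) > 0" using fibre_card[OF y(2)] degree_pos by (simp add: D_def)
  then obtain x1 where "x1 \<in> fibre y" by (metis card_gt_0_iff ex_in_conv)
  then have "qd y \<noteq> 0" using fb(1)[of x1] by (auto simp: base_def fibre_iff)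
  have "(\<Sum>x\<in>fibre y. push_weight N M x) = (\<Sum>x\<in>fibre y. t * (c * qd y))"
    by (intro sum.cong refl fb(2))
  also have "\<dots> = of_nat D * (t * (c * qd y))" by (simp only: sum_constant fibre_card[OF y(2)])
  finally have "c * qd y = of_nat D * (t * (c * qd y))" by (simp only: y(3))
  with \<open>c \<noteq> 0\<close> \<open>qd y \<noteq> 0\<close> have Dt: "of_nat D * t = 1" by (simp del: times_divide_eq_right)
  have "poly W x \<noteq> 0" "poly Q x \<noteq> 0" "qd (ratio x) \<noteq> 0" using x by (auto simp: base_def regular_def)
  then have w: "qd x = push_weight N M x * (poly W x / (poly Q x)\<^sup>2)\<^sup>2" by (simp add: push_weight_def)
  have "push_weight N M x = t * (c * qd (ratio x))"
    using t[OF x] \<open>c \<noteq> 0\<close> \<open>qd (ratio x) \<noteq> 0\<close> by (auto simp: quotient_def)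
  then have "of_nat D * qd x = (of_nat D * t) * (c * qd (ratio x)) * (poly W x / (poly Q x)\<^sup>2)\<^sup>2"
    unfolding w by (simp del: times_divide_eq_right)
  then show ?thesis unfolding Dt by (simp del: times_divide_eq_right)
qed

end

subsection \<open>Field embeddings\<close>

text \<open>An isomorphism between two subrings, encoded by its graph so that unions of chains are
  again of this kind. The last clause yields both single-valuedness and injectivity.\<close>

definition ring_graph :: "(complex \<times> complex) set \<Rightarrow> bool" where
  "ring_graph G \<longleftrightarrow> (1, 1) \<in> G \<and>
     (\<forall>a a' b b'. (a, a') \<in> G \<longrightarrow> (b, b') \<in> G \<longrightarrow> (a - b, a' - b') \<in> G \<and> (a * b, a' * b') \<in> G) \<and>
     (\<forall>a a'. (a, a') \<in> G \<longrightarrow> (a = 0 \<longleftrightarrow> a' = 0))"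

definition poly_graph :: "(complex \<times> complex) set \<Rightarrow> (complex poly \<times> complex poly) set" where
  "poly_graph G = {(p, p'). \<forall>i. (coeff p i, coeff p' i) \<in> G}"

definition adjoin :: "(complex \<times> complex) set \<Rightarrow> complex \<Rightarrow> complex \<Rightarrow> (complex \<times> complex) set" where
  "adjoin G t s = (\<lambda>(p, p'). (poly p t, poly p' s)) ` poly_graph G"

text \<open>Exactly the condition under which sending \<open>t\<close> to \<open>s\<close> extends
  the isomorphism \<open>G\<close> to the ring generated by \<open>t\<close>: one implication gives
  well-definedness, the other injectivity.\<close>

definition same_relations :: "(complex \<times> complex) set \<Rightarrow> complex \<Rightarrow> complex \<Rightarrow> bool" where
  "same_relations G t s \<longleftrightarrow> (\<forall>(p, p')\<in>poly_graph G. poly p t = 0 \<longleftrightarrow> poly p' s = 0)"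

context
  fixes G assumes G: "ring_graph G"
begin

lemma rg_one: "(1, 1) \<in> G"
  and rg_diff: "(a, a') \<in> G \<Longrightarrow> (b, b') \<in> G \<Longrightarrow> (a - b, a' - b') \<in> G"
  and rg_mult: "(a, a') \<in> G \<Longrightarrow> (b, b') \<in> G \<Longrightarrow> (a * b, a' * b') \<in> G"
  and rg_zero_iff: "(a, a') \<in> G \<Longrightarrow> a = 0 \<longleftrightarrow> a' = 0"
  using G unfolding ring_graph_def by blast+

lemma rg_zero: "(0, 0) \<in> G" using rg_diff[OF rg_one rg_one] by simp

lemma rg_minus: "(a, a') \<in> G \<Longrightarrow> (- a, - a') \<in> G" using rg_diff[OF rg_zero] by fastforce

lemma rg_add: "(a, a') \<in> G \<Longrightarrow> (b, b') \<in> G \<Longrightarrow> (a + b, a' + b') \<in> G"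
  using rg_diff[of a a' "- b" "- b'"] rg_minus[of b b'] by simp

lemma rg_unique: "(a, b) \<in> G \<Longrightarrow> (a, b') \<in> G \<Longrightarrow> b = b'"
  using rg_diff[of a b a b'] rg_zero_iff[of 0 "b - b'"] by auto

lemma rg_sum: "(\<And>i. i \<in> A \<Longrightarrow> (f i, f' i) \<in> G) \<Longrightarrow> (sum f A, sum f' A) \<in> G"
  by (induction A rule: infinite_finite_induct) (auto intro: rg_zero rg_add)

lemma pg_diff: "(p, p') \<in> poly_graph G \<Longrightarrow> (q, q') \<in> poly_graph G \<Longrightarrow> (p - q, p' - q') \<in> poly_graph G"
  by (auto simp: poly_graph_def rg_diff)

lemma pg_add: "(p, p') \<in> poly_graph G \<Longrightarrow> (q, q') \<in> poly_graph G \<Longrightarrow> (p + q, p' + q') \<in> poly_graph G"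
  by (auto simp: poly_graph_def rg_add)

lemma pg_mult: "(p, p') \<in> poly_graph G \<Longrightarrow> (q, q') \<in> poly_graph G \<Longrightarrow> (p * q, p' * q') \<in> poly_graph G"
  by (auto simp: poly_graph_def coeff_mult rg_mult rg_sum)

lemma pg_smult: "(a, a') \<in> G \<Longrightarrow> (q, q') \<in> poly_graph G \<Longrightarrow> (smult a q, smult a' q') \<in> poly_graph G"
  by (auto simp: poly_graph_def rg_mult)

lemma pg_monom: "(a, a') \<in> G \<Longrightarrow> (monom a n, monom a' n) \<in> poly_graph G"
  by (auto simp: poly_graph_def rg_zero)

lemma pg_const: "(a, a') \<in> G \<Longrightarrow> ([:a:], [:a':]) \<in> poly_graph G"
  using pg_monom[of a a' 0] by (simp add: monom_0)

lemma pg_zero_iff: "(p, p') \<in> poly_graph G \<Longrightarrow> p = 0 \<longleftrightarrow> p' = 0"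
  unfolding poly_graph_def poly_eq_iff using rg_zero_iff by auto

lemma pg_degree: "(p, p') \<in> poly_graph G \<Longrightarrow> degree p = degree p'"
proof -
  assume "(p, p') \<in> poly_graph G"
  then have "coeff p i = 0 \<longleftrightarrow> coeff p' i = 0" for i
    using rg_zero_iff[of "coeff p i" "coeff p' i"] by (auto simp: poly_graph_def)
  then show ?thesis by (simp add: degree_def)
qed

text \<open>The domain of \<open>G\<close> is only a ring, so division leaves a factor
  \<open>a\<close>, a power of the leading coefficient of \<open>g\<close>. The same steps are
  performed on both sides, which keeps all results paired in \<open>G\<close>.\<close>

lemma pg_pseudo_div:
  assumes g: "(g, g') \<in> poly_graph G" "g \<noteq> 0" and p: "(p, p') \<in> poly_graph G"
  shows "\<exists>a a' u u' r r'. (a, a') \<in> G \<and> a \<noteq> 0 \<and> (u, u') \<in> poly_graph G \<and> (r, r') \<in> poly_graph G \<and>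
    smult a p = g * u + r \<and> smult a' p' = g' * u' + r' \<and> (r = 0 \<or> degree r < degree g)"
proof -
  \<comment> \<open>The induction runs on a bound for the length of \<open>p\<close>, since
    cancelling the leading term may lower the degree by more than one.\<close>
  have "\<forall>i\<ge>n. coeff p i = 0 \<Longrightarrow> (p, p') \<in> poly_graph G \<Longrightarrow>
    \<exists>a a' u u' r r'. (a, a') \<in> G \<and> a \<noteq> 0 \<and> (u, u') \<in> poly_graph G \<and> (r, r') \<in> poly_graph G \<and>
      smult a p = g * u + r \<and> smult a' p' = g' * u' + r' \<and> (r = 0 \<or> degree r < degree g)" for n p p'
  proof (induction n arbitrary: p p')
    case 0
    then have "p = 0" by (simp add: poly_eq_iff)
    moreover from this have "p' = 0" using pg_zero_iff[OF 0(2)] by simp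
    ultimately show ?case using rg_one pg_const[OF rg_zero]
      by (intro exI[of _ "1 :: complex"] exI[of _ "0 :: complex poly"]) simp
  next
    case (Suc n)
    show ?case
    proof (cases "n < degree g")
      case True
      then have "p = 0 \<or> degree p < degree g"
        using Suc.prems(1) by (metis leading_coeff_0_iff not_less_eq_eq le_trans Suc_leI not_less)
      then show ?thesis
        using rg_one pg_const[OF rg_zero] Suc.prems(2)
        by (rule_tac exI[of _ 1], rule_tac exI[of _ 1], rule_tac exI[of _ 0], rule_tac exI[of _ 0],
            rule_tac exI[of _ p], rule_tac exI[of _ p']) simp
    next
      case False
      define l l' where "l = lead_coeff g" and "l' = lead_coeff g'"
      define m m' where "m = monom (coeff p n) (n - degree g)" and "m' = monom (coeff p' n) (n - degree g)"
      have l: "(l, l') \<in> G"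
        using g(1) unfolding l_def l'_def pg_degree[OF g(1)] by (simp add: poly_graph_def)
      have l0: "l \<noteq> 0" using g(2) by (simp add: l_def)
      have m: "(m, m') \<in> poly_graph G"
        using Suc.prems(2) unfolding m_def m'_def by (intro pg_monom) (auto simp: poly_graph_def)
      have "(smult l p - m * g, smult l' p' - m' * g') \<in> poly_graph G"
        by (intro pg_diff pg_smult pg_mult l m g Suc.prems)
      moreover have "\<forall>i\<ge>n. coeff (smult l p - m * g) i = 0"
      proof (intro allI impI)
        fix i assume "i \<ge> n"
        then show "coeff (smult l p - m * g) i = 0"
          using False Suc.prems(1)
          by (cases "i = n") (auto simp: m_def l_def coeff_monom_mult coeff_eq_0)
      qed
      ultimately obtain a a' u u' r r' where IH: "(a, a') \<in> G" "a \<noteq> 0" "(u, u') \<in> poly_graph G"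
         "(r, r') \<in> poly_graph G" "smult a (smult l p - m * g) = g * u + r"
         "smult a' (smult l' p' - m' * g') = g' * u' + r'" "r = 0 \<or> degree r < degree g"
        using Suc.IH by blast
      have "smult (a * l) p = g * (u + smult a m) + r" "smult (a' * l') p' = g' * (u' + smult a' m') + r'"
        using IH(5,6) by (simp_all add: algebra_simps smult_diff_right)
      moreover have "(u + smult a m, u' + smult a' m') \<in> poly_graph G"
        by (intro pg_add pg_smult IH m)
      ultimately show ?thesis using IH l0 rg_mult[OF IH(1) l] by (metis mult_eq_0_iff)
    qed
  qed
  from this[of "Suc (degree p)" p p'] show ?thesis using p by (simp add: coeff_eq_0)
qed

end

lemma ring_graph_adjoin:
  assumes G: "ring_graph G" and rel: "same_relations G t s"
  shows "ring_graph (adjoin G t s)" "G \<subseteq> adjoin G t s" "(t, s) \<in> adjoin G t s"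
proof -
  have adjoinI: "(poly p t, poly p' s) \<in> adjoin G t s" if "(p, p') \<in> poly_graph G" for p p'
    using that by (auto simp: adjoin_def intro!: image_eqI)
  show "G \<subseteq> adjoin G t s"
    using adjoinI[OF pg_const[OF G]] by auto
  show "(t, s) \<in> adjoin G t s"
    using adjoinI[OF pg_monom[OF G rg_one[OF G], of 1]] by (simp add: poly_monom)
  show "ring_graph (adjoin G t s)"
    unfolding ring_graph_def
  proof (intro conjI allI impI)
    show "(1, 1) \<in> adjoin G t s" using \<open>G \<subseteq> adjoin G t s\<close> rg_one[OF G] by blast
  next
    fix a a' b b' assume "(a, a') \<in> adjoin G t s" "(b, b') \<in> adjoin G t s"
    then obtain p p' q q' where pq: "(p, p') \<in> poly_graph G" "(q, q') \<in> poly_graph G"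
      "a = poly p t" "a' = poly p' s" "b = poly q t" "b' = poly q' s"
      by (auto simp: adjoin_def)
    show "(a - b, a' - b') \<in> adjoin G t s" using adjoinI[OF pg_diff[OF G pq(1,2)]] by (simp add: pq)
    show "(a * b, a' * b') \<in> adjoin G t s" using adjoinI[OF pg_mult[OF G pq(1,2)]] by (simp add: pq)
  next
    fix a a' assume "(a, a') \<in> adjoin G t s"
    then show "a = 0 \<longleftrightarrow> a' = 0" using rel by (auto simp: adjoin_def same_relations_def)
  qed
qed

text \<open>A root of the conjugate of a minimal polynomial satisfies the same algebraic relations,
  because pseudo-division makes sense over any integral domain.\<close>

lemma same_relations_minimal:
  assumes G: "ring_graph G" and g: "(g, g') \<in> poly_graph G" "g \<noteq> 0" "poly g t = 0" "poly g' s = 0"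
    and min: "\<And>p p'. (p, p') \<in> poly_graph G \<Longrightarrow> p \<noteq> 0 \<Longrightarrow> poly p t = 0 \<Longrightarrow> degree g \<le> degree p"
  shows "same_relations G t s"
  unfolding same_relations_def
proof safe
  fix p p' assume p: "(p, p') \<in> poly_graph G" "poly p t = 0"
  obtain a a' u u' r r' where *: "(a, a') \<in> G" "a \<noteq> 0" "(r, r') \<in> poly_graph G"
    "smult a p = g * u + r" "smult a' p' = g' * u' + r'" "r = 0 \<or> degree r < degree g"
    using pg_pseudo_div[OF G g(1,2) p(1)] by blast
  have "poly r t = 0" using arg_cong[OF *(4), of "\<lambda>p. poly p t"] p(2) g(3) by simp
  then have "r = 0" using min[OF *(3)] *(6) by force
  then have "r' = 0" using pg_zero_iff[OF G *(3)] by simp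
  then have "a' * poly p' s = 0" using arg_cong[OF *(5), of "\<lambda>p. poly p s"] g(4) by simp
  moreover have "a' \<noteq> 0" using rg_zero_iff[OF G *(1)] *(2) by simp
  ultimately show "poly p' s = 0" by simp
next
  fix p p' assume p: "(p, p') \<in> poly_graph G" "poly p' s = 0"
  \<comment> \<open>Minimality is given only on the side of \<open>t\<close>. On the side of
    \<open>s\<close> a least \<open>h\<close> is taken; it divides \<open>g\<close> up to a scalar,
    \<open>g = h u\<close>, and since \<open>u\<close> has too small a degree to vanish at
    \<open>t\<close>, the factor \<open>h\<close> must.\<close>
  define H where "H = {(h, h') \<in> poly_graph G. h \<noteq> 0 \<and> poly h' s = 0}"
  have "(g, g') \<in> H" using g by (simp add: H_def)
  then obtain hh where hh: "hh \<in> H" "\<And>k. k \<in> H \<Longrightarrow> degree (fst hh) \<le> degree (fst k)"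
    using ex_has_least_nat[of "\<lambda>x. x \<in> H" "(g, g')" "\<lambda>x. degree (fst x)"] by blast
  obtain h h' where "hh = (h, h')" by force
  with hh have h: "(h, h') \<in> poly_graph G" "h \<noteq> 0" "poly h' s = 0"
     and hmin: "\<And>k k'. (k, k') \<in> poly_graph G \<Longrightarrow> k \<noteq> 0 \<Longrightarrow> poly k' s = 0 \<Longrightarrow> degree h \<le> degree k"
    by (auto simp: H_def)
  have divides: "\<exists>a a' u u'. (a, a') \<in> G \<and> a \<noteq> 0 \<and> (u, u') \<in> poly_graph G \<and> smult a p = h * u"
    if p: "(p, p') \<in> poly_graph G" "poly p' s = 0" for p p'
  proof -
    obtain a a' u u' r r' where *: "(a, a') \<in> G" "a \<noteq> 0" "(u, u') \<in> poly_graph G" "(r, r') \<in> poly_graph G"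
      "smult a p = h * u + r" "smult a' p' = h' * u' + r'" "r = 0 \<or> degree r < degree h"
      using pg_pseudo_div[OF G h(1,2) p(1)] by blast
    have "poly r' s = 0" using arg_cong[OF *(6), of "\<lambda>p. poly p s"] p(2) h(3) by simp
    then have "r = 0" using hmin[OF *(4)] *(7) by force
    then show ?thesis using * by auto
  qed
  obtain a a' u u' where u: "a \<noteq> 0" "(u, u') \<in> poly_graph G" "smult a g = h * u"
    using divides[OF g(1,4)] by blast
  have "poly h t * poly u t = 0" using arg_cong[OF u(3), of "\<lambda>p. poly p t"] g(3) by simp
  moreover have "poly u t \<noteq> 0"
  proof
    assume "poly u t = 0"
    have "u \<noteq> 0" using u g(2) by auto
    then have "degree g \<le> degree u" using min[OF u(2)] \<open>poly u t = 0\<close> by simp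
    moreover have "degree g = degree h + degree u"
      using arg_cong[OF u(3), of degree] u(1) h(2) \<open>u \<noteq> 0\<close> by (simp add: degree_mult_eq)
    ultimately have "degree h = 0" by simp
    then have "degree h' = 0" using pg_degree[OF G h(1)] by simp
    then obtain x where "h' = [:x:]" by (rule degree_eq_zeroE)
    with h(3) have "h' = 0" by simp
    then show False using pg_zero_iff[OF G h(1)] h(2) by simp
  qed
  ultimately have "poly h t = 0" by simp
  obtain b v where bv: "b \<noteq> 0" "smult b p = h * v" using divides[OF p] by blast
  have "b * poly p t = poly h t * poly v t" using arg_cong[OF bv(2), of "\<lambda>p. poly p t"] by simp
  then show "poly p t = 0" using bv(1) \<open>poly h t = 0\<close> by simp
qed

lemma countable_poly_coeffs:
  assumes "countable (C :: complex set)"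
  shows "countable {p. set (coeffs p) \<subseteq> C}"
proof (rule countable_image_inj_on)
  show "countable (coeffs ` {p. set (coeffs p) \<subseteq> C})"
    by (rule countable_subset[OF _ countable_lists[OF assms]]) auto
  show "inj_on coeffs {p. set (coeffs p) \<subseteq> C}" by (auto simp: inj_on_def coeffs_eq_iff)
qed

lemma countable_roots:
  assumes "countable (C :: complex set)"
  shows "countable {x. \<exists>p. p \<noteq> 0 \<and> set (coeffs p) \<subseteq> C \<and> poly p x = 0}"
proof -
  have "{x. \<exists>p. p \<noteq> 0 \<and> set (coeffs p) \<subseteq> C \<and> poly p x = 0}
      = (\<Union>p\<in>{p. set (coeffs p) \<subseteq> C} - {0}. {x. poly p x = 0})" by auto
  also have "countable \<dots>"
    by (intro countable_UN countable_Diff countable_poly_coeffs assms countable_finite poly_roots_finite) auto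
  finally show ?thesis .
qed

text \<open>The ball around \<open>3\<close> only serves to produce a value of modulus greater than \<open>1\<close>.\<close>

lemma exists_same_relations:
  assumes G: "ring_graph G" "countable G"
  obtains s where "same_relations G t s"
    and "(\<forall>(p, p')\<in>poly_graph G. p \<noteq> 0 \<longrightarrow> poly p t \<noteq> 0) \<longrightarrow> s \<in> ball 3 1"
proof (cases "\<forall>(p, p')\<in>poly_graph G. p \<noteq> 0 \<longrightarrow> poly p t \<noteq> 0")
  case True
  \<comment> \<open>Transcendental case: only countably many numbers are algebraic over the second
    ring, so an uncountable ball contains one that is not.\<close>
  have "countable (snd ` G)" using G(2) by simp
  from countable_roots[OF this] have "\<not> ball 3 1 \<subseteq> {x. \<exists>p. p \<noteq> 0 \<and> set (coeffs p) \<subseteq> snd ` G \<and> poly p x = 0}"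
    using uncountable_ball[of 1 "3::complex"] countable_subset by auto
  then obtain s where s: "s \<in> ball 3 1" "\<And>p. p \<noteq> 0 \<Longrightarrow> set (coeffs p) \<subseteq> snd ` G \<Longrightarrow> poly p s \<noteq> 0" by blast
  have "same_relations G t s"
    unfolding same_relations_def
  proof safe
    fix p p' assume p: "(p, p') \<in> poly_graph G" "poly p t = 0"
    then have "p = 0" using True by blast
    then show "poly p' s = 0" using pg_zero_iff[OF G(1) p(1)] by simp
  next
    fix p p' assume p: "(p, p') \<in> poly_graph G" "poly p' s = 0"
    have "set (coeffs p') \<subseteq> snd ` G"
    proof -
      have "range (coeff p') \<subseteq> snd ` G" using p(1) by (force simp: poly_graph_def)
      then show ?thesis by (simp add: range_coeff)
    qed
    then have "p' = 0" using s(2) p(2) by blast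
    then show "poly p t = 0" using pg_zero_iff[OF G(1) p(1)] by simp
  qed
  then show thesis using that s(1) by blast
next
  case False
  \<comment> \<open>Algebraic case: any root of the conjugate of a polynomial of least degree
    vanishing at \<open>t\<close> will do.\<close>
  define H where "H = {(p, p') \<in> poly_graph G. p \<noteq> 0 \<and> poly p t = 0}"
  from False obtain x where "x \<in> H" by (auto simp: H_def)
  then obtain hh where hh: "hh \<in> H" "\<And>k. k \<in> H \<Longrightarrow> degree (fst hh) \<le> degree (fst k)"
    using ex_has_least_nat[of "\<lambda>x. x \<in> H" x "\<lambda>x. degree (fst x)"] by blast
  obtain g g' where "hh = (g, g')" by force
  with hh have g: "(g, g') \<in> poly_graph G" "g \<noteq> 0" "poly g t = 0"
     and min: "\<And>k k'. (k, k') \<in> poly_graph G \<Longrightarrow> k \<noteq> 0 \<Longrightarrow> poly k t = 0 \<Longrightarrow> degree g \<le> degree k"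
    by (auto simp: H_def)
  have "degree g' \<noteq> 0"
  proof
    assume "degree g' = 0"
    then have "degree g = 0" using pg_degree[OF G(1) g(1)] by simp
    then obtain x where "g = [:x:]" by (rule degree_eq_zeroE)
    with g show False by simp
  qed
  then obtain s where s: "poly g' s = 0"
    using fundamental_theorem_of_algebra[of g'] by (auto simp: constant_degree)
  have "same_relations G t s"
    by (rule same_relations_minimal[OF G(1) g s]) (rule min)
  then show thesis using that False by blast
qed


section \<open>Embeddings of countable rings\<close>

definition subring :: "complex set \<Rightarrow> bool" where
  "subring K \<longleftrightarrow> 1 \<in> K \<and> (\<forall>a\<in>K. \<forall>b\<in>K. a - b \<in> K \<and> a * b \<in> K)"

definition embedding :: "complex set \<Rightarrow> (complex \<Rightarrow> complex) \<Rightarrow> bool" where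
  "embedding K \<sigma> \<longleftrightarrow> \<sigma> 1 = 1 \<and> (\<forall>a\<in>K. \<forall>b\<in>K. \<sigma> (a - b) = \<sigma> a - \<sigma> b \<and> \<sigma> (a * b) = \<sigma> a * \<sigma> b) \<and>
     (\<forall>a\<in>K. \<sigma> a = 0 \<longrightarrow> a = 0)"

text \<open>The identity of the integers, from which every embedding is built up:
  \<open>same_relations int_graph c \<mu>\<close> says that \<open>c\<close> and
  \<open>\<mu>\<close> are roots of the same integer polynomials, that is, they are conjugate or
  both transcendental.\<close>

definition int_graph :: "(complex \<times> complex) set" where
  "int_graph = range (\<lambda>n. (of_int n, of_int n))"

lemma ring_graph_int: "ring_graph int_graph"
  unfolding ring_graph_def
proof (intro conjI allI impI)
  show "(1, 1) \<in> int_graph" unfolding int_graph_def by (intro image_eqI[of _ _ 1]) auto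
next
  fix a a' b b' assume "(a, a') \<in> int_graph" "(b, b') \<in> int_graph"
  then obtain m n :: int where "a = of_int m" "a' = of_int m" "b = of_int n" "b' = of_int n"
    by (auto simp: int_graph_def)
  then show "(a - b, a' - b') \<in> int_graph" "(a * b, a' * b') \<in> int_graph"
    unfolding int_graph_def by (auto intro: image_eqI[of _ _ "m - n"] image_eqI[of _ _ "m * n"])
qed (auto simp: int_graph_def)

lemma poly_in_subring:
  assumes "subring K" "\<And>i. coeff p i \<in> K" "t \<in> K"
  shows "poly p t \<in> K"
proof -
  have z: "0 \<in> K" using assms(1) unfolding subring_def by (metis diff_self)
  have add: "a + b \<in> K" if "a \<in> K" "b \<in> K" for a b
    using assms(1) z that unfolding subring_def by (metis add_0 diff_minus_eq_add minus_diff_eq diff_0 )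
  show ?thesis using assms(2)
  proof (induction p)
    case (pCons a p)
    have "coeff p i \<in> K" for i using pCons(3)[of "Suc i"] by simp
    moreover have "a \<in> K" using pCons(3)[of 0] by simp
    ultimately show ?case using pCons(2) add assms(1,3) by (auto simp: subring_def)
  qed (simp add: z)
qed

text \<open>Zorn's lemma for the ring graphs over \<open>K\<close> that send \<open>c\<close> to
  \<open>\<mu>\<close>. A maximal one is defined on all of \<open>K\<close>, because any further
  element of \<open>K\<close> could still be adjoined.\<close>

theorem embedding_exists:
  assumes K: "countable K" "subring K" and c: "c \<in> K" and rel: "same_relations int_graph c \<mu>"
  obtains \<sigma> where "embedding K \<sigma>" "\<sigma> c = \<mu>"
proof -
  have ofint: "of_int n \<in> K" for n :: int
  proof -
    have z: "0 \<in> K" "1 \<in> K" using K(2) unfolding subring_def by (metis diff_self)+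
    then have minus: "- a \<in> K" if "a \<in> K" for a using K(2) that unfolding subring_def by (metis diff_0)
    then have add: "a + b \<in> K" if "a \<in> K" "b \<in> K" for a b
      using K(2) that unfolding subring_def by (metis diff_minus_eq_add)
    have nat: "of_nat n \<in> K" for n by (induction n) (auto intro: z add)
    show ?thesis
    proof (cases n)
      case (nonneg m) then show ?thesis using nat by simp
    next
      case (neg m) then show ?thesis using minus[OF nat[of "Suc m"]] by simp
    qed
  qed
  define G0 where "G0 = adjoin int_graph c \<mu>"
  note G0 = ring_graph_adjoin[OF ring_graph_int rel, folded G0_def]
  have sub: "fst ` adjoin G t s \<subseteq> K" if G: "fst ` G \<subseteq> K" "t \<in> K" for G t s
  proof -
    have "poly p t \<in> K" if "(p, p') \<in> poly_graph G" for p p'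
      using that G by (intro poly_in_subring[OF K(2)]) (force simp: poly_graph_def)+
    then show ?thesis by (auto simp: adjoin_def)
  qed
  define \<G> where "\<G> = {G. ring_graph G \<and> fst ` G \<subseteq> K \<and> G0 \<subseteq> G}"
  have G0K: "fst ` G0 \<subseteq> K" unfolding G0_def using c ofint by (intro sub) (auto simp: int_graph_def)
  have "\<exists>M\<in>\<G>. \<forall>X\<in>\<G>. M \<subseteq> X \<longrightarrow> X = M"
  proof (rule subset_Zorn_nonempty)
    show "\<G> \<noteq> {}" using G0 G0K by (auto simp: \<G>_def)
    fix \<C> assume ne: "\<C> \<noteq> {}" and ch: "subset.chain \<G> \<C>"
    then have sub: "\<C> \<subseteq> \<G>" and tot: "\<And>X Y. X \<in> \<C> \<Longrightarrow> Y \<in> \<C> \<Longrightarrow> X \<subseteq> Y \<or> Y \<subseteq> X"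
      by (auto simp: subset_chain_def)
    obtain X0 where X0: "X0 \<in> \<C>" using ne by blast
    have "ring_graph (\<Union>\<C>)"
      unfolding ring_graph_def
    proof (intro conjI allI impI)
      have "ring_graph X0" using X0 sub by (auto simp: \<G>_def)
      from rg_one[OF this] X0 show "(1, 1) \<in> \<Union>\<C>" by blast
    next
      fix a a' b b' assume "(a, a') \<in> \<Union>\<C>" "(b, b') \<in> \<Union>\<C>"
      then obtain X Y where XY: "X \<in> \<C>" "Y \<in> \<C>" "(a, a') \<in> X" "(b, b') \<in> Y" by blast
      then obtain Z where Z: "Z \<in> \<C>" "(a, a') \<in> Z" "(b, b') \<in> Z" using tot[OF XY(1,2)] by blast
      then have rgZ: "ring_graph Z" using sub by (auto simp: \<G>_def)
      show "(a - b, a' - b') \<in> \<Union>\<C>" "(a * b, a' * b') \<in> \<Union>\<C>"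
        using rg_diff[OF rgZ Z(2,3)] rg_mult[OF rgZ Z(2,3)] Z(1) by blast+
    next
      fix a a' assume "(a, a') \<in> \<Union>\<C>"
      then obtain X where X: "X \<in> \<C>" "(a, a') \<in> X" by blast
      then have "ring_graph X" using sub by (auto simp: \<G>_def)
      from rg_zero_iff[OF this X(2)] show "a = 0 \<longleftrightarrow> a' = 0" .
    qed
    moreover have "fst ` \<Union>\<C> \<subseteq> K" using sub by (force simp: \<G>_def)
    moreover have "G0 \<subseteq> X0" using X0 sub by (auto simp: \<G>_def)
    then have "G0 \<subseteq> \<Union>\<C>" using X0 by blast
    ultimately show "\<Union>\<C> \<in> \<G>" by (simp add: \<G>_def)
  qed
  then obtain G where "G \<in> \<G>" and max: "\<And>X. X \<in> \<G> \<Longrightarrow> G \<subseteq> X \<Longrightarrow> X = G" by blast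
  then have G: "ring_graph G" "fst ` G \<subseteq> K" "G0 \<subseteq> G" by (auto simp: \<G>_def)
  \<comment> \<open>Single-valuedness makes the first projection injective, so countability passes
    from \<open>K\<close> to \<open>G\<close>, as the adjunction of an element requires.\<close>
  have "inj_on fst G" using rg_unique[OF G(1)] by (auto simp: inj_on_def)
  moreover have "countable (fst ` G)" using G(2) K(1) countable_subset by blast
  ultimately have cG: "countable G" by (rule countable_image_inj_on[rotated])
  have tot: "\<exists>s. (t, s) \<in> G" if t: "t \<in> K" for t
  proof -
    obtain s where s: "same_relations G t s" using exists_same_relations[OF G(1) cG] by blast
    note A = ring_graph_adjoin[OF G(1) s]
    have "adjoin G t s \<in> \<G>" using A G sub[OF G(2) t, of s] by (auto simp: \<G>_def)
    with max A(2) have "adjoin G t s = G" by blast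
    with A(3) show ?thesis by auto
  qed
  then obtain \<sigma> where \<sigma>: "\<And>t. t \<in> K \<Longrightarrow> (t, \<sigma> t) \<in> G" by metis
  have eq: "\<sigma> a = b" if "(a, b) \<in> G" for a b
  proof -
    have "a \<in> K" using that G(2) by force
    from rg_unique[OF G(1) \<sigma>[OF this] that] show ?thesis .
  qed
  show thesis
  proof (rule that[of \<sigma>])
    show "\<sigma> c = \<mu>" using eq G0(3) G(3) by blast
    show "embedding K \<sigma>"
      unfolding embedding_def
    proof (intro conjI ballI impI)
      show "\<sigma> 1 = 1" by (rule eq[OF rg_one[OF G(1)]])
      fix a assume a: "a \<in> K"
      show "a = 0" if "\<sigma> a = 0" using rg_zero_iff[OF G(1) \<sigma>[OF a]] that by simp
      fix b assume b: "b \<in> K"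
      show "\<sigma> (a - b) = \<sigma> a - \<sigma> b" by (rule eq[OF rg_diff[OF G(1) \<sigma>[OF a] \<sigma>[OF b]]])
      show "\<sigma> (a * b) = \<sigma> a * \<sigma> b" by (rule eq[OF rg_mult[OF G(1) \<sigma>[OF a] \<sigma>[OF b]]])
    qed
  qed
qed

text \<open>Closing up under differences, products and roots countably often suffices: the finitely
  many coefficients of a polynomial already occur at a common stage.\<close>

lemma countable_algebraically_closed:
  assumes "countable S"
  obtains K where "countable K" "S \<subseteq> K" "subring K"
    "\<And>p x. p \<noteq> 0 \<Longrightarrow> set (coeffs p) \<subseteq> K \<Longrightarrow> poly p x = 0 \<Longrightarrow> x \<in> K"
proof -
  define step :: "complex set \<Rightarrow> complex set" where
    "step A = insert 1 A \<union> (\<lambda>(a, b). a - b) ` (A \<times> A) \<union> (\<lambda>(a, b). a * b) ` (A \<times> A)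
       \<union> {x. \<exists>p. p \<noteq> 0 \<and> set (coeffs p) \<subseteq> A \<and> poly p x = 0}" for A
  have cstep: "countable (step A)" if "countable A" for A
    using that countable_roots[OF that] by (auto simp: step_def)
  define F where "F n = (step ^^ n) S" for n
  have FS: "F (Suc n) = step (F n)" for n by (simp add: F_def)
  have cF: "countable (F n)" for n
    by (induction n) (auto simp: FS cstep, simp add: F_def assms)
  have "F n \<subseteq> F (Suc n)" for n by (auto simp: FS step_def)
  then have mono: "F m \<subseteq> F n" if "m \<le> n" for m n using that lift_Suc_mono_le[of F] by blast
  define K where "K = (\<Union>n. F n)"
  have stepK: "x \<in> K" if "x \<in> step (F n)" for x n using that by (auto simp: K_def FS[symmetric] simp del: UN_iff)
  show thesis
  proof (rule that[of K])
    show "countable K" unfolding K_def using cF by auto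
    show "S \<subseteq> K" unfolding K_def using UN_upper[of 0 UNIV F] by (simp add: F_def)
    show "subring K"
      unfolding subring_def
    proof (intro conjI ballI)
      show "1 \<in> K" by (rule stepK[of _ 0]) (simp add: step_def)
      fix a b assume "a \<in> K" "b \<in> K"
      then obtain m n where "a \<in> F m" "b \<in> F n" by (auto simp: K_def)
      then have "a \<in> F (max m n)" "b \<in> F (max m n)" using mono[of m "max m n"] mono[of n "max m n"] by auto
      then show "a - b \<in> K" "a * b \<in> K"
        by (auto intro!: stepK[of _ "max m n"] simp: step_def)
    qed
    fix p :: "complex poly" and x assume p: "p \<noteq> 0" "set (coeffs p) \<subseteq> K" "poly p x = 0"
    have "\<exists>n. A \<subseteq> F n" if "finite A" "A \<subseteq> K" for A
      using that
    proof (induction A)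
      case (insert a A)
      then obtain m n where "A \<subseteq> F m" "a \<in> F n" by (auto simp: K_def)
      then have "insert a A \<subseteq> F (max m n)" using mono[of m "max m n"] mono[of n "max m n"] by auto
      then show ?case by blast
    qed simp
    then obtain n where "set (coeffs p) \<subseteq> F n" using p(2) by blast
    then show "x \<in> K" using p by (intro stepK[of _ n]) (auto simp: step_def)
  qed
qed


section \<open>Numbers all of whose conjugates lie in the unit disc\<close>

lemma poly_graph_int_iff: "(p, p') \<in> poly_graph int_graph \<longleftrightarrow> p' = p \<and> (\<forall>i. coeff p i \<in> \<int>)"
proof -
  have "(a, b) \<in> int_graph \<longleftrightarrow> b = a \<and> a \<in> \<int>" for a b
    by (auto simp: int_graph_def Ints_def)
  then show ?thesis by (auto simp: poly_graph_def poly_eq_iff)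
qed

lemma conjugate_bound_imp_algebraic:
  assumes bound: "\<And>\<mu>. same_relations int_graph c \<mu> \<Longrightarrow> cmod \<mu> \<le> 1"
  shows "algebraic c"
proof (rule ccontr)
  assume "\<not> ?thesis"
  then have trans: "\<forall>(p, p')\<in>poly_graph int_graph. p \<noteq> 0 \<longrightarrow> poly p c \<noteq> 0"
    unfolding algebraic_def by (fastforce simp: poly_graph_int_iff)
  have "countable int_graph" by (simp add: int_graph_def)
  then obtain s where s: "same_relations int_graph c s"
    and "(\<forall>(p, p')\<in>poly_graph int_graph. p \<noteq> 0 \<longrightarrow> poly p c \<noteq> 0) \<longrightarrow> s \<in> ball 3 1"
    by (rule exists_same_relations[OF ring_graph_int, of c])
  with trans have s3: "s \<in> ball 3 1" by (rule_tac mp)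
  have "cmod 3 \<le> cmod (3 - s) + cmod s" using norm_triangle_ineq[of "3 - s" s] by simp
  then show False using bound[OF s] s3 by (simp add: dist_norm)
qed

text \<open>Gauss's lemma: a primitive integer polynomial of least degree vanishing at
  \<open>c\<close> divides a monic one up to a constant, and comparison of contents makes its
  leading coefficient a unit.\<close>

lemma algebraic_int_minimal_poly:
  fixes c :: complex
  assumes "algebraic_int c"
  obtains g :: "int poly" where "g \<noteq> 0" "\<bar>lead_coeff g\<bar> = 1" "poly (map_poly of_int g) c = 0"
    "\<And>h :: int poly. h \<noteq> 0 \<Longrightarrow> poly (map_poly of_int h) c = 0 \<Longrightarrow> degree g \<le> degree h"
proof -
  let ?C = "map_poly (of_int :: int \<Rightarrow> complex)"
  have C_mult: "?C (a * b) = ?C a * ?C b" for a b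
    by (rule poly_eqI) (simp add: coeff_map_poly coeff_mult)
  have C_eq: "?C a = ?C b \<longleftrightarrow> a = b" for a b by (auto simp: poly_eq_iff coeff_map_poly)
  have C_degree: "degree (?C a) = degree a" for a by (rule degree_map_poly) auto
  have C_pg: "(?C a, ?C a) \<in> poly_graph int_graph" for a
    by (auto simp: poly_graph_int_iff coeff_map_poly)
  obtain q where q: "poly (?C q) c = 0" "lead_coeff q = 1"
    using assms unfolding algebraic_int_altdef_ipoly by blast
  have "q \<noteq> 0" using q(2) by auto
  define H where "H = {h. h \<noteq> 0 \<and> poly (?C h) c = 0}"
  have "q \<in> H" using q \<open>q \<noteq> 0\<close> by (simp add: H_def)
  then obtain g0 where g0: "g0 \<in> H" "\<And>k. k \<in> H \<Longrightarrow> degree g0 \<le> degree k"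
    using ex_has_least_nat[of "\<lambda>x. x \<in> H" q degree] by blast
  define g where "g = primitive_part g0"
  have "g0 \<noteq> 0" using g0 by (simp add: H_def)
  have g0_eq: "g0 = [:content g0:] * g" unfolding g_def by simp
  have "g \<noteq> 0" using \<open>g0 \<noteq> 0\<close> by (simp add: g_def)
  have "poly (?C g0) c = poly (?C [:content g0:]) c * poly (?C g) c"
    using arg_cong[OF g0_eq, of "\<lambda>p. poly (?C p) c"] unfolding C_mult poly_mult .
  then have gc: "poly (?C g) c = 0" using g0(1) \<open>g0 \<noteq> 0\<close> by (simp add: H_def map_poly_pCons)
  have "degree g = degree g0" by (simp add: g_def)
  then have min: "degree g \<le> degree h" if "h \<noteq> 0" "poly (?C h) c = 0" for h
    using g0(2)[of h] that by (simp add: H_def)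
  have minC: "degree (?C g) \<le> degree p" if "(p, p') \<in> poly_graph int_graph" "p \<noteq> 0" "poly p c = 0" for p p'
  proof -
    from that obtain h where "p = ?C h" unfolding poly_graph_int_iff by (metis intpolyE)
    moreover from this that have "h \<noteq> 0" by auto
    ultimately show ?thesis using min[of h] that(3) by (simp add: C_degree)
  qed
  have gC0: "?C g \<noteq> 0" using \<open>g \<noteq> 0\<close> C_eq[of g 0] by simp
  have lead: "\<bar>lead_coeff g\<bar> = 1"
  proof -
    obtain a a' u u' r r' where *: "(a, a') \<in> int_graph" "a \<noteq> 0" "(u, u') \<in> poly_graph int_graph"
      "(r, r') \<in> poly_graph int_graph" "smult a (?C q) = ?C g * u + r" "r = 0 \<or> degree r < degree (?C g)"
      using pg_pseudo_div[OF ring_graph_int C_pg gC0 C_pg[of q]] by blast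
    have "poly r c = 0" using arg_cong[OF *(5), of "\<lambda>p. poly p c"] q(1) gc by simp
    then have "r = 0" using minC[OF *(4)] *(6) by force
    obtain a0 where a0: "a = of_int a0" using *(1) by (auto simp: int_graph_def)
    obtain u0 where u0: "u = ?C u0" using *(3) unfolding poly_graph_int_iff by (metis intpolyE)
    have "?C ([:a0:] * q) = ?C (g * u0)"
      unfolding C_mult using *(5) \<open>r = 0\<close> a0 u0 by (simp add: map_poly_pCons)
    then have eq: "smult a0 q = g * u0" by (simp add: C_eq)
    \<comment> \<open>The monic \<open>q\<close> and the primitive \<open>g\<close> both have
      content 1, so the content of the cofactor is exactly \<open>\<bar>a0\<bar>\<close> and
      cancels.\<close>
    have "content q dvd 1" using content_dvd_coeff[of q "degree q"] q(2) by simp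
    then have "content q = 1" using is_unit_content_iff by blast
    moreover have "content g = 1" using \<open>g0 \<noteq> 0\<close> by (simp add: g_def)
    ultimately have cu: "content u0 = \<bar>a0\<bar>"
      using arg_cong[OF eq, of content] by (simp add: content_mult)
    define u1 where "u1 = primitive_part u0"
    have "u0 = smult \<bar>a0\<bar> u1" using content_times_primitive_part[of u0] by (simp add: cu u1_def)
    then have "smult a0 q = smult \<bar>a0\<bar> (g * u1)" using eq by simp
    then have "lead_coeff (smult a0 q) = lead_coeff (smult \<bar>a0\<bar> (g * u1))" by (rule arg_cong)
    then have a0_eq: "a0 = \<bar>a0\<bar> * (lead_coeff g * lead_coeff u1)"
      unfolding lead_coeff_smult lead_coeff_mult q(2) by simp
    have "a0 \<noteq> 0" using *(2) a0 by auto
    have "\<bar>a0\<bar> = \<bar>a0\<bar> * \<bar>lead_coeff g * lead_coeff u1\<bar>"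
      using arg_cong[OF a0_eq, of abs] unfolding abs_mult abs_abs .
    then have "\<bar>lead_coeff g * lead_coeff u1\<bar> = 1"
      using \<open>a0 \<noteq> 0\<close> unfolding mult_cancel_left1 by (simp only: abs_eq_0 simp_thms)
    then show ?thesis by (rule abs_zmult_eq_1)
  qed
  show thesis by (rule that[OF \<open>g \<noteq> 0\<close> lead gc]) (rule min)
qed

lemma conjugate_bound_imp_cmod_eq_1:
  assumes bound: "\<And>\<mu>. same_relations int_graph c \<mu> \<Longrightarrow> cmod \<mu> \<le> 1"
    and c: "algebraic_int c" "c \<noteq> 0"
  shows "cmod c = 1"
proof -
  let ?C = "map_poly (of_int :: int \<Rightarrow> complex)"
  have C_eq: "?C a = ?C b \<longleftrightarrow> a = b" for a b by (auto simp: poly_eq_iff coeff_map_poly)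
  have C_degree: "degree (?C a) = degree a" for a by (rule degree_map_poly) auto
  have C_pg: "(?C a, ?C a) \<in> poly_graph int_graph" for a
    by (auto simp: poly_graph_int_iff coeff_map_poly)
  obtain g :: "int poly" where g: "g \<noteq> 0" and lead: "\<bar>lead_coeff g\<bar> = 1" and gc: "poly (?C g) c = 0"
    and min: "\<And>h. h \<noteq> 0 \<Longrightarrow> poly (?C h) c = 0 \<Longrightarrow> degree g \<le> degree h"
    using algebraic_int_minimal_poly[OF c(1)] by metis
  have minC: "degree (?C g) \<le> degree p" if "(p, p') \<in> poly_graph int_graph" "p \<noteq> 0" "poly p c = 0" for p p'
  proof -
    from that obtain h where "p = ?C h" unfolding poly_graph_int_iff by (metis intpolyE)
    moreover from this that have "h \<noteq> 0" by auto
    ultimately show ?thesis using min[of h] that(3) by (simp add: C_degree)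
  qed
  have gC0: "?C g \<noteq> 0" using g C_eq[of g 0] by simp
  have conj: "cmod \<mu> \<le> 1" if "poly (?C g) \<mu> = 0" for \<mu>
    by (rule bound, rule same_relations_minimal[OF ring_graph_int C_pg gC0 gc that]) (rule minC)
  obtain root where root: "smult (lead_coeff (?C g)) (\<Prod>i<degree (?C g). [:- root i, 1:]) = ?C g"
    using complex_poly_decompose' by blast
  define n where "n = degree (?C g)"
  have leadC: "cmod (lead_coeff (?C g)) = 1"
    using lead by (simp add: C_degree coeff_map_poly)
  have eval: "poly (?C g) z = lead_coeff (?C g) * (\<Prod>i<n. z - root i)" for z
    using arg_cong[OF root, of "\<lambda>p. poly p z"] by (simp add: poly_prod n_def)
  have le1: "cmod (root i) \<le> 1" if "i < n" for i
    using that by (intro conj) (auto simp: eval)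
  \<comment> \<open>Otherwise \<open>g\<close> divided by the variable would still vanish at
    \<open>c \<noteq> 0\<close>, with smaller degree.\<close>
  have "coeff g 0 \<noteq> 0"
  proof
    assume "coeff g 0 = 0"
    then obtain h where h: "g = pCons 0 h" by (metis coeff_pCons_0 pCons_cases)
    then have "poly (?C h) c = 0" "h \<noteq> 0"
      using gc c(2) g by (auto simp: map_poly_pCons)
    then show False using min[of h] h by simp
  qed
  have "1 \<le> cmod (poly (?C g) 0)"
    using \<open>coeff g 0 \<noteq> 0\<close> by (simp add: poly_0_coeff_0 coeff_map_poly)
  also have "\<dots> = (\<Prod>i<n. cmod (root i))" unfolding eval norm_mult leadC by (simp add: prod_norm[symmetric])
  finally have ge: "1 \<le> (\<Prod>i<n. cmod (root i))" .
  have "(\<Prod>i<n. c - root i) = 0" using gc gC0 by (simp add: eval)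
  then obtain j where j: "j < n" "root j = c" by auto
  \<comment> \<open>The product of the moduli is at least 1 and no factor exceeds 1, so the factor
    belonging to \<open>c\<close> is itself at least 1.\<close>
  have "(\<Prod>i<n. cmod (root i)) = cmod (root j) * (\<Prod>i\<in>{..<n} - {j}. cmod (root i))"
    using j by (intro prod.remove) auto
  also have "\<dots> \<le> cmod (root j) * 1"
    using le1 by (intro mult_left_mono prod_le_1) auto
  finally have "1 \<le> cmod (root j)" using ge by linarith
  with le1[OF j(1)] show ?thesis unfolding j(2) by (rule antisym)
qed

section \<open>Conjugating polynomials by an embedding\<close>

locale alg_closed_embedding =
  fixes K :: "complex set" and \<sigma> :: "complex \<Rightarrow> complex"
  assumes subring: "subring K" and embedding: "embedding K \<sigma>"
    and closed: "\<And>p x. p \<noteq> 0 \<Longrightarrow> set (coeffs p) \<subseteq> K \<Longrightarrow> poly p x = 0 \<Longrightarrow> x \<in> K"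
begin

definition over_K :: "complex poly \<Rightarrow> bool" where "over_K p \<longleftrightarrow> (\<forall>i. coeff p i \<in> K)"

lemma K_one: "1 \<in> K" and K_diff: "a \<in> K \<Longrightarrow> b \<in> K \<Longrightarrow> a - b \<in> K"
  and K_mult: "a \<in> K \<Longrightarrow> b \<in> K \<Longrightarrow> a * b \<in> K"
  using subring by (auto simp: subring_def)

lemma K_zero: "0 \<in> K" using K_diff[OF K_one K_one] by simp

lemma K_minus: "a \<in> K \<Longrightarrow> - a \<in> K" using K_diff[OF K_zero] by simp

lemma K_add: "a \<in> K \<Longrightarrow> b \<in> K \<Longrightarrow> a + b \<in> K" using K_diff[OF _ K_minus] by fastforce

lemma K_of_nat: "of_nat n \<in> K" by (induction n) (auto intro: K_zero K_one K_add)

lemma \<sigma>_one: "\<sigma> 1 = 1" and \<sigma>_diff: "a \<in> K \<Longrightarrow> b \<in> K \<Longrightarrow> \<sigma> (a - b) = \<sigma> a - \<sigma> b"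
  and \<sigma>_mult: "a \<in> K \<Longrightarrow> b \<in> K \<Longrightarrow> \<sigma> (a * b) = \<sigma> a * \<sigma> b" and \<sigma>_eq_0: "a \<in> K \<Longrightarrow> \<sigma> a = 0 \<Longrightarrow> a = 0"
  using embedding by (auto simp: embedding_def)

lemma \<sigma>_zero [simp]: "\<sigma> 0 = 0" using \<sigma>_diff[OF K_one K_one] by simp

lemma \<sigma>_minus: "a \<in> K \<Longrightarrow> \<sigma> (- a) = - \<sigma> a" using \<sigma>_diff[OF K_zero, of a] by simp

lemma \<sigma>_add: "a \<in> K \<Longrightarrow> b \<in> K \<Longrightarrow> \<sigma> (a + b) = \<sigma> a + \<sigma> b"
  using \<sigma>_diff[of a "- b"] K_minus[of b] \<sigma>_minus[of b] by simp

lemma \<sigma>_of_nat: "\<sigma> (of_nat n) = of_nat n"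
  by (induction n) (auto simp: \<sigma>_add \<sigma>_one K_one K_of_nat)

lemma \<sigma>_inj: "inj_on \<sigma> K"
  using \<sigma>_diff \<sigma>_eq_0 K_diff by (intro inj_onI) (metis right_minus_eq)

lemma \<sigma>_eq_0_iff: "a \<in> K \<Longrightarrow> \<sigma> a = 0 \<longleftrightarrow> a = 0" using \<sigma>_eq_0 by auto

lemma K_sum: "(\<And>i. i \<in> A \<Longrightarrow> f i \<in> K) \<Longrightarrow> sum f A \<in> K"
  by (induction A rule: infinite_finite_induct) (auto intro: K_zero K_add)

lemma \<sigma>_sum: "(\<And>i. i \<in> A \<Longrightarrow> f i \<in> K) \<Longrightarrow> \<sigma> (sum f A) = (\<Sum>i\<in>A. \<sigma> (f i))"
  by (induction A rule: infinite_finite_induct) (auto simp: \<sigma>_add K_sum)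

text \<open>\<open>K\<close> is assumed to be a subring only; an inverse lies in it as a root of
  \<open>a X - 1\<close>.\<close>

lemma K_inverse:
  assumes "a \<in> K"
  shows "inverse a \<in> K"
proof (cases "a = 0")
  case False
  have "set (coeffs [:-1, a:]) \<subseteq> K" using False assms K_minus[OF K_one] by simp
  then show ?thesis using False by (intro closed[of "[:-1, a:]"]) auto
qed (simp add: K_zero)

lemma \<sigma>_inverse:
  assumes "a \<in> K"
  shows "\<sigma> (inverse a) = inverse (\<sigma> a)"
proof (cases "a = 0")
  case False
  then have "\<sigma> a * \<sigma> (inverse a) = 1"
    using \<sigma>_mult[OF assms K_inverse[OF assms]] by (simp add: \<sigma>_one)
  then show ?thesis using inverse_unique[of "\<sigma> a" "\<sigma> (inverse a)"] by simp
qed simp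

lemma K_divide: "a \<in> K \<Longrightarrow> b \<in> K \<Longrightarrow> a / b \<in> K"
  by (simp add: divide_inverse K_mult K_inverse)

lemma \<sigma>_divide: "a \<in> K \<Longrightarrow> b \<in> K \<Longrightarrow> \<sigma> (a / b) = \<sigma> a / \<sigma> b"
  by (simp add: divide_inverse \<sigma>_mult \<sigma>_inverse K_inverse)

lemma K_power: "a \<in> K \<Longrightarrow> a ^ n \<in> K" by (induction n) (auto intro: K_one K_mult)

lemma \<sigma>_power: "a \<in> K \<Longrightarrow> \<sigma> (a ^ n) = \<sigma> a ^ n"
  by (induction n) (auto simp: \<sigma>_one \<sigma>_mult K_power)

abbreviation conj_poly :: "complex poly \<Rightarrow> complex poly" where "conj_poly \<equiv> map_poly \<sigma>"

lemma coeff_conj: "coeff (conj_poly p) i = \<sigma> (coeff p i)" by (simp add: coeff_map_poly)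

lemma over_K_coeffs: "over_K p \<Longrightarrow> set (coeffs p) \<subseteq> K"
proof -
  assume "over_K p"
  then have "range (coeff p) \<subseteq> K" by (auto simp: over_K_def)
  then show ?thesis by (simp add: range_coeff)
qed

lemma degree_conj: "over_K p \<Longrightarrow> degree (conj_poly p) = degree p"
  unfolding degree_def coeff_conj by (simp add: over_K_def \<sigma>_eq_0_iff)

lemma conj_eq_0: "over_K p \<Longrightarrow> conj_poly p = 0 \<longleftrightarrow> p = 0"
  by (auto simp: poly_eq_iff coeff_conj over_K_def \<sigma>_eq_0_iff)

lemma over_K_mult: "over_K p \<Longrightarrow> over_K q \<Longrightarrow> over_K (p * q)"
  and over_K_diff: "over_K p \<Longrightarrow> over_K q \<Longrightarrow> over_K (p - q)"
  and over_K_smult: "a \<in> K \<Longrightarrow> over_K q \<Longrightarrow> over_K (smult a q)"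
  and over_K_pderiv: "over_K p \<Longrightarrow> over_K (pderiv p)"
  using K_of_nat[of "Suc _"] by (auto simp: over_K_def coeff_mult coeff_pderiv intro!: K_sum K_mult K_diff simp del: of_nat_Suc)

lemma conj_mult: "over_K p \<Longrightarrow> over_K q \<Longrightarrow> conj_poly (p * q) = conj_poly p * conj_poly q"
  by (rule poly_eqI) (auto simp: coeff_conj coeff_mult over_K_def \<sigma>_sum \<sigma>_mult K_mult)

lemma conj_diff: "over_K p \<Longrightarrow> over_K q \<Longrightarrow> conj_poly (p - q) = conj_poly p - conj_poly q"
  by (rule poly_eqI) (auto simp: coeff_conj over_K_def \<sigma>_diff)

lemma conj_smult: "a \<in> K \<Longrightarrow> over_K q \<Longrightarrow> conj_poly (smult a q) = smult (\<sigma> a) (conj_poly q)"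
  by (rule poly_eqI) (auto simp: coeff_conj over_K_def \<sigma>_mult)

lemma conj_pderiv: "over_K p \<Longrightarrow> conj_poly (pderiv p) = pderiv (conj_poly p)"
  by (rule poly_eqI) (simp add: coeff_conj over_K_def coeff_pderiv \<sigma>_mult K_of_nat \<sigma>_of_nat del: of_nat_Suc)

lemma K_poly: "over_K p \<Longrightarrow> x \<in> K \<Longrightarrow> poly p x \<in> K"
  using poly_in_subring[OF subring] by (simp add: over_K_def)

lemma poly_conj:
  assumes "over_K p" "x \<in> K"
  shows "poly (conj_poly p) (\<sigma> x) = \<sigma> (poly p x)"
proof -
  have "poly (conj_poly p) (\<sigma> x) = (\<Sum>i\<le>degree p. \<sigma> (coeff p i) * \<sigma> x ^ i)"
    by (subst poly_altdef) (simp add: degree_conj[OF assms(1)] coeff_conj)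
  also have "\<dots> = \<sigma> (\<Sum>i\<le>degree p. coeff p i * x ^ i)"
    using assms by (subst \<sigma>_sum) (auto simp: over_K_def \<sigma>_mult \<sigma>_power K_mult K_power)
  finally show ?thesis by (simp add: poly_altdef)
qed

lemma root_in_K: "over_K p \<Longrightarrow> p \<noteq> 0 \<Longrightarrow> poly p x = 0 \<Longrightarrow> x \<in> K"
  using closed over_K_coeffs by blast

text \<open>Over the algebraically closed \<open>K\<close> the polynomial splits into linear
  factors, and conjugation acts on each of them. Without this, a conjugate fibre might contain
  points that come from no point of the original one.\<close>

lemma conj_root:
  assumes p: "over_K p" "p \<noteq> 0" and z: "poly (conj_poly p) z = 0"
  shows "\<exists>x. poly p x = 0 \<and> z = \<sigma> x"
  using assms
proof (induction "degree p" arbitrary: p)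
  case 0
  then obtain a where "p = [:a:]" by (metis degree_eq_zeroE)
  moreover from this 0(2) have "a \<in> K" unfolding over_K_def by (metis coeff_pCons_0)
  ultimately show ?case using 0 \<sigma>_eq_0[of a] by (auto simp: map_poly_pCons)
next
  case (Suc n)
  then have "\<not> constant (poly p)" by (simp add: constant_degree)
  then obtain x where x: "poly p x = 0" using fundamental_theorem_of_algebra by blast
  then have xK: "x \<in> K" using Suc.prems root_in_K by blast
  obtain q where q: "p = [:-x, 1:] * q" using x by (auto simp: poly_eq_0_iff_dvd)
  have lin: "over_K [:-x, 1:]"
    using xK K_minus K_one K_zero by (auto simp: over_K_def coeff_pCons split: nat.splits)
  have oq: "over_K q"
  proof -
    \<comment> \<open>The cofactor of \<open>X - x\<close> is computed from the top down by
      \<open>q_i = p_(i+1) + x q_(i+1)\<close>, without leaving \<open>K\<close>.\<close>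
    have "coeff q i \<in> K" if "i \<le> degree q" for i
      using that
    proof (induction "degree q - i" arbitrary: i rule: less_induct)
      case less
      have e: "coeff p (Suc i) = coeff q i - x * coeff q (Suc i)"
        unfolding q by (simp add: coeff_pCons algebra_simps)
      have "coeff q (Suc i) \<in> K"
      proof (cases "Suc i \<le> degree q")
        case True
        then show ?thesis using less by auto
      qed (simp add: coeff_eq_0 K_zero)
      moreover have "coeff q i = coeff p (Suc i) + x * coeff q (Suc i)" using e by simp
      ultimately show ?case using Suc.prems(1) xK by (auto simp: over_K_def intro!: K_add K_mult)
    qed
    then show ?thesis unfolding over_K_def by (metis K_zero coeff_eq_0 not_le)
  qed
  have q0: "q \<noteq> 0" using Suc.prems(2) q by auto
  have "degree p = Suc (degree q)" unfolding q using q0 by (subst degree_mult_eq) auto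
  then have dq: "n = degree q" using Suc.hyps(2) by simp
  have "conj_poly [:-x, 1:] = [:- \<sigma> x, 1:]" using xK by (simp add: map_poly_pCons \<sigma>_minus \<sigma>_one)
  then have "conj_poly p = [:- \<sigma> x, 1:] * conj_poly q" unfolding q using conj_mult[OF lin oq] by simp
  then have "z = \<sigma> x \<or> poly (conj_poly q) z = 0" using Suc.prems(3) by auto
  then show ?case
  proof
    assume "poly (conj_poly q) z = 0"
    from Suc.hyps(1)[OF dq oq q0 this] show ?thesis unfolding q by auto
  qed (use x in blast)
qed

end

lemma coprime_if_no_common_root:
  fixes p q :: "complex poly"
  assumes "p \<noteq> 0" "\<And>x. poly p x = 0 \<Longrightarrow> poly q x \<noteq> 0"
  shows "coprime p q"
proof (rule coprimeI)
  fix d assume d: "d dvd p" "d dvd q"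
  show "is_unit d"
  proof (rule ccontr)
    assume "\<not> is_unit d"
    moreover have "d \<noteq> 0" using d assms(1) by auto
    ultimately have "\<not> constant (poly d)" by (simp add: constant_degree is_unit_iff_degree)
    then obtain x where "poly d x = 0" using fundamental_theorem_of_algebra by blast
    then have "poly p x = 0" "poly q x = 0" using d by (auto elim!: dvdE)
    with assms(2) show False by blast
  qed
qed

text \<open>Coprimality and squarefreeness are read off from roots: a common or multiple root after
  conjugation is the image of one before it. The equation itself is continued from points of
  \<open>K\<close>.\<close>

theorem (in eigen_differential) eigen_differential_conj:
  assumes "alg_closed_embedding K \<sigma>"
    and coeffs: "set (coeffs P) \<union> set (coeffs Q) \<union> set (coeffs N) \<union> set (coeffs M) \<union> {c} \<subseteq> K"
  shows "eigen_differential (map_poly \<sigma> P) (map_poly \<sigma> Q) (map_poly \<sigma> N) (map_poly \<sigma> M) (\<sigma> c)"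
proof -
  interpret K: alg_closed_embedding K \<sigma> by fact
  have over: "K.over_K P" "K.over_K Q" "K.over_K N" "K.over_K M"
  proof -
    have "K.over_K p" if "set (coeffs p) \<subseteq> K" for p
    proof -
      have "range (coeff p) \<subseteq> K" using that K.K_zero by (simp add: range_coeff)
      then show ?thesis by (auto simp: K.over_K_def)
    qed
    with coeffs show "K.over_K P" "K.over_K Q" "K.over_K N" "K.over_K M" by auto
  qed
  have cK: "c \<in> K" using coeffs by simp
  interpret C: coprime_fraction "map_poly \<sigma> P" "map_poly \<sigma> Q"
  proof
    show Q: "map_poly \<sigma> Q \<noteq> 0" using K.conj_eq_0[OF over(2)] Q_nonzero by simp
    show "1 \<le> max (degree (map_poly \<sigma> P)) (degree (map_poly \<sigma> Q))"
      using degree_pos by (simp add: K.degree_conj over)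
    show "coprime (map_poly \<sigma> P) (map_poly \<sigma> Q)"
    proof (subst coprime_commute, rule coprime_if_no_common_root[OF Q])
      fix z assume "poly (map_poly \<sigma> Q) z = 0"
      then obtain x where x: "poly Q x = 0" "z = \<sigma> x" using K.conj_root[OF over(2) Q_nonzero] by blast
      then have "x \<in> K" using K.root_in_K[OF over(2) Q_nonzero] by blast
      moreover have "poly P x \<noteq> 0" using no_common_root x(1) by blast
      ultimately show "poly (map_poly \<sigma> P) z \<noteq> 0"
        using K.poly_conj[OF over(1)] K.\<sigma>_eq_0 K.K_poly[OF over(1)] x(2) by metis
    qed
  qed
  have W: "C.W = map_poly \<sigma> W" and overW: "K.over_K W"
    unfolding C.W_def W_def
    by (auto simp: K.conj_diff K.conj_mult K.conj_pderiv over K.over_K_mult K.over_K_diff K.over_K_pderiv)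
  have M0: "map_poly \<sigma> M \<noteq> 0" using K.conj_eq_0[OF over(4)] M_nonzero by simp
  have weight: "C.push_weight (map_poly \<sigma> N) (map_poly \<sigma> M) (\<sigma> x) = \<sigma> (push_weight N M x)"
    "push_weight N M x \<in> K" if x: "x \<in> K" for x
    unfolding C.push_weight_def push_weight_def W using x over overW
    by (simp_all only: K.poly_conj K.\<sigma>_divide K.\<sigma>_power K.K_poly K.K_divide K.K_power)
  have poly_yQ: "P - smult y Q \<noteq> 0" for y
  proof
    assume "P - smult y Q = 0"
    then have "poly (P - smult y Q) x = 0" for x by (simp only: poly_0)
    then have "fibre y = UNIV" by (auto simp: fibre_def)
    then show False using finite_fibre[of y] infinite_UNIV_char_0[where 'a = complex] by simp
  qed
  have fibreK: "fibre y \<subseteq> K" "C.fibre (\<sigma> y) = \<sigma> ` fibre y" if y: "y \<in> K" for y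
  proof -
    have ov: "K.over_K (P - smult y Q)" using y over by (intro K.over_K_diff K.over_K_smult)
    have fib: "fibre y = {x. poly (P - smult y Q) x = 0}" by (auto simp: fibre_def)
    show sub: "fibre y \<subseteq> K" unfolding fib using K.root_in_K[OF ov poly_yQ] by auto
    have eq: "map_poly \<sigma> (P - smult y Q) = map_poly \<sigma> P - smult (\<sigma> y) (map_poly \<sigma> Q)"
      using y over by (simp add: K.conj_diff K.conj_smult K.over_K_smult)
    have Cfib: "C.fibre (\<sigma> y) = {x. poly (map_poly \<sigma> (P - smult y Q)) x = 0}"
      unfolding eq by (auto simp: C.fibre_def)
    show "C.fibre (\<sigma> y) = \<sigma> ` fibre y"
    proof
      show "C.fibre (\<sigma> y) \<subseteq> \<sigma> ` fibre y"
        unfolding Cfib fib using K.conj_root[OF ov poly_yQ] by auto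
      show "\<sigma> ` fibre y \<subseteq> C.fibre (\<sigma> y)"
        using sub K.poly_conj[OF ov] unfolding Cfib fib by auto
    qed
  qed
  define B where "B = {y. \<not> (c * qd y = (\<Sum>x\<in>fibre y. push_weight N M x))}"
  have "finite B" using eigen by (simp add: B_def eventually_cofinite)
  have point: "\<sigma> c * (poly (map_poly \<sigma> N) (\<sigma> y) / poly (map_poly \<sigma> M) (\<sigma> y))
      = (\<Sum>x\<in>C.fibre (\<sigma> y). C.push_weight (map_poly \<sigma> N) (map_poly \<sigma> M) x)" if y: "y \<in> K" "y \<notin> B" for y
  proof -
    have "\<sigma> c * (poly (map_poly \<sigma> N) (\<sigma> y) / poly (map_poly \<sigma> M) (\<sigma> y)) = \<sigma> (c * qd y)"
      using y cK over by (simp only: K.poly_conj K.\<sigma>_divide K.\<sigma>_mult K.K_poly K.K_divide)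
    also have "\<dots> = \<sigma> (\<Sum>x\<in>fibre y. push_weight N M x)" using y(2) unfolding B_def by simp
    also have "\<dots> = (\<Sum>x\<in>fibre y. \<sigma> (push_weight N M x))"
      using fibreK(1)[OF y(1)] weight(2) by (intro K.\<sigma>_sum) blast
    also have "\<dots> = (\<Sum>x\<in>fibre y. C.push_weight (map_poly \<sigma> N) (map_poly \<sigma> M) (\<sigma> x))"
      using fibreK(1)[OF y(1)] weight(1) by (intro sum.cong) auto
    also have "\<dots> = (\<Sum>x\<in>\<sigma> ` fibre y. C.push_weight (map_poly \<sigma> N) (map_poly \<sigma> M) x)"
      using inj_on_subset[OF K.\<sigma>_inj fibreK(1)[OF y(1)]] by (simp add: sum.reindex)
    finally show ?thesis using fibreK(2)[OF y(1)] by simp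
  qed
  define E where "E = C.exceptional (map_poly \<sigma> M) \<union> {y. poly (map_poly \<sigma> M) y = 0}"
  have finE: "finite E" unfolding E_def using C.finite_exceptional[OF M0] poly_roots_finite[OF M0] by simp
  define h where "h y = \<sigma> c * (poly (map_poly \<sigma> N) y / poly (map_poly \<sigma> M) y)
     - (\<Sum>x\<in>C.fibre y. C.push_weight (map_poly \<sigma> N) (map_poly \<sigma> M) x)" for y
  have "(\<lambda>y. \<Sum>x\<in>C.fibre y. C.push_weight (map_poly \<sigma> N) (map_poly \<sigma> M) x) holomorphic_on - E"
    by (rule holomorphic_on_subset[OF C.fibre_sum_holomorphic[OF M0 C.push_weight_holomorphic]]) (auto simp: E_def)
  then have hol: "h holomorphic_on - E"
    unfolding h_def[abs_def] by (intro holomorphic_intros) (auto simp: E_def)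
  have opE: "open (- E)" using finE by (simp add: finite_imp_closed open_Compl)
  have conE: "connected (- E)"
    using connected_open_delete_finite[of UNIV E] finE by (simp add: Compl_eq_Diff_UNIV connected_UNIV)
  \<comment> \<open>The identity theorem wants its accumulation point inside the domain; some
    natural number avoids the finite set \<open>E\<close>.\<close>
  have "infinite (range (of_nat :: nat \<Rightarrow> complex))" by (rule range_inj_infinite) (simp add: inj_def)
  then obtain m where m: "of_nat m \<notin> E" using finE finite_subset[of "range (of_nat :: nat \<Rightarrow> complex)" E] by blast
  \<comment> \<open>Rational points lie in \<open>K\<close> and are fixed by
    \<open>\<sigma>\<close>, so the transported equation holds at \<open>y\<close> itself and not
    merely at \<open>\<sigma> y\<close>.\<close>
  define V where "V = range (\<lambda>n. of_nat m + 1 / of_nat (Suc n) :: complex)"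
  have VK: "y \<in> K \<and> \<sigma> y = y" if "y \<in> V" for y
    using that unfolding V_def
    by (auto simp: K.\<sigma>_add K.\<sigma>_divide K.\<sigma>_one K.\<sigma>_of_nat K.K_of_nat K.K_one K.K_add K.K_divide simp del: of_nat_Suc)
  have "(\<lambda>n. of_nat m + 1 / of_nat (Suc n) :: complex) \<longlonglongrightarrow> of_nat m + 0"
    by (intro tendsto_intros lim_1_over_n[THEN LIMSEQ_Suc])
  then have "of_nat m islimpt V"
    unfolding V_def islimpt_sequential
    by (intro exI[of _ "\<lambda>n. of_nat m + 1 / of_nat (Suc n)"]) (auto simp del: of_nat_Suc)
  then have "of_nat m islimpt ((B \<union> E) \<union> (V - (B \<union> E)))"
    by (rule islimpt_subset) auto
  then have lim: "of_nat m islimpt (V - (B \<union> E))"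
    using \<open>finite B\<close> finE by (subst (asm) islimpt_Un_finite) simp_all
  have "h y = 0" if "y \<notin> E" for y
  proof (rule analytic_continuation[OF hol opE conE _ _ lim])
    show "h z = 0" if "z \<in> V - (B \<union> E)" for z
      using point[of z] VK[of z] that by (simp add: h_def)
  qed (use m that in auto)
  then have all: "\<sigma> c * (poly (map_poly \<sigma> N) y / poly (map_poly \<sigma> M) y)
     = (\<Sum>x\<in>C.fibre y. C.push_weight (map_poly \<sigma> N) (map_poly \<sigma> M) x)" if "y \<notin> E" for y
    using that by (simp add: h_def del: times_divide_eq_right)
  show ?thesis
  proof
    show "map_poly \<sigma> N \<noteq> 0" using K.conj_eq_0[OF over(3)] N_nonzero by simp
    show "degree (map_poly \<sigma> N) + 3 \<le> degree (map_poly \<sigma> M)"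
      using degree_N_M by (simp add: K.degree_conj over)
    show "\<forall>\<^sub>F y in cofinite. \<sigma> c * (poly (map_poly \<sigma> N) y / poly (map_poly \<sigma> M) y)
     = (\<Sum>x\<in>C.fibre y. C.push_weight (map_poly \<sigma> N) (map_poly \<sigma> M) x)"
    proof (rule eventually_mono)
      show "\<forall>\<^sub>F y in cofinite. y \<notin> E" using finE by (simp add: eventually_cofinite)
    qed (rule all)
    show "rsquarefree (map_poly \<sigma> M)"
      unfolding rsquarefree_roots
    proof (intro allI notI)
      fix z assume z: "poly (map_poly \<sigma> M) z = 0 \<and> poly (pderiv (map_poly \<sigma> M)) z = 0"
      then obtain x where x: "poly M x = 0" "z = \<sigma> x" using K.conj_root[OF over(4) M_nonzero] by blast
      have xK: "x \<in> K" using K.root_in_K[OF over(4) M_nonzero x(1)] .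
      have "\<sigma> (poly (pderiv M) x) = 0"
        using z K.poly_conj[OF K.over_K_pderiv[OF over(4)] xK] by (simp add: K.conj_pderiv over x(2))
      then have "poly (pderiv M) x = 0"
        using K.\<sigma>_eq_0[OF K.K_poly[OF K.over_K_pderiv[OF over(4)] xK]] by blast
      then show False using rsquarefree_M x(1) unfolding rsquarefree_roots by blast
    qed
  qed
qed

theorem (in eigen_differential) eigenvalue_algebraic:
  "algebraic c" "algebraic_int c \<Longrightarrow> c \<noteq> 0 \<Longrightarrow> cmod c = 1"
proof -
  have bound: "cmod \<mu> \<le> 1" if rel: "same_relations int_graph c \<mu>" for \<mu>
  proof -
    define S where "S = set (coeffs P) \<union> set (coeffs Q) \<union> set (coeffs N) \<union> set (coeffs M) \<union> {c}"
    have "countable S" unfolding S_def by (intro countable_finite) auto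
    then obtain K where K: "countable K" "S \<subseteq> K" "subring K"
      "\<And>p x. p \<noteq> 0 \<Longrightarrow> set (coeffs p) \<subseteq> K \<Longrightarrow> poly p x = 0 \<Longrightarrow> x \<in> K"
      by (rule countable_algebraically_closed) blast
    have "c \<in> K" using K(2) by (auto simp: S_def)
    then obtain \<sigma> where \<sigma>: "embedding K \<sigma>" "\<sigma> c = \<mu>" using embedding_exists[OF K(1,3) _ rel] by blast
    have "alg_closed_embedding K \<sigma>" using K(3,4) \<sigma>(1) by unfold_locales blast+
    from eigen_differential_conj[OF this] K(2) interpret C: eigen_differential "map_poly \<sigma> P" "map_poly \<sigma> Q"
      "map_poly \<sigma> N" "map_poly \<sigma> M" "\<sigma> c" by (simp add: S_def)
    show ?thesis using C.cmod_eigenvalue_le_1 \<sigma>(2) by simp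
  qed
  show "algebraic c" by (rule conjugate_bound_imp_algebraic[OF bound])
  show "cmod c = 1" if "algebraic_int c" "c \<noteq> 0" by (rule conjugate_bound_imp_cmod_eq_1[OF bound that])
qed

section \<open>Germs: square roots, primitives, inverses\<close>

lemma square_germ_unique:
  fixes a b :: "complex \<Rightarrow> complex"
  assumes "isCont a z" "isCont b z" "\<forall>\<^sub>F t in nhds z. (a t)\<^sup>2 = (b t)\<^sup>2" "a z = b z" "a z \<noteq> 0"
  shows "\<forall>\<^sub>F t in nhds z. a t = b t"
proof -
  have "isCont (\<lambda>t. a t + b t) z" using assms(1,2) by (intro continuous_intros)
  moreover have "a z + b z \<noteq> 0" using assms(4,5) by simp
  ultimately have "\<forall>\<^sub>F t in at z. a t + b t \<noteq> 0"
    unfolding isCont_def by (rule tendsto_imp_eventually_ne)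
  then have "\<forall>\<^sub>F t in nhds z. a t + b t \<noteq> 0"
    using \<open>a z + b z \<noteq> 0\<close> by (simp add: eventually_nhds_conv_at)
  with assms(3) show ?thesis
    by eventually_elim (metis power2_eq_iff add.right_inverse add.commute)
qed

lemma holomorphic_germ_eq:
  fixes f g :: "complex \<Rightarrow> complex"
  assumes "f analytic_on {z}" "g analytic_on {z}" "\<forall>\<^sub>F w in nhds z. deriv f w = deriv g w" "f z = g z"
  shows "\<forall>\<^sub>F w in nhds z. f w = g w"
proof -
  have "\<exists>e>0. f holomorphic_on ball z e" "\<exists>e>0. g holomorphic_on ball z e"
    using assms(1,2) by (auto simp: analytic_at_ball)
  then obtain e1 e2 where e: "e1 > 0" "f holomorphic_on ball z e1" "e2 > 0" "g holomorphic_on ball z e2" by blast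
  obtain e3 where e3: "e3 > 0" "\<And>w. w \<in> ball z e3 \<Longrightarrow> deriv f w = deriv g w"
    using assms(3) by (auto simp: eventually_nhds_metric dist_commute)
  define e where "e = min e1 (min e2 e3)"
  have "e > 0" using e e3 by (simp add: e_def)
  have hol: "f holomorphic_on ball z e" "g holomorphic_on ball z e"
    using e by (auto simp: e_def elim!: holomorphic_on_subset)
  have "((\<lambda>w. f w - g w) has_field_derivative 0) (at w within ball z e)" if w: "w \<in> ball z e" for w
  proof -
    have "((\<lambda>w. f w - g w) has_field_derivative (deriv f w - deriv g w)) (at w)"
      using holomorphic_derivI[OF hol(1) open_ball w] holomorphic_derivI[OF hol(2) open_ball w]
      by (rule DERIV_diff)
    moreover have "deriv f w = deriv g w" using w by (intro e3) (simp add: e_def)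
    ultimately show ?thesis by (simp add: has_field_derivative_at_within)
  qed
  from has_field_derivative_zero_constant[OF convex_ball this]
  obtain c where c: "\<And>w. w \<in> ball z e \<Longrightarrow> f w - g w = c" by blast
  have "f w = g w" if "w \<in> ball z e" for w
    using c[OF that] c[of z] \<open>e > 0\<close> assms(4) by simp
  then show ?thesis
    using \<open>e > 0\<close> by (auto simp: eventually_nhds_metric dist_commute)
qed

lemma sqrt_germ:
  assumes "Q analytic_on {z::complex}" "Q z \<noteq> 0"
  shows "\<exists>s. s analytic_on {z} \<and> (\<forall>\<^sub>F w in nhds z. (s w)\<^sup>2 = Q w)"
proof (intro exI conjI)
  \<comment> \<open>Division by \<open>Q z\<close> moves the argument close to 1, away from the
    branch cut of \<open>csqrt\<close>.\<close>
  let ?s = "\<lambda>w. csqrt (Q z) * csqrt (Q w / Q z)"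
  show "?s analytic_on {z}"
    using assms by (intro analytic_intros) (auto simp: complex_nonpos_Reals_iff)
  show "\<forall>\<^sub>F w in nhds z. (?s w)\<^sup>2 = Q w"
    using assms(2) by (intro always_eventually) (simp add: power_mult_distrib)
qed

lemma primitive_germ:
  assumes "s analytic_on {z::complex}"
  shows "\<exists>H. H analytic_on {z} \<and> H z = 0 \<and> (\<forall>\<^sub>F w in nhds z. deriv H w = s w)"
proof -
  obtain e where e: "e > 0" "s holomorphic_on ball z e" using assms by (auto simp: analytic_at_ball)
  obtain H where H: "\<And>w. w \<in> ball z e \<Longrightarrow> (H has_field_derivative s w) (at w within ball z e)"
    using holomorphic_convex_primitive'[OF convex_ball open_ball e(2)] by blast
  then have H': "(H has_field_derivative s w) (at w)" if "w \<in> ball z e" for w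
    using that by (metis at_within_open open_ball)
  define G where "G w = H w - H z" for w
  have G: "(G has_field_derivative s w) (at w)" if "w \<in> ball z e" for w
    unfolding G_def using H'[OF that] by (auto intro!: derivative_eq_intros)
  have "G holomorphic_on ball z e"
    using G by (intro holomorphic_onI) (auto simp: field_differentiable_def intro: has_field_derivative_at_within)
  then have "G analytic_on {z}" using e(1) by (auto simp: analytic_at_ball)
  moreover have "\<forall>\<^sub>F w in nhds z. deriv G w = s w"
    using e(1) G by (auto simp: eventually_nhds_metric dist_commute intro!: exI[of _ e] DERIV_imp_deriv)
  ultimately show ?thesis by (intro exI[of _ G]) (simp add: G_def)
qed

lemma local_inverse:
  assumes H: "H analytic_on {z::complex}" and nz: "deriv H z \<noteq> 0"
  obtains \<psi> r e where "r > 0" "\<psi> holomorphic_on ball (H z) r" "\<psi> (H z) = z"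
    "\<And>t. t \<in> ball (H z) r \<Longrightarrow> H (\<psi> t) = t"
    "\<And>t. t \<in> ball (H z) r \<Longrightarrow> (\<psi> has_field_derivative 1 / deriv H (\<psi> t)) (at t)"
    "e > 0" "inj_on H (ball z e)" "H holomorphic_on ball z e" "\<psi> ` ball (H z) r \<subseteq> ball z e"
    "\<And>t. t \<in> ball (H z) r \<Longrightarrow> deriv H (\<psi> t) \<noteq> 0"
proof -
  obtain d where d: "d > 0" "H holomorphic_on ball z d" using H by (auto simp: analytic_at_ball)
  obtain e where e: "e > 0" "ball z e \<subseteq> ball z d" "inj_on H (ball z e)"
    using has_complex_derivative_locally_injective[OF d(2) _ open_ball nz] d(1) by auto
  have hol: "H holomorphic_on ball z e" using d e holomorphic_on_subset by blast
  obtain \<psi> where \<psi>: "\<psi> holomorphic_on H ` ball z e" "\<And>w. w \<in> ball z e \<Longrightarrow> deriv H w * deriv \<psi> (H w) = 1"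
    "\<And>w. w \<in> ball z e \<Longrightarrow> \<psi> (H w) = w"
    using holomorphic_has_inverse[OF hol open_ball e(3)] by metis
  have op: "open (H ` ball z e)" by (rule open_mapping_thm3[OF hol open_ball e(3)])
  then obtain r where r: "r > 0" "ball (H z) r \<subseteq> H ` ball z e"
    using e(1) open_contains_ball by (metis centre_in_ball image_eqI)
  show thesis
  proof (rule that[of r \<psi> e])
    show "\<psi> holomorphic_on ball (H z) r" using \<psi>(1) r(2) holomorphic_on_subset by blast
    show "\<psi> (H z) = z" using \<psi>(3)[of z] e(1) by simp
    fix t assume t: "t \<in> ball (H z) r"
    then obtain w where w: "w \<in> ball z e" "t = H w" using r by blast
    then have "\<psi> t = w" using \<psi>(3) by simp
    then show "H (\<psi> t) = t" using w by simp
    have d: "deriv H (\<psi> t) * deriv \<psi> t = 1" using \<psi>(2)[OF w(1)] w(2) \<open>\<psi> t = w\<close> by simp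
    then show nz: "deriv H (\<psi> t) \<noteq> 0" by auto
    have "(\<psi> has_field_derivative deriv \<psi> t) (at t)"
      using holomorphic_derivI[OF \<psi>(1) op] t r by blast
    moreover have "deriv \<psi> t = 1 / deriv H (\<psi> t)" using d nz by (simp add: eq_divide_eq mult.commute)
    ultimately show "(\<psi> has_field_derivative 1 / deriv H (\<psi> t)) (at t)" by simp
  next
    show "\<psi> ` ball (H z) r \<subseteq> ball z e" using \<psi>(3) r(2) by auto
  qed (use r e hol in auto)
qed

lemma analytic_deriv_isCont: "f analytic_on {z::complex} \<Longrightarrow> isCont (deriv f) z"
  by (intro analytic_at_imp_isCont analytic_deriv)

lemma eventually_at_imp_nhds_eq:
  fixes a b :: "complex \<Rightarrow> complex"
  assumes "\<forall>\<^sub>F w in at z. a w = b w" "isCont a z" "isCont b z"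
  shows "\<forall>\<^sub>F w in nhds z. a w = b w"
proof -
  have "(a \<longlongrightarrow> a z) (at z)" "(b \<longlongrightarrow> b z) (at z)" using assms(2,3) by (auto simp: isCont_def)
  moreover from this(2) have "(a \<longlongrightarrow> b z) (at z)"
    using tendsto_cong[OF assms(1)] by blast
  ultimately have "a z = b z" using tendsto_unique[of "at z" a] by simp
  with assms(1) show ?thesis by (simp add: eventually_nhds_conv_at)
qed

lemma eventually_compose_analytic:
  assumes "\<forall>\<^sub>F w in nhds (F z). R w" "F analytic_on {z::complex}"
  shows "\<forall>\<^sub>F t in nhds z. R (F t)"
proof -
  have "(F \<longlongrightarrow> F z) (nhds z)"
    using analytic_at_imp_isCont[OF assms(2)] by (simp add: isCont_def tendsto_at_iff_tendsto_nhds)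
  with assms(1) show ?thesis by (rule eventually_compose_filterlim)
qed

lemma eventually_analytic_at: "f analytic_on {z::complex} \<Longrightarrow> \<forall>\<^sub>F w in nhds z. f analytic_on {w}"
proof -
  assume "f analytic_on {z}"
  then obtain e where e: "e > 0" "f holomorphic_on ball z e" by (auto simp: analytic_at_ball)
  have "\<forall>\<^sub>F w in nhds z. w \<in> ball z e" using e(1) by (intro eventually_nhds_in_open) auto
  then show ?thesis by eventually_elim (use e in \<open>auto simp: analytic_at intro!: exI[of _ "ball z e"]\<close>)
qed

text \<open>Local solution: \<open>\<psi>\<close> inverts \<open>\<integral>\<surd>Q\<close>, a coordinate in which \<open>F\<close> becomes linear.\<close>

lemma linearization:
  assumes Q: "Q analytic_on {0}" "Q 0 \<noteq> 0" and F: "F analytic_on {0}" "F 0 = 0"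
    and R: "R \<noteq> 0" and eq: "\<forall>\<^sub>F w in at 0. Q (F w) * (deriv F w)\<^sup>2 = R * Q w"
  obtains \<rho> \<psi> r where "\<rho>\<^sup>2 = R" "r > 0" "\<psi> holomorphic_on ball 0 r" "\<psi> 0 = 0"
    "\<And>t. t \<in> ball 0 r \<Longrightarrow> Q (\<psi> t) * (deriv \<psi> t)\<^sup>2 = 1" "\<forall>\<^sub>F t in nhds 0. F (\<psi> t) = \<psi> (\<rho> * t)"
proof -
  have QF: "(\<lambda>w. Q (F w)) analytic_on {0}"
    using analytic_on_compose[OF F(1), of Q] Q(1) F(2) by (simp add: o_def)
  \<comment> \<open>Both sides are continuous at the puncture; the value there gives
    \<open>\<rho>^2 = R\<close> for \<open>\<rho> = deriv F 0\<close>.\<close>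
  have eq': "\<forall>\<^sub>F w in nhds 0. Q (F w) * (deriv F w)\<^sup>2 = R * Q w"
    by (rule eventually_at_imp_nhds_eq[OF eq])
       (intro continuous_intros analytic_at_imp_isCont QF analytic_deriv_isCont F Q)+
  define \<rho> where "\<rho> = deriv F 0"
  have \<rho>: "\<rho>\<^sup>2 = R" using eventually_nhds_x_imp_x[OF eq'] Q(2) F(2) by (simp add: \<rho>_def)
  then have "\<rho> \<noteq> 0" using R by auto
  obtain s where s: "s analytic_on {0}" "\<forall>\<^sub>F w in nhds 0. (s w)\<^sup>2 = Q w" using sqrt_germ[OF Q] by blast
  have s0: "s 0 \<noteq> 0" using eventually_nhds_x_imp_x[OF s(2)] Q(2) by auto
  obtain H where H: "H analytic_on {0}" "H 0 = 0" "\<forall>\<^sub>F w in nhds 0. deriv H w = s w"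
    using primitive_germ[OF s(1)] by blast
  have dH0: "deriv H 0 \<noteq> 0" using eventually_nhds_x_imp_x[OF H(3)] s0 by simp
  have sF: "(\<lambda>w. s (F w)) analytic_on {0}"
    using analytic_on_compose[OF F(1), of s] s(1) F(2) by (simp add: o_def)
  have HF: "(\<lambda>w. H (F w)) analytic_on {0}"
    using analytic_on_compose[OF F(1), of H] H(1) F(2) by (simp add: o_def)
  have sqF: "\<forall>\<^sub>F w in nhds 0. (s (F w))\<^sup>2 = Q (F w)"
    by (rule eventually_compose_analytic[OF _ F(1)]) (simp add: F s)
  have dHF: "\<forall>\<^sub>F w in nhds 0. deriv H (F w) = s (F w)"
    by (rule eventually_compose_analytic[OF _ F(1)]) (simp add: F H)
  have anHF: "\<forall>\<^sub>F w in nhds 0. H analytic_on {F w}"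
    by (rule eventually_compose_analytic[OF _ F(1)]) (simp add: F eventually_analytic_at[OF H(1)])
  \<comment> \<open>Both sides are square roots of \<open>R Q\<close>, and at 0 they agree by the
    choice of \<open>\<rho>\<close>; so there is no sign ambiguity nearby. Integrated, this says
    that \<open>H\<close> conjugates \<open>F\<close> to multiplication by
    \<open>\<rho>\<close>.\<close>
  have "\<forall>\<^sub>F w in nhds 0. s (F w) * deriv F w = \<rho> * s w"
  proof (rule square_germ_unique)
    show "\<forall>\<^sub>F w in nhds 0. (s (F w) * deriv F w)\<^sup>2 = (\<rho> * s w)\<^sup>2"
      using sqF s(2) eq' by eventually_elim (simp add: power_mult_distrib \<rho>)
  qed (use s0 \<open>\<rho> \<noteq> 0\<close> F(2) in \<open>auto simp: \<rho>_def intro!: analytic_at_imp_isCont analytic_intros sF s analytic_deriv F\<close>)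
  then have dd: "\<forall>\<^sub>F w in nhds 0. deriv (\<lambda>w. H (F w)) w = deriv (\<lambda>w. \<rho> * H w) w"
    using dHF H(3) anHF eventually_analytic_at[OF F(1)] eventually_analytic_at[OF H(1)]
  proof eventually_elim
    case (elim w)
    have "deriv (\<lambda>w. H (F w)) w = deriv H (F w) * deriv F w"
      using deriv_chain[of F w H] elim analytic_on_imp_differentiable_at by (fastforce simp: o_def)
    moreover have "deriv (\<lambda>w. \<rho> * H w) w = \<rho> * deriv H w"
      using elim analytic_on_imp_differentiable_at by (intro deriv_cmult) fastforce
    ultimately show ?case using elim by simp
  qed
  have conj: "\<forall>\<^sub>F w in nhds 0. H (F w) = \<rho> * H w"
    by (rule holomorphic_germ_eq[OF HF _ dd]) (auto intro!: analytic_intros H simp: F H)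
  obtain \<psi> r e where \<psi>: "r > 0" "\<psi> holomorphic_on ball 0 r" "\<psi> 0 = 0"
    "\<And>t. t \<in> ball 0 r \<Longrightarrow> H (\<psi> t) = t"
    "\<And>t. t \<in> ball 0 r \<Longrightarrow> (\<psi> has_field_derivative 1 / deriv H (\<psi> t)) (at t)"
    "e > 0" "inj_on H (ball 0 e)" "\<psi> ` ball 0 r \<subseteq> ball 0 e"
    "\<And>t. t \<in> ball 0 r \<Longrightarrow> deriv H (\<psi> t) \<noteq> 0"
    using local_inverse[OF H(1) dH0] unfolding H(2) by metis
  have an\<psi>: "\<psi> analytic_on {0}" using \<psi>(1,2) by (auto simp: analytic_at_ball)
  have "\<forall>\<^sub>F t in nhds 0. Q (\<psi> t) * (deriv \<psi> t)\<^sup>2 = 1"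
  proof -
    have "\<forall>\<^sub>F t in nhds 0. (s (\<psi> t))\<^sup>2 = Q (\<psi> t)"
      by (rule eventually_compose_analytic[OF _ an\<psi>]) (simp add: \<psi> s)
    moreover have "\<forall>\<^sub>F t in nhds 0. deriv H (\<psi> t) = s (\<psi> t)"
      by (rule eventually_compose_analytic[OF _ an\<psi>]) (simp add: \<psi> H)
    moreover have "\<forall>\<^sub>F t in nhds 0. t \<in> ball 0 r" using \<psi>(1) by (intro eventually_nhds_in_open) auto
    ultimately show ?thesis
    proof eventually_elim
      case (elim t)
      have "deriv \<psi> t = 1 / s (\<psi> t)" using \<psi>(5)[OF elim(3)] elim(2) by (simp add: DERIV_imp_deriv)
      moreover have "s (\<psi> t) \<noteq> 0" using \<psi>(9)[OF elim(3)] elim(2) by simp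
      ultimately have "s (\<psi> t) * deriv \<psi> t = 1" by simp
      then have "(s (\<psi> t))\<^sup>2 * (deriv \<psi> t)\<^sup>2 = 1" by (simp only: power_mult_distrib[symmetric] power_one)
      then show ?case using elim(1) by simp
    qed
  qed
  then obtain r1 where r1: "r1 > 0" "\<And>t. t \<in> ball 0 r1 \<Longrightarrow> Q (\<psi> t) * (deriv \<psi> t)\<^sup>2 = 1"
    by (auto simp: eventually_nhds_metric dist_commute)
  have "\<forall>\<^sub>F t in nhds 0. F (\<psi> t) = \<psi> (\<rho> * t)"
  proof -
    have an1: "(\<lambda>t. F (\<psi> t)) analytic_on {0}"
      using analytic_on_compose[OF an\<psi>, of F] F(1) \<psi>(3) by (simp add: o_def)
    have an2: "(\<lambda>t. \<rho> * t) analytic_on {0}" by (intro analytic_intros)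
    have "\<forall>\<^sub>F t in nhds 0. H (F (\<psi> t)) = \<rho> * H (\<psi> t)"
      by (rule eventually_compose_analytic[OF _ an\<psi>]) (simp add: \<psi> conj)
    moreover have "\<forall>\<^sub>F w in nhds 0. w \<in> ball (0::complex) e" using \<psi>(6) by (intro eventually_nhds_in_open) auto
    then have "\<forall>\<^sub>F t in nhds 0. F (\<psi> t) \<in> ball 0 e"
      by (intro eventually_compose_analytic[OF _ an1]) (simp only: \<psi>(3) F(2))
    moreover have "\<forall>\<^sub>F w in nhds 0. w \<in> ball (0::complex) r" using \<psi>(1) by (intro eventually_nhds_in_open) auto
    then have "\<forall>\<^sub>F t in nhds 0. \<rho> * t \<in> ball 0 r"
      by (intro eventually_compose_analytic[OF _ an2]) (simp only: mult_zero_right)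
    moreover have "\<forall>\<^sub>F t in nhds 0. t \<in> ball 0 r" using \<psi>(1) by (intro eventually_nhds_in_open) auto
    ultimately show ?thesis
    proof eventually_elim
      case (elim t)
      have "H (F (\<psi> t)) = H (\<psi> (\<rho> * t))" using elim(1) \<psi>(4)[OF elim(3)] \<psi>(4)[OF elim(4)] by simp
      moreover have "\<psi> (\<rho> * t) \<in> ball 0 e" using \<psi>(8) elim(3) by blast
      ultimately show ?case using \<psi>(7) elim(2) by (auto simp: inj_on_def)
    qed
  qed
  moreover have "\<psi> holomorphic_on ball 0 (min r r1)" using \<psi>(2) by (rule holomorphic_on_subset) auto
  ultimately show thesis
    using that[of \<rho> "min r r1" \<psi>] \<rho> \<psi>(1,3) r1 by auto
qed

text \<open>With \<open>m\<close> the order of vanishing of \<open>F\<close>, the pullback of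
  \<open>w^n dw^2\<close> has order \<open>m n + 2 (m - 1)\<close>. Thus order plus 2 is multiplied
  by the local degree \<open>m\<close>.\<close>

lemma order_relation:
  fixes n n' :: int
  assumes F: "F analytic_on {0}" "F 0 = 0" and k: "k analytic_on {0}" "k 0 \<noteq> 0"
    and k': "k' analytic_on {0}" "k' 0 \<noteq> 0" and R: "R \<noteq> 0"
    and eq: "\<forall>\<^sub>F w in at 0. F w powi n * k (F w) * (deriv F w)\<^sup>2 = R * (w powi n' * k' w)"
  obtains m :: nat where "m > 0" "n' + 2 = int m * (n + 2)" "m = 1 \<Longrightarrow> deriv F 0 \<noteq> 0"
proof -
  obtain e where e: "e > 0" "F holomorphic_on ball 0 e" using F by (auto simp: analytic_at_ball)
  have k'nz: "\<forall>\<^sub>F w in at 0. k' w \<noteq> 0"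
    using analytic_at_imp_isCont[OF k'(1)] k'(2) unfolding isCont_def by (rule tendsto_imp_eventually_ne)
  have e0: "0 \<in> ball 0 e" using e(1) by simp
  \<comment> \<open>A constant \<open>F\<close> would annihilate the left side of \<open>eq\<close>,
    whereas the right side is nonzero near 0.\<close>
  have nonconst: "\<not> F constant_on ball 0 e"
  proof
    assume "F constant_on ball 0 e"
    then obtain c where c: "\<And>w. w \<in> ball 0 e \<Longrightarrow> F w = c" by (auto simp: constant_on_def)
    have "\<forall>\<^sub>F w in at 0. w \<in> ball 0 e - {0}" using e(1) by (intro eventually_at_in_open) auto
    with eq k'nz have "\<forall>\<^sub>F w in at (0::complex). False"
    proof eventually_elim
      case (elim w)
      have "deriv F w = deriv (\<lambda>_. c) w"
        using elim(3) c by (intro deriv_cong_ev eventually_mono[OF eventually_nhds_in_open[of "ball 0 e"]]) auto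
      then show ?case using elim R by simp
    qed
    then show False by simp
  qed
  obtain l r m where l: "0 < m" "0 < r" "ball (0::complex) r \<subseteq> ball 0 e" "l holomorphic_on ball 0 r"
    "\<And>w. w \<in> ball 0 r \<Longrightarrow> F w = (w - 0) ^ m * l w" "\<And>w. w \<in> ball 0 r \<Longrightarrow> l w \<noteq> 0"
    by (rule holomorphic_factor_zero_nonconstant[OF e(2) open_ball connected_ball e0 F(2) nonconst], rule that)
  have lan: "l analytic_on {0}" using l by (auto simp: analytic_at_ball)
  have Fl: "F w = w ^ m * l w" if "w \<in> ball 0 r" for w using l(5)[OF that] by simp
  define j where "j w = of_nat m * l w + w * deriv l w" for w
  have dF: "deriv F w = w ^ (m - 1) * j w" if w: "w \<in> ball 0 r" for w
  proof -
    have "deriv F w = deriv (\<lambda>w. w ^ m * l w) w"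
      using w Fl by (intro deriv_cong_ev eventually_mono[OF eventually_nhds_in_open[of "ball 0 r"]]) auto
    also have "\<dots> = of_nat m * w ^ (m - 1) * l w + w ^ m * deriv l w"
      using holomorphic_derivI[OF l(4) open_ball w]
      by (intro DERIV_imp_deriv) (auto intro!: derivative_eq_intros)
    also have "w ^ m = w ^ (m - 1) * w" using l(1) by (metis power_minus_mult)
    finally show ?thesis by (simp add: j_def algebra_simps)
  qed
  have j0: "j 0 \<noteq> 0" using l(1,2) l(6)[of 0] by (simp add: j_def)
  \<comment> \<open>\<open>E\<close> is the excess of the left exponent over the right one. What
    remains on either side has a finite nonzero limit at 0, so \<open>E\<close> can be neither
    positive nor negative.\<close>
  define E where "E = int m * n + 2 * (int m - 1) - n'"
  define A where "A w = l w powi n * k (F w) * (j w)\<^sup>2" for w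
  have kF: "(\<lambda>w. k (F w)) analytic_on {0}"
    using analytic_on_compose[OF F(1), of k] k(1) F(2) by (simp add: o_def)
  have l0: "l 0 \<noteq> 0" using l(2) l(6)[of 0] by simp
  have jan: "j analytic_on {0}" unfolding j_def[abs_def]
    by (intro analytic_intros lan analytic_deriv)
  have contA: "isCont A 0"
    unfolding A_def using l0
    by (intro continuous_intros analytic_at_imp_isCont kF lan jan) auto
  have A0: "A 0 \<noteq> 0" unfolding A_def using l0 j0 k(2) F(2) by simp
  have "\<forall>\<^sub>F w in at 0. w \<in> ball 0 r - {0}" using l(2) by (intro eventually_at_in_open) auto
  with eq have E: "\<forall>\<^sub>F w in at 0. w powi E * A w = R * k' w"
  proof eventually_elim
    case (elim w)
    then have w: "w \<in> ball 0 r" "w \<noteq> 0" by auto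
    have "w powi E * A w * w powi n' = (w ^ m) powi n * (w ^ (m - 1))\<^sup>2 * A w"
    proof -
      have "(w ^ m) powi n * (w ^ (m - 1))\<^sup>2 = w powi (int m * n) * w powi (2 * (int m - 1))"
      proof -
        have "2 * (int m - 1) = int (2 * (m - 1))" using l(1) by simp
        then show ?thesis
          by (simp only: power_int_mult power_int_of_nat power_mult[symmetric] mult.commute[of "m - 1" 2])
      qed
      also have "\<dots> = w powi (int m * n + 2 * (int m - 1))" using w(2) by (simp add: power_int_add)
      also have "\<dots> = w powi E * w powi n'" using w(2) unfolding E_def by (subst power_int_add[symmetric]) auto
      finally show ?thesis by (simp add: mult_ac)
    qed
    also have "\<dots> = R * k' w * w powi n'"
      using elim(1) unfolding Fl[OF w(1)] dF[OF w(1)] A_def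
      by (simp add: power_int_mult_distrib power_mult_distrib Fl[OF w(1)] mult_ac)
    finally show ?case using w(2) by simp
  qed
  have "E = 0"
  proof (rule ccontr)
    assume "E \<noteq> 0"
    have lim: "((\<lambda>w::complex. w ^ p) \<longlongrightarrow> 0) (at 0)" if "p > 0" for p
      using tendsto_power[OF tendsto_ident_at[of "0::complex" UNIV], of p] that by (simp add: zero_power)
    have limA: "(A \<longlongrightarrow> A 0) (at 0)" using contA by (simp add: isCont_def)
    have limk: "((\<lambda>w. R * k' w) \<longlongrightarrow> R * k' 0) (at 0)"
      using analytic_at_imp_isCont[OF k'(1)] by (intro tendsto_intros) (simp add: isCont_def)
    show False
    proof (cases "E > 0")
      case True
      then have "((\<lambda>w. w ^ nat E * A w) \<longlongrightarrow> 0 * A 0) (at 0)" by (intro tendsto_mult lim limA) auto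
      moreover have "\<forall>\<^sub>F w in at 0. w ^ nat E * A w = R * k' w" using E True by (simp add: power_int_def)
      ultimately have "((\<lambda>w. R * k' w) \<longlongrightarrow> 0) (at 0)" using Lim_transform_eventually by fastforce
      with limk have "R * k' 0 = 0" using tendsto_unique trivial_limit_at by blast
      then show False using R k'(2) by simp
    next
      case False
      then have "((\<lambda>w. w ^ nat (- E) * (R * k' w)) \<longlongrightarrow> 0 * (R * k' 0)) (at 0)"
        using \<open>E \<noteq> 0\<close> by (intro tendsto_mult lim limk) auto
      moreover have "\<forall>\<^sub>F w in at 0. w ^ nat (- E) * (R * k' w) = A w"
      proof -
        have "\<forall>\<^sub>F w in at (0::complex). w \<noteq> 0" by (rule eventually_neq_at_within)
        with E show ?thesis
        proof eventually_elim
          case (elim w)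
          then have "w powi E = inverse (w ^ nat (- E))" using False \<open>E \<noteq> 0\<close> by (simp add: power_int_def power_inverse)
          with elim show ?case by (simp add: field_simps)
        qed
      qed
      ultimately have "(A \<longlongrightarrow> 0) (at 0)" using Lim_transform_eventually by fastforce
      with limA have "A 0 = 0" using tendsto_unique trivial_limit_at by blast
      with A0 show False by simp
    qed
  qed
  show thesis
  proof (rule that[of m])
    show "n' + 2 = int m * (n + 2)" using \<open>E = 0\<close> by (simp add: E_def algebra_simps)
    show "deriv F 0 \<noteq> 0" if "m = 1" using dF[of 0] l(2) j0 that by simp
  qed (use l in auto)
qed

text \<open>Puts an identity on a punctured neighbourhood into a form that can be differentiated at
  each nearby point.\<close>

lemma eventually_at_eventually_nhds:
  assumes "\<forall>\<^sub>F w in at (z::complex). R w"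
  shows "\<forall>\<^sub>F w in at z. \<forall>\<^sub>F v in nhds w. R v"
proof -
  obtain S where S: "open S" "z \<in> S" "\<And>w. w \<in> S \<Longrightarrow> w \<noteq> z \<Longrightarrow> R w"
    using assms unfolding eventually_at_topological by blast
  have "\<forall>\<^sub>F w in at z. w \<in> S - {z}" using S(1,2) by (rule eventually_at_in_open)
  then show ?thesis
  proof eventually_elim
    case (elim w)
    have "\<forall>\<^sub>F v in nhds w. v \<in> S - {z}" using elim S(1) by (intro eventually_nhds_in_open) auto
    then show ?case by eventually_elim (use S(3) in auto)
  qed
qed

lemma eventually_at_not_in_finite:
  assumes "finite B"
  shows "\<forall>\<^sub>F w in at (z::'a::t1_space). w \<notin> B"
proof -
  have "open (- (B - {z}))" using assms by (intro open_Compl finite_imp_closed) auto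
  then have "\<forall>\<^sub>F w in at z. w \<in> - (B - {z}) - {z}" by (rule eventually_at_in_open) auto
  then show ?thesis by eventually_elim auto
qed

subsection \<open>Local coordinates on the sphere\<close>

text \<open>The finite point that \<open>sphere_param\<close> yields, as a complex number; at
  infinity it has no meaning for \<open>w = 0\<close>.\<close>

fun chart :: "riemann_sphere \<Rightarrow> complex \<Rightarrow> complex" where
  "chart (Some a) w = a + w"
| "chart None w = 1 / w"

fun chart_deriv :: "riemann_sphere \<Rightarrow> complex \<Rightarrow> complex" where
  "chart_deriv (Some a) w = 1"
| "chart_deriv None w = - 1 / w\<^sup>2"

lemma sphere_param_chart: "w \<noteq> 0 \<Longrightarrow> sphere_param x w = Some (chart x w)"
  by (cases x) auto

lemma sphere_param_eq_Some: "sphere_param x w = Some z \<Longrightarrow> chart x w = z"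
  by (cases x) (auto split: if_splits)

lemma sphere_param_0 [simp]: "sphere_param x 0 = x"
  by (cases x) auto

lemma inj_sphere_param: "inj (sphere_param x)"
  by (cases x) (auto simp: inj_def split: if_splits)

lemma sphere_param_eq_self: "sphere_param x w = x \<longleftrightarrow> w = 0"
  using inj_sphere_param[of x] sphere_param_0[of x] by (metis injD)

lemma chart_has_derivative:
  "w \<noteq> 0 \<Longrightarrow> (chart x has_field_derivative chart_deriv x w) (at w)"
proof (cases x)
  case None
  have "chart None = (\<lambda>w. 1 / w)" by auto
  moreover assume "w \<noteq> 0"
  ultimately show ?thesis using None by (auto intro!: derivative_eq_intros simp: power2_eq_square)
next
  case (Some a)
  have "chart (Some a) = (\<lambda>w. a + w)" by auto
  then show ?thesis using Some by (auto intro!: derivative_eq_intros)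
qed

text \<open>The condition of \<open>holomorphic_to_sphere\<close> at a single point.\<close>

definition sphere_analytic_at :: "(complex \<Rightarrow> riemann_sphere) \<Rightarrow> complex \<Rightarrow> bool" where
  "sphere_analytic_at h z \<longleftrightarrow>
     (\<exists>g. g analytic_on {z} \<and> (\<forall>\<^sub>F x in nhds z. h x = sphere_param (h z) (g x)))"

lemma sphere_analytic_atE:
  assumes "sphere_analytic_at h z"
  obtains g where "g analytic_on {z}" "g z = 0" "\<forall>\<^sub>F x in nhds z. h x = sphere_param (h z) (g x)"
proof -
  obtain g where g: "g analytic_on {z}" "\<forall>\<^sub>F x in nhds z. h x = sphere_param (h z) (g x)"
    using assms by (auto simp: sphere_analytic_at_def)
  from eventually_nhds_x_imp_x[OF g(2)] have "g z = 0" by (metis sphere_param_eq_self)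
  with g that show thesis by blast
qed

lemma analytic_isolated_zero:
  assumes "g analytic_on {z::complex}" "\<not> (\<forall>\<^sub>F w in nhds z. g w = 0)"
  shows "\<forall>\<^sub>F w in at z. g w \<noteq> 0"
proof -
  obtain e where e: "e > 0" "g holomorphic_on ball z e" using assms(1) by (auto simp: analytic_at_ball)
  have "\<forall>\<^sub>F w in nhds z. w \<in> ball z e" using e(1) by (intro eventually_nhds_in_open) auto
  with assms(2) obtain b where "b \<in> ball z e" "g b \<noteq> 0" by (metis (mono_tags, lifting) eventually_mono)
  with e show ?thesis
    using non_zero_neighbour_alt[OF e(2) open_ball connected_ball, of z b] by (auto elim: eventually_mono)
qed

text \<open>In the centred coordinate the points mapped into \<open>B\<close> are zeros of a
  nonconstant analytic function, or are already bounded away from \<open>z\<close> by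
  continuity.\<close>

lemma sphere_analytic_avoids:
  assumes h: "sphere_analytic_at h z" and nc: "\<not> (\<forall>\<^sub>F t in nhds z. h t = h z)" and B: "finite B"
  shows "\<forall>\<^sub>F t in at z. h t \<notin> B"
proof -
  obtain g where g: "g analytic_on {z}" "g z = 0" "\<forall>\<^sub>F x in nhds z. h x = sphere_param (h z) (g x)"
    using sphere_analytic_atE[OF h] .
  have "\<not> (\<forall>\<^sub>F w in nhds z. g w = 0)"
  proof
    assume "\<forall>\<^sub>F w in nhds z. g w = 0"
    with g(3) have "\<forall>\<^sub>F t in nhds z. h t = h z" by eventually_elim simp
    with nc show False ..
  qed
  from analytic_isolated_zero[OF g(1) this] have "\<forall>\<^sub>F w in at z. g w \<noteq> 0" .
  moreover have "finite (sphere_param (h z) -` B)" using inj_sphere_param B by (intro finite_vimageI) auto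
  then have "open (- (sphere_param (h z) -` B - {0}))" by (intro open_Compl finite_imp_closed) auto
  then have "\<forall>\<^sub>F w in nhds (g z). w \<in> - (sphere_param (h z) -` B - {0})"
    by (rule eventually_nhds_in_open) (simp add: g)
  from eventually_compose_analytic[OF this g(1)]
  have "\<forall>\<^sub>F t in at z. g t \<in> - (sphere_param (h z) -` B - {0})" by (simp add: eventually_nhds_conv_at)
  moreover have "\<forall>\<^sub>F x in at z. h x = sphere_param (h z) (g x)"
    using g(3) by (simp add: eventually_nhds_conv_at)
  ultimately show ?thesis by eventually_elim auto
qed

lemma poly_analytic: "poly p analytic_on S" for p :: "complex poly"
  by (rule analytic_on_subset[of _ UNIV]) (auto simp: analytic_on_open intro!: holomorphic_intros)

lemma eventually_nhds_ne_poly: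
  fixes p :: "complex poly"
  assumes "poly p z \<noteq> 0"
  shows "\<forall>\<^sub>F w in nhds z. poly p w \<noteq> 0"
proof -
  have "\<forall>\<^sub>F w in at z. poly p w \<noteq> 0"
  proof (rule tendsto_imp_eventually_ne)
    show "poly p \<midarrow>z\<rightarrow> poly p z" by (intro tendsto_intros)
  qed fact
  then show ?thesis using assms by (simp add: eventually_nhds_conv_at)
qed

section \<open>Rational maps in centred coordinates\<close>

context coprime_fraction
begin

abbreviation f :: "riemann_sphere \<Rightarrow> riemann_sphere" where "f \<equiv> sphere_quotient P Q"

text \<open>At infinity numerator and denominator are both multiplied by \<open>w\<^sup>D\<close>.\<close>

fun local_poly :: "complex poly \<Rightarrow> riemann_sphere \<Rightarrow> complex poly" where
  "local_poly p (Some a) = pcompose p [:a, 1:]"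
| "local_poly p None = monom 1 (D - degree p) * reflect_poly p"

lemma local_poly_chart:
  assumes "degree p \<le> D" "w \<noteq> 0 \<or> x \<noteq> None"
  shows "\<exists>u. u \<noteq> 0 \<and> poly (local_poly P x) w = u * poly P (chart x w) \<and> poly (local_poly Q x) w = u * poly Q (chart x w)"
proof (cases x)
  case (Some a)
  then show ?thesis by (intro exI[of _ 1]) (simp add: poly_pcompose)
next
  case None
  have "poly (local_poly p None) w = w ^ D * poly p (1 / w)" if "degree p \<le> D" "w \<noteq> 0" for p
    using that by (simp add: poly_monom poly_reflect_poly_nz inverse_eq_divide power_add[symmetric])
  then show ?thesis using None assms(2) by (intro exI[of _ "w ^ D"]) (auto simp: D_def)
qed

lemma local_poly_None_0: "degree p \<le> D \<Longrightarrow> poly (local_poly p None) 0 = coeff p D"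
  by (cases "degree p = D") (auto simp: poly_monom zero_power coeff_eq_0)

lemma degree_le_D: "degree P \<le> D" "degree Q \<le> D" by (auto simp: D_def)

lemma coeff_D: "coeff P D \<noteq> 0 \<or> coeff Q D \<noteq> 0"
  using Q_nonzero degree_pos by (metis D_def degree_0 leading_coeff_0_iff max_def not_one_le_zero)

lemma local_poly_no_common_root: "poly (local_poly P x) w \<noteq> 0 \<or> poly (local_poly Q x) w \<noteq> 0"
proof (cases "w \<noteq> 0 \<or> x \<noteq> None")
  case True
  from local_poly_chart[OF degree_le_D(1) this] show ?thesis using no_common_root[of "chart x w"] by auto
next
  case False
  then show ?thesis using coeff_D local_poly_None_0[OF degree_le_D(1)] local_poly_None_0[OF degree_le_D(2)] by auto
qed

lemma f_sphere_param:
  "f (sphere_param x w) = (if poly (local_poly Q x) w = 0 then None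
     else Some (poly (local_poly P x) w / poly (local_poly Q x) w))"
proof (cases "w \<noteq> 0 \<or> x \<noteq> None")
  case True
  then have "sphere_param x w = Some (chart x w)" by (cases x) auto
  moreover from local_poly_chart[OF degree_le_D(1) True] obtain u where "u \<noteq> 0"
    "poly (local_poly P x) w = u * poly P (chart x w)" "poly (local_poly Q x) w = u * poly Q (chart x w)" by blast
  ultimately show ?thesis by simp
next
  case False
  then have x: "x = None" "w = 0" by auto
  have "degree P > degree Q \<longleftrightarrow> coeff Q D = 0"
    using Q_nonzero by (auto simp: D_def coeff_eq_0 max_def not_le)
  moreover have "D = degree Q" if "\<not> degree P > degree Q" using that by (simp add: D_def)
  ultimately show ?thesis
    using x local_poly_None_0[OF degree_le_D(1)] local_poly_None_0[OF degree_le_D(2)] by (auto simp del: local_poly.simps)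
qed

text \<open>\<open>f\<close> read in the coordinates centred at \<open>x\<close> and at
  \<open>f x\<close>; where the value is infinite this is \<open>1 / f\<close>, hence the exchanged
  quotient.\<close>

definition local_map :: "riemann_sphere \<Rightarrow> complex \<Rightarrow> complex" where
  "local_map x w = (case f x of
      None \<Rightarrow> poly (local_poly Q x) w / poly (local_poly P x) w
    | Some b \<Rightarrow> poly (local_poly P x) w / poly (local_poly Q x) w - b)"

lemma f_at_0: "f x = (if poly (local_poly Q x) 0 = 0 then None
     else Some (poly (local_poly P x) 0 / poly (local_poly Q x) 0))"
  using f_sphere_param[of x 0] by simp

lemma local_map_0 [simp]: "local_map x 0 = 0"
  using f_at_0[of x] by (auto simp: local_map_def split: if_splits)

lemma local_map_analytic: "local_map x analytic_on {0}"
proof (cases "f x")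
  case None
  then have "poly (local_poly P x) 0 \<noteq> 0"
    using local_poly_no_common_root[of x 0] f_at_0[of x] by (auto split: if_splits)
  then show ?thesis unfolding local_map_def[abs_def] None by (auto intro!: analytic_intros poly_analytic)
next
  case (Some b)
  then have "poly (local_poly Q x) 0 \<noteq> 0" using f_at_0[of x] by (auto split: if_splits)
  then show ?thesis unfolding local_map_def[abs_def] Some by (auto intro!: analytic_intros poly_analytic)
qed

lemma f_local_map: "\<forall>\<^sub>F w in nhds 0. f (sphere_param x w) = sphere_param (f x) (local_map x w)"
proof (cases "f x")
  case None
  then have "poly (local_poly P x) 0 \<noteq> 0"
    using local_poly_no_common_root[of x 0] f_at_0[of x] by (auto split: if_splits)
  then have "\<forall>\<^sub>F w in nhds 0. poly (local_poly P x) w \<noteq> 0"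
    by (intro eventually_nhds_ne_poly)
  then show ?thesis
    by eventually_elim (auto simp: f_sphere_param local_map_def None)
next
  case (Some b)
  then have "poly (local_poly Q x) 0 \<noteq> 0" using f_at_0[of x] by (auto split: if_splits)
  then have "\<forall>\<^sub>F w in nhds 0. poly (local_poly Q x) w \<noteq> 0"
    by (intro eventually_nhds_ne_poly)
  then show ?thesis
    by eventually_elim (auto simp: f_sphere_param local_map_def Some)
qed

lemma sphere_analytic_comp:
  assumes "sphere_analytic_at h z"
  shows "sphere_analytic_at (\<lambda>t. f (h t)) z"
proof -
  obtain g where g: "g analytic_on {z}" "g z = 0" "\<forall>\<^sub>F x in nhds z. h x = sphere_param (h z) (g x)"
    using sphere_analytic_atE[OF assms] .
  have "(\<lambda>t. local_map (h z) (g t)) analytic_on {z}"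
    using analytic_on_compose[OF g(1), of "local_map (h z)"] local_map_analytic[of "h z"] g(2) by (simp add: o_def)
  moreover have "\<forall>\<^sub>F t in nhds z. f (sphere_param (h z) (g t)) = sphere_param (f (h z)) (local_map (h z) (g t))"
    by (rule eventually_compose_analytic[OF _ g(1)]) (simp only: g(2) f_local_map)
  with g(3) have "\<forall>\<^sub>F t in nhds z. f (h t) = sphere_param (f (h z)) (local_map (h z) (g t))"
    by eventually_elim simp
  ultimately show ?thesis unfolding sphere_analytic_at_def by blast
qed

lemma f_surj: "\<exists>x. f x = y"
proof (cases y)
  case None
  show ?thesis
  proof (cases "degree Q = 0")
    case True
    then have "f None = None" using degree_pos by simp
    with None show ?thesis by blast
  next
    case False
    then obtain x where "poly Q x = 0"
      using fundamental_theorem_of_algebra[of Q] by (auto simp: constant_degree)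
    then show ?thesis using None by (intro exI[of _ "Some x"]) simp
  qed
next
  case (Some b)
  define p where "p = P - smult b Q"
  show ?thesis
  proof (cases "degree p = 0")
    case False
    then obtain x where "poly p x = 0"
      using fundamental_theorem_of_algebra[of p] by (auto simp: constant_degree)
    then have "x \<in> fibre b" by (simp add: fibre_def p_def)
    then have "f (Some x) = Some b" by (simp add: fibre_iff ratio_def)
    with Some show ?thesis by blast
  next
    case True
    \<comment> \<open>Here \<open>P - b Q\<close> may have no root at all; its drop in degree means
      that infinity is mapped to \<open>b\<close>.\<close>
    have "coeff p D = 0" using True degree_pos by (intro coeff_eq_0) (simp add: D_def)
    then have eq: "coeff P D = b * coeff Q D" by (simp add: p_def)
    then have "coeff Q D \<noteq> 0" using coeff_D by auto
    then have "D = degree Q" using degree_le_D(2) le_degree le_antisym by blast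
    then have "\<not> degree P > degree Q" using degree_le_D(1) by simp
    then have "f None = Some b" using eq \<open>D = degree Q\<close> Q_nonzero by simp
    with Some show ?thesis by blast
  qed
qed

lemma f_fixed_point:
  assumes "D \<ge> 2"
  obtains x where "f x = x"
proof -
  define p where "p = P - [:0, 1:] * Q"
  show thesis
  proof (cases "degree p = 0")
    case False
    then obtain x where "poly p x = 0"
      using fundamental_theorem_of_algebra[of p] by (auto simp: constant_degree)
    then have "x \<in> fibre x" by (simp add: fibre_def p_def)
    then have "f (Some x) = Some x" by (simp add: fibre_iff ratio_def)
    then show thesis by (rule that)
  next
    case True
    \<comment> \<open>A constant \<open>P - X Q\<close> forces
      \<open>degree P = degree Q + 1\<close>, so that infinity is fixed.\<close>
    have "degree ([:0, 1:] * Q) = Suc (degree Q)" using Q_nonzero by (simp add: degree_mult_eq)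
    moreover have "P = p + [:0, 1:] * Q" by (simp add: p_def)
    ultimately have "degree P = Suc (degree Q)" using True by (metis degree_add_eq_right zero_less_Suc)
    then have "f None = None" by simp
    then show thesis by (rule that)
  qed
qed

text \<open>A point that is its own full preimage is totally ramified, hence superattracting.\<close>

lemma totally_ramified:
  assumes D: "D \<ge> 2" and x: "f x = x" and uniq: "\<And>y. f y = x \<Longrightarrow> y = x"
  shows "deriv (local_map x) 0 = 0"
proof (cases x)
  case None
  \<comment> \<open>No finite point maps to infinity, so \<open>f\<close> is a polynomial of degree
    at least 2, and \<open>1 / f(1/w)\<close> vanishes to order \<open>D\<close> at 0.\<close>
  have "degree Q = 0"
  proof (rule ccontr)
    assume "degree Q \<noteq> 0"
    then obtain z where "poly Q z = 0"
      using fundamental_theorem_of_algebra[of Q] by (auto simp: constant_degree)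
    then have "f (Some z) = None" by simp
    with uniq None show False by blast
  qed
  then have DP: "D = degree P" "degree P \<ge> 2" using D by (auto simp: D_def)
  have lm: "local_map None = (\<lambda>w. poly (local_poly Q None) w / poly (local_poly P None) w)"
    using x None by (simp add: local_map_def[abs_def])
  obtain q where q: "Q = [:q:]" using \<open>degree Q = 0\<close> by (metis degree_eq_zeroE)
  have "reflect_poly Q = [:q:]" by (simp add: q)
  then have Q': "poly (local_poly Q None) w = q * w ^ D" for w by (simp add: \<open>degree Q = 0\<close> poly_monom)
  have P0: "poly (local_poly P None) 0 \<noteq> 0"
    using DP by (simp add: local_poly_None_0 D_def[symmetric] del: local_poly.simps) (metis degree_0 leading_coeff_0_iff not_numeral_le_zero)
  have "(local_map None has_field_derivative 0) (at 0)"
    unfolding lm Q' using P0 D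
    by (auto intro!: derivative_eq_intros simp: zero_power)
  then show ?thesis using None by (simp add: DERIV_imp_deriv)
next
  case (Some a)
  define p where "p = P - smult a Q"
  have "Some a \<in> f -` {Some a}" using x Some by simp
  then have fa1: "poly Q a \<noteq> 0" "ratio a = a" by (auto simp: ratio_def split: if_splits)
  then have "a \<in> fibre a" by (simp add: fibre_iff)
  then have fa: "poly Q a \<noteq> 0" "poly P a = a * poly Q a" using fa1 by (auto simp: fibre_def)
  have roots: "{z. poly p z = 0} = {a}"
  proof -
    have "z = a" if "poly p z = 0" for z
    proof -
      have "z \<in> fibre a" using that by (simp add: p_def fibre_def)
      then have "f (Some z) = x" using Some by (simp add: fibre_iff ratio_def)
      from uniq[OF this] Some show ?thesis by simp
    qed
    then show ?thesis using fa by (auto simp: p_def)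
  qed
  \<comment> \<open>If the degree of \<open>P - a Q\<close> dropped below \<open>D\<close>, infinity
    would be another preimage of \<open>a\<close>.\<close>
  have degp: "degree p \<ge> 2"
  proof (rule ccontr)
    assume "\<not> ?thesis"
    then have "coeff p D = 0" using D by (intro coeff_eq_0) simp
    then have eq: "coeff P D = a * coeff Q D" by (simp add: p_def)
    then have "coeff Q D \<noteq> 0" using coeff_D by auto
    then have "D = degree Q" using degree_le_D(2) le_degree le_antisym by blast
    then have "f None = Some a" using eq degree_le_D(1) Q_nonzero by simp
    with uniq Some show False by blast
  qed
  \<comment> \<open>A polynomial of degree at least 2 with \<open>a\<close> as its only root has a
    multiple root there, which makes \<open>a\<close> critical.\<close>
  have "\<not> rsquarefree p"
  proof
    assume "rsquarefree p"
    from arg_cong[OF complex_poly_decompose_rsquarefree[OF this], of degree] roots degp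
    show False by (simp split: if_splits)
  qed
  then obtain z where "poly p z = 0" "poly (pderiv p) z = 0" by (auto simp: rsquarefree_roots)
  with roots have "poly (pderiv p) a = 0" by auto
  then have "poly W a = 0" using fa(2) by (simp add: W_def p_def pderiv_diff pderiv_smult)
  have lm: "local_map (Some a) = (\<lambda>w. ratio (a + w) - a)"
    using x Some by (auto simp: local_map_def[abs_def] poly_pcompose ratio_def)
  have "((\<lambda>w. ratio (a + w)) has_field_derivative poly W a / (poly Q a)\<^sup>2) (at 0)"
    using DERIV_shift[of ratio _ 0 a] ratio_derivative[OF fa(1)] by (simp add: add.commute)
  then have "(local_map (Some a) has_field_derivative 0) (at 0)"
    unfolding lm using \<open>poly W a = 0\<close> by (auto intro!: derivative_eq_intros)
  then show ?thesis using Some by (simp add: DERIV_imp_deriv)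
qed

end

subsection \<open>An eigendifferential with unimodular eigenvalue\<close>

locale unimodular_eigen_differential = eigen_differential +
  assumes cmod_c: "cmod c = 1" and D_ge_2: "D \<ge> 2"
begin

text \<open>The factor in \<open>f\<^sup>*q = R q\<close>. Its modulus \<open>D\<close> exceeds 1,
  so a fixed point whose multiplier squares to \<open>R\<close> or equals \<open>R\<close> is
  repelling.\<close>

definition R :: complex where "R = of_nat D / c"

lemma c_nonzero: "c \<noteq> 0" using cmod_c by auto

lemma R_nonzero: "R \<noteq> 0" using c_nonzero D_ge_2 by (simp add: R_def)

lemma pullback_equation_R:
  assumes "x \<in> base"
  shows "qd (ratio x) * (deriv ratio x)\<^sup>2 = R * qd x"
proof -
  have "poly Q x \<noteq> 0" using assms by (simp add: base_def regular_def)
  then show ?thesis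
    using pullback_equation[OF cmod_c assms] c_nonzero
    by (simp add: R_def deriv_ratio eq_divide_eq mult_ac del: times_divide_eq_right)
qed

lemma base_ratio:
  assumes "x \<in> base"
  shows "poly Q x \<noteq> 0" "poly N x \<noteq> 0" "poly M x \<noteq> 0" "deriv ratio x \<noteq> 0" "ratio analytic_on {x}"
    "f (Some x) = Some (ratio x)" "poly N (ratio x) \<noteq> 0" "poly M (ratio x) \<noteq> 0"
proof -
  have reg: "x \<in> regular M" using assms by (simp add: base_def)
  then show Q: "poly Q x \<noteq> 0" and M: "poly M x \<noteq> 0" by (auto simp: regular_def)
  show nr: "poly N (ratio x) \<noteq> 0" "poly M (ratio x) \<noteq> 0" using assms by (auto simp: base_def)
  show "f (Some x) = Some (ratio x)" using Q by (simp add: ratio_def)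
  show d: "deriv ratio x \<noteq> 0" using deriv_ratio_nonzero[OF reg] .
  show "ratio analytic_on {x}"
    using ratio_holomorphic[of M] open_regular[of M] reg by (auto simp: analytic_at)
  have "qd (ratio x) * (deriv ratio x)\<^sup>2 \<noteq> 0" using d nr by simp
  then show "poly N x \<noteq> 0" using pullback_equation_R[OF assms] by auto
qed

section \<open>The differential in centred coordinates\<close>

definition qd_local :: "riemann_sphere \<Rightarrow> complex \<Rightarrow> complex" where
  "qd_local x w = qd (chart x w) * (chart_deriv x w)\<^sup>2"

lemma eventually_chart_base: "\<forall>\<^sub>F w in at 0. chart x w \<in> base"
proof -
  have "finite {w. sphere_param x w \<in> Some ` (- base)}"
    using finite_vimageI[OF _ inj_sphere_param, of "Some ` (- base)" x] finite_compl_base by (simp add: vimage_def)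
  from eventually_at_not_in_finite[OF this, of 0] eventually_neq_at_within[of 0]
  show ?thesis by eventually_elim (auto simp: sphere_param_chart)
qed

lemma chart_local_map:
  "\<forall>\<^sub>F w in at 0. local_map x w \<noteq> 0 \<and> chart (f x) (local_map x w) = ratio (chart x w)"
proof -
  have ev: "\<forall>\<^sub>F w in at 0. f (sphere_param x w) = sphere_param (f x) (local_map x w)"
    using f_local_map by (simp add: eventually_nhds_conv_at)
  \<comment> \<open>Excluding the finitely many points with image \<open>f x\<close> keeps
    \<open>local_map x w\<close> away from 0. For \<open>f x = None\<close> the fibre of the
    arbitrary value \<open>the None\<close> is excluded, which does no harm.\<close>
  have "finite {w. sphere_param x w \<in> Some ` fibre (the (f x))}"
    using finite_vimageI[OF _ inj_sphere_param, of "Some ` fibre (the (f x))" x] finite_fibre by (simp add: vimage_def)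
  from eventually_at_not_in_finite[OF this, of 0] ev eventually_chart_base[of x] eventually_neq_at_within[of 0]
  show ?thesis
  proof eventually_elim
    case (elim w)
    have sp: "sphere_param x w = Some (chart x w)" using elim(4) by (rule sphere_param_chart)
    have fr: "f (sphere_param x w) = Some (ratio (chart x w))" unfolding sp by (rule base_ratio(6)[OF elim(3)])
    have "local_map x w \<noteq> 0"
    proof
      assume "local_map x w = 0"
      then have "f x = Some (ratio (chart x w))" using elim(2) fr by simp
      then have "chart x w \<in> fibre (the (f x))" using base_ratio(1)[OF elim(3)] by (simp add: fibre_iff)
      then show False using elim(1) sp by auto
    qed
    moreover have "chart (f x) (local_map x w) = ratio (chart x w)"
      using elim(2) fr by (intro sphere_param_eq_Some) simp
    ultimately show ?case by blast
  qed
qed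

text \<open>The chain rule, applied to the two expressions of the same map supplied by
  \<open>chart_local_map\<close>, gives the pullback equation in centred coordinates, infinity
  included.\<close>

lemma qd_local_relation:
  "\<forall>\<^sub>F w in at 0. qd_local (f x) (local_map x w) * (deriv (local_map x) w)\<^sup>2 = R * qd_local x w"
proof -
  have "\<forall>\<^sub>F w in at 0. local_map x analytic_on {w}"
    using eventually_analytic_at[OF local_map_analytic[of x]] by (simp add: eventually_nhds_conv_at)
  with eventually_at_eventually_nhds[OF chart_local_map[of x]] chart_local_map[of x] eventually_chart_base[of x]
    eventually_neq_at_within[of 0]
  show ?thesis
  proof eventually_elim
    case (elim w)
    let ?F = "local_map x" and ?y = "f x"
    have "(?F has_field_derivative deriv ?F w) (at w)"
      using elim(5) by (metis analytic_on_imp_differentiable_at DERIV_deriv_iff_field_differentiable singletonI)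
    from DERIV_chain2[OF chart_has_derivative[OF conjunct1[OF elim(2)]] this]
    have d1: "((\<lambda>w. chart ?y (?F w)) has_field_derivative chart_deriv ?y (?F w) * deriv ?F w) (at w)" .
    have "\<forall>\<^sub>F v in nhds w. chart ?y (?F v) = ratio (chart x v)"
      using elim(1) by eventually_elim simp
    from iffD1[OF DERIV_cong_ev[OF refl this refl] d1]
    have d2: "((\<lambda>w. ratio (chart x w)) has_field_derivative chart_deriv ?y (?F w) * deriv ?F w) (at w)" .
    have "(ratio has_field_derivative deriv ratio (chart x w)) (at (chart x w))"
      using base_ratio(5)[OF elim(3)]
      by (metis analytic_on_imp_differentiable_at DERIV_deriv_iff_field_differentiable singletonI)
    from DERIV_chain2[OF this chart_has_derivative[OF elim(4)]]
    have "((\<lambda>w. ratio (chart x w)) has_field_derivative deriv ratio (chart x w) * chart_deriv x w) (at w)" .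
    with d2 have eq: "chart_deriv ?y (?F w) * deriv ?F w = deriv ratio (chart x w) * chart_deriv x w"
      by (rule DERIV_unique)
    have "qd_local ?y (?F w) * (deriv ?F w)\<^sup>2 = qd (ratio (chart x w)) * (chart_deriv ?y (?F w) * deriv ?F w)\<^sup>2"
      using elim(2) by (simp only: qd_local_def power_mult_distrib mult.assoc)
    also have "\<dots> = qd (ratio (chart x w)) * (deriv ratio (chart x w))\<^sup>2 * (chart_deriv x w)\<^sup>2"
      unfolding eq by (simp only: power_mult_distrib mult.assoc)
    also have "\<dots> = R * qd_local x w"
      unfolding pullback_equation_R[OF elim(3)] by (simp only: qd_local_def mult.assoc)
    finally show ?case .
  qed
qed

fun qd_ord :: "riemann_sphere \<Rightarrow> int" where
  "qd_ord (Some a) = int (order a N) - int (order a M)"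
| "qd_ord None = int (degree M) - int (degree N) - 4"

lemma qd_ord_ge: "qd_ord x \<ge> -1"
proof (cases x)
  case (Some a)
  have "order a M = 0 \<or> order a M = 1" using rsquarefree_M by (simp add: rsquarefree_def)
  then show ?thesis using Some by auto
qed (use degree_N_M in simp)

lemma qd_local_form:
  "\<exists>k. k analytic_on {0} \<and> k 0 \<noteq> 0 \<and> (\<forall>\<^sub>F w in at 0. qd_local x w = w powi qd_ord x * k w)"
proof (cases x)
  case (Some a)
  obtain N1 where N1: "N = [:-a, 1:] ^ order a N * N1" "\<not> [:-a, 1:] dvd N1"
    using order_decomp[OF N_nonzero] by metis
  obtain M1 where M1: "M = [:-a, 1:] ^ order a M * M1" "\<not> [:-a, 1:] dvd M1"
    using order_decomp[OF M_nonzero] by metis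
  have nz: "poly N1 a \<noteq> 0" "poly M1 a \<noteq> 0" using N1 M1 by (auto simp: poly_eq_0_iff_dvd)
  let ?k = "\<lambda>w. poly (pcompose N1 [:a, 1:]) w / poly (pcompose M1 [:a, 1:]) w"
  have "?k analytic_on {0}" using nz by (intro analytic_intros poly_analytic) (auto simp: poly_pcompose)
  moreover have "?k 0 \<noteq> 0" using nz by (simp add: poly_pcompose)
  moreover have "qd_local x w = w powi qd_ord x * ?k w" if "w \<noteq> 0" for w
  proof -
    have "poly N (a + w) = w ^ order a N * poly N1 (a + w)" by (subst N1(1)) simp
    moreover have "poly M (a + w) = w ^ order a M * poly M1 (a + w)" by (subst M1(1)) simp
    ultimately show ?thesis using that Some
      by (simp add: qd_local_def power_int_diff poly_pcompose)
  qed
  then have "\<forall>\<^sub>F w in at 0. qd_local x w = w powi qd_ord x * ?k w"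
    by (rule eventually_mono[OF eventually_neq_at_within])
  ultimately show ?thesis by blast
next
  case None
  let ?k = "\<lambda>w. poly (reflect_poly N) w / poly (reflect_poly M) w"
  have "?k analytic_on {0}" using N_nonzero M_nonzero by (intro analytic_intros poly_analytic) auto
  moreover have "?k 0 \<noteq> 0" using N_nonzero M_nonzero by simp
  moreover have "qd_local x w = w powi qd_ord x * ?k w" if "w \<noteq> 0" for w
  proof -
    have e: "qd_ord None = int (degree M) - int (degree N + 4)" by simp
    have "w powi qd_ord None = w ^ degree M / (w ^ degree N * w ^ 4)"
    proof -
      have "w powi qd_ord None = w powi int (degree M) / w powi int (degree N + 4)"
        unfolding e using that by (intro power_int_diff) simp
      then show ?thesis by (simp only: power_int_of_nat power_add)
    qed
    then show ?thesis using that None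
      by (simp add: qd_local_def poly_reflect_poly_nz inverse_eq_divide power_divide power_mult[symmetric])
  qed
  then have "\<forall>\<^sub>F w in at 0. qd_local x w = w powi qd_ord x * ?k w"
    by (rule eventually_mono[OF eventually_neq_at_within])
  ultimately show ?thesis by blast
qed

lemma qd_ord_pullback:
  obtains m :: nat where "m > 0" "qd_ord x + 2 = int m * (qd_ord (f x) + 2)" "m = 1 \<Longrightarrow> deriv (local_map x) 0 \<noteq> 0"
proof -
  obtain k where k: "k analytic_on {0}" "k 0 \<noteq> 0" "\<forall>\<^sub>F w in at 0. qd_local (f x) w = w powi qd_ord (f x) * k w"
    using qd_local_form[of "f x"] by blast
  obtain k' where k': "k' analytic_on {0}" "k' 0 \<noteq> 0" "\<forall>\<^sub>F w in at 0. qd_local x w = w powi qd_ord x * k' w"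
    using qd_local_form[of x] by blast
  have "\<forall>\<^sub>F w in nhds 0. w \<noteq> 0 \<longrightarrow> qd_local (f x) w = w powi qd_ord (f x) * k w"
    using k(3) by (simp add: eventually_at_filter)
  then have "\<forall>\<^sub>F w in nhds (local_map x 0). w \<noteq> 0 \<longrightarrow> qd_local (f x) w = w powi qd_ord (f x) * k w" by simp
  from eventually_compose_analytic[OF this local_map_analytic]
  have "\<forall>\<^sub>F w in at 0. local_map x w \<noteq> 0 \<longrightarrow>
      qd_local (f x) (local_map x w) = local_map x w powi qd_ord (f x) * k (local_map x w)"
    by (simp add: eventually_nhds_conv_at)
  with qd_local_relation[of x] chart_local_map[of x] k'(3)
  have "\<forall>\<^sub>F w in at 0. local_map x w powi qd_ord (f x) * k (local_map x w) * (deriv (local_map x) w)\<^sup>2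
      = R * (w powi qd_ord x * k' w)"
    by eventually_elim simp
  from order_relation[OF local_map_analytic local_map_0 k(1,2) k'(1,2) R_nonzero this] that
  show thesis by blast
qed

text \<open>At a fixed point the positive number \<open>qd_ord x + 2\<close> equals \<open>m\<close>
  times itself, so \<open>m = 1\<close> and the multiplier is nonzero. Zeros of \<open>q\<close> are
  excluded as follows: they form a finite set \<open>Z\<close> with all preimages of
  \<open>Z\<close> in \<open>Z\<close>, so a section of \<open>f\<close> permutes \<open>Z\<close>
  and each zero has a single preimage. A fixed zero would be its own full preimage, hence totally
  ramified.\<close>

lemma good_fixed_point:
  obtains x where "f x = x" "qd_ord x = 0 \<or> qd_ord x = -1" "deriv (local_map x) 0 \<noteq> 0"
proof -
  obtain x where x: "f x = x" using f_fixed_point[OF D_ge_2] .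
  obtain m where m: "m > 0" "qd_ord x + 2 = int m * (qd_ord x + 2)" "m = 1 \<Longrightarrow> deriv (local_map x) 0 \<noteq> 0"
    using qd_ord_pullback[of x] x by metis
  have "qd_ord x + 2 > 0" using qd_ord_ge[of x] by simp
  then have "m = 1" using m(2) by simp
  then have d: "deriv (local_map x) 0 \<noteq> 0" using m(3) by simp
  have "qd_ord x \<le> 0"
  proof (rule ccontr)
    assume pos: "\<not> ?thesis"
    define Z where "Z = {x. qd_ord x \<ge> 1}"
    have "Z \<subseteq> insert None (Some ` {a. poly N a = 0})"
    proof
      fix y assume "y \<in> Z"
      then show "y \<in> insert None (Some ` {a. poly N a = 0})"
        using order_root[of N] N_nonzero by (cases y) (auto simp: Z_def)
    qed
    then have "finite Z" using poly_roots_finite[OF N_nonzero] finite_subset by blast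
    have preim: "y \<in> Z" if "f y \<in> Z" for y
    proof -
      obtain m where m: "m > 0" "qd_ord y + 2 = int m * (qd_ord (f y) + 2)"
        using qd_ord_pullback[of y] by metis
      have "1 * (qd_ord (f y) + 2) \<le> int m * (qd_ord (f y) + 2)"
        using m(1) that by (intro mult_right_mono) (auto simp: Z_def)
      then have "qd_ord (f y) + 2 \<le> qd_ord y + 2" unfolding m(2) by simp
      then show ?thesis using that by (simp add: Z_def)
    qed
    obtain s where s: "\<And>y. f (s y) = y" using f_surj by metis
    have "s ` Z \<subseteq> Z" using preim s by auto
    moreover have "inj_on s Z" using s by (metis inj_onI)
    ultimately have sZ: "s ` Z = Z" using endo_inj_surj[OF \<open>finite Z\<close>] by blast
    have "y = x" if y: "f y = x" for y
    proof -
      have "x \<in> Z" using pos by (simp add: Z_def)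
      then have "y \<in> Z" using y by (rule_tac preim) simp
      with sZ obtain z where z: "y = s z" by blast
      have "y = s x" using s[of z] y unfolding z by simp
      from \<open>x \<in> Z\<close> sZ obtain z' where z': "x = s z'" by blast
      have "z' = f x" using s[of z'] unfolding z' by simp
      then have "x = s x" using x z' by simp
      with \<open>y = s x\<close> show ?thesis by simp
    qed
    with totally_ramified[OF D_ge_2 x] d show False by blast
  qed
  with qd_ord_ge[of x] have "qd_ord x = 0 \<or> qd_ord x = -1" by auto
  with x d that show thesis by blast
qed

end

lemma sphere_analytic_at_param:
  assumes "J analytic_on {z}"
  shows "sphere_analytic_at (\<lambda>s. sphere_param x (J s)) z"
proof (cases "x = None \<and> J z \<noteq> 0")
  case False
  show ?thesis
  proof (cases x)
    case None
    with False show ?thesis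
      unfolding sphere_analytic_at_def by (intro exI[of _ J]) (auto simp: assms)
  next
    case (Some a)
    then show ?thesis
      unfolding sphere_analytic_at_def using assms
      by (intro exI[of _ "\<lambda>s. J s - J z"]) (auto intro!: analytic_intros)
  qed
next
  case True
  have "\<forall>\<^sub>F s in at z. J s \<noteq> 0"
    using analytic_at_imp_isCont[OF assms] True unfolding isCont_def by (intro tendsto_imp_eventually_ne) auto
  then have "\<forall>\<^sub>F s in nhds z. J s \<noteq> 0" using True by (simp add: eventually_nhds_conv_at)
  then have "\<forall>\<^sub>F s in nhds z. sphere_param x (J s) = sphere_param (sphere_param x (J z)) (1 / J s - 1 / J z)"
    by eventually_elim (use True in auto)
  then show ?thesis
    unfolding sphere_analytic_at_def using assms True
    by (intro exI[of _ "\<lambda>s. 1 / J s - 1 / J z"]) (auto intro!: analytic_intros)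
qed

lemma sphere_analytic_at_cong:
  assumes "sphere_analytic_at h z" "\<forall>\<^sub>F s in nhds z. h' s = h s"
  shows "sphere_analytic_at h' z"
proof -
  obtain g where g: "g analytic_on {z}" "\<forall>\<^sub>F x in nhds z. h x = sphere_param (h z) (g x)"
    using assms(1) by (auto simp: sphere_analytic_at_def)
  have "h' z = h z" using eventually_nhds_x_imp_x[OF assms(2)] .
  from g(2) assms(2) have "\<forall>\<^sub>F x in nhds z. h' x = sphere_param (h' z) (g x)"
    by eventually_elim (simp add: \<open>h' z = h z\<close>)
  with g(1) show ?thesis by (auto simp: sphere_analytic_at_def)
qed

lemma linear_factor_germ:
  assumes F: "F analytic_on {0::complex}" "F 0 = 0"
  obtains l where "l analytic_on {0}" "l 0 = deriv F 0" "\<And>w. F w = w * l w"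
proof -
  let ?l = "\<lambda>w. if w = 0 then deriv F 0 else (F w - F 0) / (w - 0)"
  obtain e where e: "e > 0" "F holomorphic_on ball 0 e" using F(1) by (auto simp: analytic_at_ball)
  have "?l holomorphic_on ball 0 e" by (rule pole_lemma_open[OF e(2) open_ball])
  then have "?l analytic_on {0}" using e(1) by (auto simp: analytic_at_ball)
  then show thesis by (rule that) (auto simp: F(2))
qed

section \<open>Linearization at the fixed point and its extension to the plane\<close>

context unimodular_eigen_differential
begin

text \<open>At a simple pole the local problem is transferred to the double cover \<open>w = v\<^sup>2\<close>.\<close>

lemma local_solution:
  obtains x0 \<rho> J where "\<rho>\<^sup>2 = R" "f x0 = x0" "J analytic_on {0}" "J 0 = 0"
    "\<forall>\<^sub>F t in at 0. J t \<noteq> 0 \<and> qd_local x0 (J t) * (deriv J t)\<^sup>2 = 1"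
    "\<forall>\<^sub>F t in nhds 0. local_map x0 (J t) = J (\<rho> * t)"
proof -
  obtain x where x: "f x = x" "qd_ord x = 0 \<or> qd_ord x = -1" "deriv (local_map x) 0 \<noteq> 0"
    using good_fixed_point .
  define F where "F = local_map x"
  have F: "F analytic_on {0}" "F 0 = 0" "deriv F 0 \<noteq> 0" using local_map_analytic x(3) by (auto simp: F_def)
  obtain k where k: "k analytic_on {0}" "k 0 \<noteq> 0" "\<forall>\<^sub>F w in at 0. qd_local x w = w powi qd_ord x * k w"
    using qd_local_form[of x] by blast
  have Fne: "\<forall>\<^sub>F w in at 0. F w \<noteq> 0" using chart_local_map[of x] by (auto simp: F_def elim: eventually_mono)
  have kn: "\<forall>\<^sub>F w in nhds 0. w \<noteq> 0 \<longrightarrow> qd_local x w = w powi qd_ord x * k w"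
    using k(3) by (simp add: eventually_at_filter)
  then have "\<forall>\<^sub>F w in nhds (F 0). w \<noteq> 0 \<longrightarrow> qd_local x w = w powi qd_ord x * k w" using F(2) by simp
  from eventually_compose_analytic[OF this F(1)]
  have kF: "\<forall>\<^sub>F w in at 0. F w \<noteq> 0 \<longrightarrow> qd_local x (F w) = F w powi qd_ord x * k (F w)"
    by (simp add: eventually_nhds_conv_at)
  have "\<forall>\<^sub>F w in at 0. qd_local x (F w) * (deriv F w)\<^sup>2 = R * qd_local x w"
    using qd_local_relation[of x] x(1) by (simp add: F_def)
  with kF Fne k(3)
  have rel: "\<forall>\<^sub>F w in at 0. F w powi qd_ord x * k (F w) * (deriv F w)\<^sup>2 = R * (w powi qd_ord x * k w)"
    by eventually_elim simp
  have nonzero: "\<forall>\<^sub>F t in at 0. \<psi> t \<noteq> 0" if "\<psi> analytic_on {0}" "deriv \<psi> 0 \<noteq> 0" for \<psi> :: "complex \<Rightarrow> complex"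
    using that(1)
  proof (rule analytic_isolated_zero)
    show "\<not> (\<forall>\<^sub>F w in nhds 0. \<psi> w = 0)"
    proof
      assume "\<forall>\<^sub>F w in nhds 0. \<psi> w = 0"
      then have "deriv \<psi> 0 = deriv (\<lambda>_. 0) 0" by (intro deriv_cong_ev) auto
      with that(2) show False by simp
    qed
  qed
  show thesis
  proof (cases "qd_ord x = 0")
    case True
    then have "\<forall>\<^sub>F w in at 0. k (F w) * (deriv F w)\<^sup>2 = R * k w" using rel by simp
    note lin = linearization[OF k(1,2) F(1,2) R_nonzero this]
    obtain \<rho> \<psi> r where \<psi>: "\<rho>\<^sup>2 = R" "r > 0" "\<psi> holomorphic_on ball 0 r" "\<psi> 0 = 0"
      "\<And>t. t \<in> ball 0 r \<Longrightarrow> k (\<psi> t) * (deriv \<psi> t)\<^sup>2 = 1" "\<forall>\<^sub>F t in nhds 0. F (\<psi> t) = \<psi> (\<rho> * t)"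
      by (rule lin, rule that)
    have an: "\<psi> analytic_on {0}" using \<psi>(2,3) by (auto simp: analytic_at_ball)
    have d0: "deriv \<psi> 0 \<noteq> 0" using \<psi>(5)[of 0] \<psi>(2) by auto
    have "\<forall>\<^sub>F w in nhds (\<psi> 0). w \<noteq> 0 \<longrightarrow> qd_local x w = w powi qd_ord x * k w" using kn \<psi>(4) by simp
    from eventually_compose_analytic[OF this an]
    have "\<forall>\<^sub>F t in at 0. \<psi> t \<noteq> 0 \<longrightarrow> qd_local x (\<psi> t) = \<psi> t powi qd_ord x * k (\<psi> t)"
      by (simp add: eventually_nhds_conv_at)
    moreover have "\<forall>\<^sub>F t in at 0. t \<in> ball 0 r - {0}" using \<psi>(2) by (intro eventually_at_in_open) auto
    ultimately have "\<forall>\<^sub>F t in at 0. \<psi> t \<noteq> 0 \<and> qd_local x (\<psi> t) * (deriv \<psi> t)\<^sup>2 = 1"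
      using nonzero[OF an d0] by eventually_elim (use True \<psi>(5) in auto)
    then show thesis using that[OF \<psi>(1) x(1) an \<psi>(4)] \<psi>(6) by (simp add: F_def)
  next
    case False
    then have ord: "qd_ord x = -1" using x(2) by simp
    obtain l where l: "l analytic_on {0}" "l 0 = deriv F 0" "\<And>w. F w = w * l w"
      using linear_factor_germ[OF F(1,2)] by blast
    obtain s where s: "s analytic_on {0}" "\<forall>\<^sub>F w in nhds 0. (s w)\<^sup>2 = l w"
      using sqrt_germ[OF l(1)] l(2) F(3) by auto
    \<comment> \<open>\<open>F2\<close> lifts \<open>F\<close> through \<open>w = v^2\<close>, with
      a square root available because the multiplier \<open>l 0\<close> is nonzero.
      \<open>Q2\<close> is the pullback of \<open>k(w) / w dw^2\<close>: the pole cancels against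
      \<open>dw = 2 v dv\<close>, leaving the factor 4.\<close>
    define F2 where "F2 v = v * s (v\<^sup>2)" for v
    define Q2 where "Q2 v = 4 * k (v\<^sup>2)" for v
    have sq: "(\<lambda>v::complex. v\<^sup>2) analytic_on {0}" by (intro analytic_intros)
    have sq0: "nhds ((0::complex)\<^sup>2) = nhds 0" by simp
    have F2: "F2 analytic_on {0}" "F2 0 = 0"
      using analytic_on_compose[OF sq, of s] s(1) by (auto simp: F2_def[abs_def] o_def intro!: analytic_intros)
    have Q2: "Q2 analytic_on {0}" "Q2 0 \<noteq> 0"
      using analytic_on_compose[OF sq, of k] k(1,2) by (auto simp: Q2_def[abs_def] o_def intro!: analytic_intros)
    have "\<forall>\<^sub>F v in nhds 0. (s (v\<^sup>2))\<^sup>2 = l (v\<^sup>2)"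
      by (rule eventually_compose_analytic[OF _ sq]) (simp only: sq0 s(2))
    then have F2sq: "\<forall>\<^sub>F v in nhds 0. (F2 v)\<^sup>2 = F (v\<^sup>2)"
      by eventually_elim (simp add: F2_def power_mult_distrib l(3))
    have sq_at: "filterlim (\<lambda>v::complex. v\<^sup>2) (at 0) (at 0)"
      unfolding filterlim_at using tendsto_power[OF tendsto_ident_at[of "0::complex" UNIV], of 2]
      by (auto simp: eventually_at_filter)
    have F2sq_at: "\<forall>\<^sub>F v in at 0. \<forall>\<^sub>F u in nhds v. (F2 u)\<^sup>2 = F (u\<^sup>2)"
      using F2sq by (intro eventually_at_eventually_nhds) (simp add: eventually_nhds_conv_at)
    have anF2: "\<forall>\<^sub>F v in at 0. F2 analytic_on {v}"
      using eventually_analytic_at[OF F2(1)] by (simp add: eventually_nhds_conv_at)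
    have "\<forall>\<^sub>F w in nhds ((0::complex)\<^sup>2). F analytic_on {w}" unfolding sq0 by (rule eventually_analytic_at[OF F(1)])
    from eventually_compose_analytic[OF this sq]
    have anF: "\<forall>\<^sub>F v in at 0. F analytic_on {v\<^sup>2}" by (simp add: eventually_nhds_conv_at)
    have rel2: "\<forall>\<^sub>F v in at 0. F (v\<^sup>2) powi qd_ord x * k (F (v\<^sup>2)) * (deriv F (v\<^sup>2))\<^sup>2
        = R * ((v\<^sup>2) powi qd_ord x * k (v\<^sup>2))"
      using eventually_compose_filterlim[OF rel sq_at] .
    have Fne2: "\<forall>\<^sub>F v in at 0. F (v\<^sup>2) \<noteq> 0" using eventually_compose_filterlim[OF Fne sq_at] .
    have "\<forall>\<^sub>F v in at 0. Q2 (F2 v) * (deriv F2 v)\<^sup>2 = R * Q2 v"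
      using F2sq_at anF2 anF rel2 Fne2 eventually_neq_at_within[of 0]
    proof eventually_elim
      case (elim v)
      have d2: "(F2 has_field_derivative deriv F2 v) (at v)"
        using elim(2) by (metis analytic_on_imp_differentiable_at DERIV_deriv_iff_field_differentiable singletonI)
      have d: "(F has_field_derivative deriv F (v\<^sup>2)) (at (v\<^sup>2))"
        using elim(3) by (metis analytic_on_imp_differentiable_at DERIV_deriv_iff_field_differentiable singletonI)
      have e1: "((\<lambda>v. (F2 v)\<^sup>2) has_field_derivative 2 * F2 v * deriv F2 v) (at v)"
        using DERIV_power[OF d2, of 2] by (simp add: mult_ac)
      have e2: "((\<lambda>v. F (v\<^sup>2)) has_field_derivative deriv F (v\<^sup>2) * (2 * v)) (at v)"
        by (rule DERIV_chain2[where f = F and g = "\<lambda>v. v\<^sup>2", OF d]) (auto intro!: derivative_eq_intros)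
      have "2 * F2 v * deriv F2 v = deriv F (v\<^sup>2) * (2 * v)"
        using iffD1[OF DERIV_cong_ev[OF refl elim(1) refl] e1] e2 by (rule DERIV_unique)
      then have "F2 v * deriv F2 v = deriv F (v\<^sup>2) * v" by simp
      from arg_cong[OF this, of "\<lambda>x. x\<^sup>2"]
      have a: "F (v\<^sup>2) * (deriv F2 v)\<^sup>2 = (deriv F (v\<^sup>2))\<^sup>2 * v\<^sup>2"
        using eventually_nhds_x_imp_x[OF elim(1)] by (simp add: power_mult_distrib)
      have "k (F (v\<^sup>2)) * (deriv F (v\<^sup>2))\<^sup>2 * v\<^sup>2 = R * k (v\<^sup>2) * F (v\<^sup>2)"
        using elim(4-6) unfolding ord by (simp add: field_simps power_int_minus)
      then have kF2: "k (F (v\<^sup>2)) * ((deriv F (v\<^sup>2))\<^sup>2 * v\<^sup>2) = R * k (v\<^sup>2) * F (v\<^sup>2)"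
        by (simp only: mult.assoc)
      have "F (v\<^sup>2) * (k (F (v\<^sup>2)) * (deriv F2 v)\<^sup>2) = k (F (v\<^sup>2)) * (F (v\<^sup>2) * (deriv F2 v)\<^sup>2)"
        by (rule mult.left_commute)
      also have "\<dots> = F (v\<^sup>2) * (R * k (v\<^sup>2))"
        unfolding a kF2 by (rule mult.commute)
      finally have "F (v\<^sup>2) * (k (F (v\<^sup>2)) * (deriv F2 v)\<^sup>2) = F (v\<^sup>2) * (R * k (v\<^sup>2))" .
      then have "k (F (v\<^sup>2)) * (deriv F2 v)\<^sup>2 = R * k (v\<^sup>2)" using elim(5) by simp
      then show ?case using eventually_nhds_x_imp_x[OF elim(1)] by (simp add: Q2_def)
    qed
    note lin = linearization[OF Q2 F2 R_nonzero this]
    obtain \<rho> \<psi> r where \<psi>: "\<rho>\<^sup>2 = R" "r > 0" "\<psi> holomorphic_on ball 0 r" "\<psi> 0 = 0"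
      "\<And>t. t \<in> ball 0 r \<Longrightarrow> Q2 (\<psi> t) * (deriv \<psi> t)\<^sup>2 = 1" "\<forall>\<^sub>F t in nhds 0. F2 (\<psi> t) = \<psi> (\<rho> * t)"
      by (rule lin, rule that)
    have an: "\<psi> analytic_on {0}" using \<psi>(2,3) by (auto simp: analytic_at_ball)
    have d0: "deriv \<psi> 0 \<noteq> 0" using \<psi>(5)[of 0] \<psi>(2) by auto
    \<comment> \<open>Squaring returns from the double cover to the coordinate at \<open>x\<close>.
      As \<open>J\<close> ramifies over the pole of \<open>q\<close>, its equation is asserted for
      \<open>t \<noteq> 0\<close> only.\<close>
    define J where "J t = (\<psi> t)\<^sup>2" for t
    have J: "J analytic_on {0}" "J 0 = 0" unfolding J_def[abs_def] using an \<psi>(4) by (auto intro!: analytic_intros)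
    have "\<forall>\<^sub>F w in nhds (J 0). w \<noteq> 0 \<longrightarrow> qd_local x w = w powi qd_ord x * k w" using kn J(2) by simp
    from eventually_compose_analytic[OF this J(1)]
    have "\<forall>\<^sub>F t in at 0. J t \<noteq> 0 \<longrightarrow> qd_local x (J t) = J t powi qd_ord x * k (J t)"
      by (simp add: eventually_nhds_conv_at)
    moreover have "\<forall>\<^sub>F t in at 0. t \<in> ball 0 r - {0}" using \<psi>(2) by (intro eventually_at_in_open) auto
    ultimately have sol: "\<forall>\<^sub>F t in at 0. J t \<noteq> 0 \<and> qd_local x (J t) * (deriv J t)\<^sup>2 = 1"
      using nonzero[OF an d0]
    proof eventually_elim
      case (elim t)
      have "(\<psi> has_field_derivative deriv \<psi> t) (at t)"
        using holomorphic_derivI[OF \<psi>(3) open_ball] elim(2) by auto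
      then have dJ: "deriv J t = 2 * \<psi> t * deriv \<psi> t"
        unfolding J_def[abs_def] by (intro DERIV_imp_deriv) (auto intro!: derivative_eq_intros)
      have nz: "J t \<noteq> 0" using elim(3) by (simp add: J_def)
      have "qd_local x (J t) = inverse (J t) * k (J t)" using elim(1) nz ord by (simp add: power_int_minus)
      then have "qd_local x (J t) * (deriv J t)\<^sup>2 = (inverse (J t) * J t) * (4 * k (J t) * (deriv \<psi> t)\<^sup>2)"
        unfolding dJ by (simp add: J_def power_mult_distrib)
      also have "\<dots> = Q2 (\<psi> t) * (deriv \<psi> t)\<^sup>2" using nz by (simp add: Q2_def J_def)
      also have "\<dots> = 1" using \<psi>(5) elim(2) by blast
      finally show ?case using nz by blast
    qed
    have "\<forall>\<^sub>F v in nhds (\<psi> 0). (F2 v)\<^sup>2 = F (v\<^sup>2)" using F2sq \<psi>(4) by simp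
    from eventually_compose_analytic[OF this an] \<psi>(6)
    have "\<forall>\<^sub>F t in nhds 0. F (J t) = J (\<rho> * t)"
      by eventually_elim (simp add: J_def)
    then show thesis using that[OF \<psi>(1) x(1) J sol] by (simp add: F_def)
  qed
qed

text \<open>The equation \<open>h\<^sup>*q = C dt^2\<close> at the single point \<open>t\<close>,
  away from zeros and poles of \<open>q\<close>. The finite representative \<open>g\<close> may vary
  with \<open>t\<close>, since \<open>h\<close> takes the value infinity elsewhere. The constant is
  kept variable: applying \<open>f\<close> multiplies it by \<open>R\<close>, rescaling by
  \<open>a\<close> multiplies it by \<open>a^2\<close>.\<close>

definition pt_sol :: "complex \<Rightarrow> (complex \<Rightarrow> riemann_sphere) \<Rightarrow> complex \<Rightarrow> bool" where
  "pt_sol C h t \<longleftrightarrow> (\<exists>g. g analytic_on {t} \<and> (\<forall>\<^sub>F s in nhds t. h s = Some (g s)) \<and>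
     poly N (g t) \<noteq> 0 \<and> poly M (g t) \<noteq> 0 \<and> qd (g t) * (deriv g t)\<^sup>2 = C)"

lemma pt_sol_cong: "pt_sol C h t \<Longrightarrow> \<forall>\<^sub>F s in nhds t. h' s = h s \<Longrightarrow> pt_sol C h' t"
  unfolding pt_sol_def by (erule exE, rule_tac x = g in exI) (auto elim: eventually_elim2)

lemma pt_sol_f:
  assumes "pt_sol C h t" "h t \<in> Some ` base"
  shows "pt_sol (R * C) (\<lambda>s. f (h s)) t"
proof -
  obtain g where g: "g analytic_on {t}" "\<forall>\<^sub>F s in nhds t. h s = Some (g s)"
    "qd (g t) * (deriv g t)\<^sup>2 = C" using assms(1) by (auto simp: pt_sol_def)
  have gb: "g t \<in> base" using assms(2) eventually_nhds_x_imp_x[OF g(2)] by auto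
  have "\<forall>\<^sub>F w in nhds (g t). w \<in> base" using open_base gb by (rule eventually_nhds_in_open)
  from eventually_compose_analytic[OF this g(1)] g(2)
  have "\<forall>\<^sub>F s in nhds t. f (h s) = Some (ratio (g s))"
    by eventually_elim (simp only: base_ratio(6))
  moreover have "(\<lambda>s. ratio (g s)) analytic_on {t}"
    using analytic_on_compose[OF g(1), of ratio] base_ratio(5)[OF gb] by (simp add: o_def)
  moreover have "deriv (\<lambda>s. ratio (g s)) t = deriv ratio (g t) * deriv g t"
    using deriv_chain[of g t ratio] base_ratio(5)[OF gb] g(1) analytic_on_imp_differentiable_at
    by (fastforce simp: o_def)
  then have "qd (ratio (g t)) * (deriv (\<lambda>s. ratio (g s)) t)\<^sup>2 = R * C"
    using pullback_equation_R[OF gb] g(3)[symmetric] by (simp only: power_mult_distrib mult.assoc[symmetric])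
  ultimately show ?thesis unfolding pt_sol_def using base_ratio(7,8)[OF gb] by blast
qed

lemma sol_not_constant:
  assumes "\<forall>\<^sub>F t in at z. pt_sol C h t" "C \<noteq> 0"
  shows "\<not> (\<forall>\<^sub>F t in nhds z. h t = h z)"
proof
  assume "\<forall>\<^sub>F t in nhds z. h t = h z"
  then have "\<forall>\<^sub>F t in at z. \<forall>\<^sub>F s in nhds t. h s = h z"
    by (intro eventually_at_eventually_nhds) (simp add: eventually_nhds_conv_at)
  with assms(1) have "\<forall>\<^sub>F t in at z. False"
  proof eventually_elim
    case (elim t)
    then obtain g where g: "\<forall>\<^sub>F s in nhds t. h s = Some (g s)" "qd (g t) * (deriv g t)\<^sup>2 = C"
      by (auto simp: pt_sol_def)
    from g(1) elim(2) have "\<forall>\<^sub>F s in nhds t. g s = the (h z)" by eventually_elim (metis option.sel)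
    then have "deriv g t = deriv (\<lambda>_. the (h z)) t" by (intro deriv_cong_ev) auto
    then show False using g(2) assms(2) by simp
  qed
  then show False by simp
qed

lemma eventually_pt_sol_f:
  assumes "sphere_analytic_at h z" "\<forall>\<^sub>F t in at z. pt_sol C h t" "C \<noteq> 0"
  shows "\<forall>\<^sub>F t in at z. pt_sol (R * C) (\<lambda>s. f (h s)) t"
proof -
  have "\<forall>\<^sub>F t in at z. h t \<notin> Some ` (- base)"
    using finite_compl_base by (intro sphere_analytic_avoids[OF assms(1) sol_not_constant[OF assms(2,3)]]) simp
  with assms(2) show ?thesis
  proof eventually_elim
    case (elim t)
    then have "h t \<in> Some ` base" by (auto simp: pt_sol_def dest!: eventually_nhds_x_imp_x)
    with elim(1) show ?case by (rule pt_sol_f)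
  qed
qed

lemma pt_sol_scale:
  assumes "pt_sol C h (a * t)"
  shows "pt_sol (a\<^sup>2 * C) (\<lambda>s. h (a * s)) t"
proof -
  obtain g where g: "g analytic_on {a * t}" "\<forall>\<^sub>F s in nhds (a * t). h s = Some (g s)"
    "poly N (g (a * t)) \<noteq> 0" "poly M (g (a * t)) \<noteq> 0" "qd (g (a * t)) * (deriv g (a * t))\<^sup>2 = C"
    using assms by (auto simp: pt_sol_def)
  have an: "(\<lambda>s. a * s) analytic_on {t}" by (intro analytic_intros)
  have "(\<lambda>s. g (a * s)) analytic_on {t}"
    using analytic_on_compose[OF an, of g] g(1) by (simp add: o_def)
  moreover have "\<forall>\<^sub>F s in nhds t. h (a * s) = Some (g (a * s))"
    by (rule eventually_compose_analytic[OF g(2) an])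
  moreover have "(g has_field_derivative deriv g (a * t)) (at (a * t))"
    using g(1) by (metis analytic_on_imp_differentiable_at DERIV_deriv_iff_field_differentiable singletonI)
  then have "((\<lambda>s. g (a * s)) has_field_derivative deriv g (a * t) * a) (at t)"
    by (rule DERIV_chain2) (auto intro!: derivative_eq_intros)
  then have "deriv (\<lambda>s. g (a * s)) t = deriv g (a * t) * a" by (rule DERIV_imp_deriv)
  then have "qd (g (a * t)) * (deriv (\<lambda>s. g (a * s)) t)\<^sup>2 = a\<^sup>2 * C"
    using g(5)[symmetric] by (simp add: power_mult_distrib mult_ac)
  ultimately show ?thesis unfolding pt_sol_def using g(3,4) by (intro exI[of _ "\<lambda>s. g (a * s)"]) simp
qed


lemma cmod_R: "cmod R = of_nat D"
  using cmod_c by (simp add: R_def norm_divide)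

text \<open>Conjugating by \<open>f\<close> extends the local solution at the repelling fixed point to the whole plane.\<close>

theorem flat_parametrization:
  obtains \<rho> \<phi> where "\<rho>\<^sup>2 = R" "\<And>z. sphere_analytic_at \<phi> z" "\<And>z. \<phi> (\<rho> * z) = f (\<phi> z)"
    "\<And>z. \<forall>\<^sub>F t in at z. pt_sol 1 \<phi> t"
proof -
  obtain x0 \<rho> J where J: "\<rho>\<^sup>2 = R" "f x0 = x0" "J analytic_on {0}" "J 0 = 0"
    "\<forall>\<^sub>F t in at 0. J t \<noteq> 0 \<and> qd_local x0 (J t) * (deriv J t)\<^sup>2 = 1"
    "\<forall>\<^sub>F t in nhds 0. local_map x0 (J t) = J (\<rho> * t)"
    using local_solution .
  define \<phi>0 where "\<phi>0 t = sphere_param x0 (J t)" for t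
  have "(cmod \<rho>)\<^sup>2 = of_nat D" using J(1) cmod_R by (simp add: norm_power[symmetric])
  then have \<rho>1: "cmod \<rho> > 1"
    using D_ge_2 by (metis norm_ge_zero not_less numeral_le_one_iff of_nat_le_1_iff order_trans power_le_one semiring_norm(69))
  then have \<rho>0: "\<rho> \<noteq> 0" by auto
  have "\<forall>\<^sub>F w in nhds (J 0). f (sphere_param x0 w) = sphere_param (f x0) (local_map x0 w)"
    unfolding J(4) by (rule f_local_map)
  from eventually_compose_analytic[OF this J(3)] J(6)
  have ev1: "\<forall>\<^sub>F t in nhds 0. f (\<phi>0 t) = \<phi>0 (\<rho> * t)"
    by eventually_elim (simp add: \<phi>0_def J(2))
  have "\<forall>\<^sub>F w in nhds (J 0). w \<noteq> 0 \<longrightarrow> chart x0 w \<in> base"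
    unfolding J(4) using eventually_chart_base[of x0] by (simp add: eventually_at_filter)
  from eventually_compose_analytic[OF this J(3)]
  have "\<forall>\<^sub>F t in at 0. J t \<noteq> 0 \<longrightarrow> chart x0 (J t) \<in> base" by (simp add: eventually_nhds_conv_at)
  moreover have "\<forall>\<^sub>F t in at 0. J analytic_on {t}"
    using eventually_analytic_at[OF J(3)] by (simp add: eventually_nhds_conv_at)
  moreover have "\<forall>\<^sub>F t in at 0. \<forall>\<^sub>F s in nhds t. J s \<noteq> 0"
    using J(5) by (intro eventually_at_eventually_nhds) (auto elim: eventually_mono)
  ultimately have ev2: "\<forall>\<^sub>F t in at 0. pt_sol 1 \<phi>0 t \<and> J analytic_on {t}"
    using J(5)
  proof eventually_elim
    case (elim t)
    have nz: "J t \<noteq> 0" using elim(4) by simp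
    have cb: "chart x0 (J t) \<in> base" using elim(1) nz by simp
    have "(J has_field_derivative deriv J t) (at t)"
      using elim(2) by (metis analytic_on_imp_differentiable_at DERIV_deriv_iff_field_differentiable singletonI)
    from DERIV_chain2[OF chart_has_derivative[OF nz] this]
    have d: "deriv (\<lambda>s. chart x0 (J s)) t = chart_deriv x0 (J t) * deriv J t" by (rule DERIV_imp_deriv)
    have "(\<lambda>s. chart x0 (J s)) analytic_on {t}"
      using elim(2) nz by (cases x0) (auto intro!: analytic_intros)
    moreover have "\<forall>\<^sub>F s in nhds t. \<phi>0 s = Some (chart x0 (J s))"
      using elim(3) by eventually_elim (simp add: \<phi>0_def sphere_param_chart)
    moreover have "qd (chart x0 (J t)) * (deriv (\<lambda>s. chart x0 (J s)) t)\<^sup>2 = 1"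
      using elim(4) unfolding d qd_local_def by (simp only: power_mult_distrib mult.assoc)
    ultimately show ?case unfolding pt_sol_def using base_ratio(2,3)[OF cb] elim(2) by blast
  qed
  obtain r1 where r1: "r1 > 0" "\<And>t. cmod t < r1 \<Longrightarrow> f (\<phi>0 t) = \<phi>0 (\<rho> * t)"
    using ev1 by (auto simp: eventually_nhds_metric)
  obtain r2 where r2: "r2 > 0" "\<And>t. cmod t < r2 \<Longrightarrow> t \<noteq> 0 \<Longrightarrow> pt_sol 1 \<phi>0 t \<and> J analytic_on {t}"
    using ev2 by (auto simp: eventually_at)
  define r where "r = min r1 r2"
  have r: "r > 0" "\<And>t. cmod t < r \<Longrightarrow> f (\<phi>0 t) = \<phi>0 (\<rho> * t)"
    "\<And>t. cmod t < r \<Longrightarrow> t \<noteq> 0 \<Longrightarrow> pt_sol 1 \<phi>0 t"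
    "\<And>t. cmod t < r \<Longrightarrow> J analytic_on {t}"
    using r1 r2 J(3) by (auto simp: r_def)
  have ex: "\<exists>n. cmod (z / \<rho> ^ n) < r" for z
  proof -
    obtain n where "cmod z / r < cmod \<rho> ^ n" using real_arch_pow[OF \<rho>1] by blast
    then have "cmod z < r * cmod \<rho> ^ n" using r(1) by (simp add: pos_divide_less_eq mult.commute)
    moreover have "cmod \<rho> ^ n > 0" using \<rho>0 by simp
    ultimately have "cmod (z / \<rho> ^ n) < r" by (simp add: norm_divide norm_power pos_divide_less_eq)
    then show ?thesis ..
  qed
  \<comment> \<open>Once \<open>z / \<rho>^n\<close> lies in the small disc, a larger exponent
    changes nothing, because \<open>f\<close> undoes each further division by
    \<open>\<rho>\<close>.\<close>
  have shift: "(f ^^ (n + k)) (\<phi>0 (z / \<rho> ^ (n + k))) = (f ^^ n) (\<phi>0 (z / \<rho> ^ n))"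
    if n: "cmod (z / \<rho> ^ n) < r" for n k z
  proof (induction k)
    case (Suc k)
    have le: "cmod (z / \<rho> ^ (n + k)) \<le> cmod (z / \<rho> ^ n)" for k
    proof -
      have "cmod \<rho> ^ n \<le> cmod \<rho> ^ (n + k)" using \<rho>1 by (intro power_increasing) auto
      then show ?thesis using \<rho>0 by (simp add: norm_divide norm_power divide_left_mono)
    qed
    have "cmod (z / \<rho> ^ (n + Suc k)) < r" using le[of "Suc k"] n by linarith
    from r(2)[OF this] have "f (\<phi>0 (z / \<rho> ^ (n + Suc k))) = \<phi>0 (z / \<rho> ^ (n + k))"
      using \<rho>0 by simp
    then have "(f ^^ (n + Suc k)) (\<phi>0 (z / \<rho> ^ (n + Suc k))) = (f ^^ (n + k)) (\<phi>0 (z / \<rho> ^ (n + k)))"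
      by (simp only: add_Suc_right funpow_Suc_right o_def)
    with Suc show ?case by simp
  qed simp
  \<comment> \<open>The least admissible \<open>n\<close> merely makes \<open>\<phi>\<close> a
    function; near a given \<open>z\<close> a single fixed \<open>n\<close> serves.\<close>
  define \<phi> where "\<phi> z = (let n = (LEAST n. cmod (z / \<rho> ^ n) < r) in (f ^^ n) (\<phi>0 (z / \<rho> ^ n)))" for z
  have \<phi>: "\<phi> z = (f ^^ n) (\<phi>0 (z / \<rho> ^ n))" if n: "cmod (z / \<rho> ^ n) < r" for n z
  proof -
    define m where "m = (LEAST n. cmod (z / \<rho> ^ n) < r)"
    have m: "cmod (z / \<rho> ^ m) < r" unfolding m_def using ex[of z] by (rule LeastI_ex)
    have "m \<le> n" unfolding m_def using n by (rule Least_le)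
    with shift[OF m, of "n - m"] show ?thesis by (simp add: \<phi>_def m_def[symmetric])
  qed
  have near: "\<forall>\<^sub>F s in nhds z. cmod (s / \<rho> ^ n) < r" if "cmod (z / \<rho> ^ n) < r" for n z
  proof -
    have "open {s. cmod (s / \<rho> ^ n) < r}" using \<rho>0 by (intro open_Collect_less continuous_intros) auto
    from eventually_nhds_in_open[OF this, of z] that show ?thesis by simp
  qed
  have iter: "sphere_analytic_at (\<lambda>s. (f ^^ k) (\<phi>0 (s / \<rho> ^ n))) z" if n: "cmod (z / \<rho> ^ n) < r" for k n z
  proof (induction k)
    case 0
    have an: "(\<lambda>s. s / \<rho> ^ n) analytic_on {z}" using \<rho>0 by (intro analytic_intros) auto
    have "(\<lambda>s. J (s / \<rho> ^ n)) analytic_on {z}"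
      using analytic_on_compose[OF an, of J] r(4)[OF n] by (simp add: o_def)
    from sphere_analytic_at_param[OF this, of x0] show ?case by (simp add: \<phi>0_def)
  next
    case (Suc k)
    from sphere_analytic_comp[OF Suc] show ?case by simp
  qed
  have iter_sol: "\<forall>\<^sub>F t in at z. pt_sol (R ^ k * ((1 / \<rho> ^ n)\<^sup>2 * 1)) (\<lambda>s. (f ^^ k) (\<phi>0 (s / \<rho> ^ n))) t"
    if n: "cmod (z / \<rho> ^ n) < r" for k n z
  proof (induction k)
    case 0
    have "\<forall>\<^sub>F s in at z. cmod (s / \<rho> ^ n) < r" using near[OF n] by (simp add: eventually_nhds_conv_at)
    moreover have "\<forall>\<^sub>F s in at z. s \<notin> {0}" by (rule eventually_at_not_in_finite) simp
    ultimately show ?case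
    proof eventually_elim
      case (elim t)
      then have "pt_sol 1 \<phi>0 (1 / \<rho> ^ n * t)" using r(3)[of "t / \<rho> ^ n"] \<rho>0 by simp
      from pt_sol_scale[OF this] show ?case by simp
    qed
  next
    case (Suc k)
    have "R ^ k * ((1 / \<rho> ^ n)\<^sup>2 * 1) \<noteq> 0" using R_nonzero \<rho>0 by simp
    from eventually_pt_sol_f[OF iter[OF n] Suc this] show ?case by (simp add: mult.assoc)
  qed
  show thesis
  proof (rule that[of \<rho> \<phi>])
    show "\<rho>\<^sup>2 = R" by fact
    fix z
    obtain n where n: "cmod (z / \<rho> ^ n) < r" using ex by blast
    have ev: "\<forall>\<^sub>F s in nhds z. \<phi> s = (f ^^ n) (\<phi>0 (s / \<rho> ^ n))"
      using near[OF n] by eventually_elim (rule \<phi>)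
    show "sphere_analytic_at \<phi> z" by (rule sphere_analytic_at_cong[OF iter[OF n] ev])
    have "cmod (\<rho> * z / \<rho> ^ Suc n) < r" using n \<rho>0 by simp
    from \<phi>[OF this] \<phi>[OF n] show "\<phi> (\<rho> * z) = f (\<phi> z)" using \<rho>0 by simp
    \<comment> \<open>The factor gained from \<open>n\<close> applications of \<open>f\<close>
      cancels the one from rescaling, so the constant 1 persists over the whole plane.\<close>
    have "R ^ n * ((1 / \<rho> ^ n)\<^sup>2 * 1) = 1"
      unfolding J(1)[symmetric] using \<rho>0 by (simp add: power_divide power_mult[symmetric] mult.commute)
    with iter_sol[OF n, of n] have "\<forall>\<^sub>F t in at z. pt_sol 1 (\<lambda>s. (f ^^ n) (\<phi>0 (s / \<rho> ^ n))) t" by simp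
    moreover have "\<forall>\<^sub>F t in at z. \<forall>\<^sub>F s in nhds t. \<phi> s = (f ^^ n) (\<phi>0 (s / \<rho> ^ n))"
      using ev by (intro eventually_at_eventually_nhds) (simp add: eventually_nhds_conv_at)
    ultimately show "\<forall>\<^sub>F t in at z. pt_sol 1 \<phi> t" by eventually_elim (rule pt_sol_cong)
  qed
qed

end

subsection \<open>Discrete subgroups of the plane\<close>

lemma discrete_subgroup_finite:
  assumes diff: "\<And>v w. v \<in> \<Lambda> \<Longrightarrow> w \<in> \<Lambda> \<Longrightarrow> v - w \<in> \<Lambda>"
    and disc: "\<delta> > 0" "\<And>w. w \<in> \<Lambda> \<Longrightarrow> cmod w < \<delta> \<Longrightarrow> w = 0"
  shows "finite {w \<in> \<Lambda>. cmod w \<le> B}"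
proof -
  have "uniform_discrete {w \<in> \<Lambda>. cmod w \<le> B}"
    unfolding uniform_discrete_def
  proof (intro exI[of _ \<delta>] conjI ballI impI disc(1))
    fix v w assume "v \<in> {w \<in> \<Lambda>. cmod w \<le> B}" "w \<in> {w \<in> \<Lambda>. cmod w \<le> B}" "dist v w < \<delta>"
    then show "v = w" using disc(2)[of "v - w"] diff by (simp add: dist_norm)
  qed
  moreover have "bounded {w \<in> \<Lambda>. cmod w \<le> B}" by (auto simp: bounded_iff)
  ultimately show ?thesis using uniform_discrete_finite_iff by blast
qed

lemma finite_exists_minimal:
  fixes f :: "'a \<Rightarrow> real"
  assumes "finite A" "A \<noteq> {}"
  shows "\<exists>w\<in>A. \<forall>v\<in>A. f w \<le> f v"
proof -
  have "Min (f ` A) \<in> f ` A" using assms by simp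
  then obtain w where "w \<in> A" "f w = Min (f ` A)" by auto
  moreover have "Min (f ` A) \<le> f v" if "v \<in> A" for v using that assms by simp
  ultimately show ?thesis by metis
qed

text \<open>Lattice reduction: \<open>w1\<close> is a shortest nonzero element, and
  \<open>w2\<close> has the least positive height \<open>Im (w / w1)\<close>. Subtracting multiples
  of both leaves an element of height 0 whose real part over \<open>w1\<close> lies in
  \<open>[0, 1)\<close>; it is shorter than \<open>w1\<close>, hence 0.\<close>

lemma discrete_subgroup_lattice:
  assumes zero: "0 \<in> \<Lambda>" and diff: "\<And>v w. v \<in> \<Lambda> \<Longrightarrow> w \<in> \<Lambda> \<Longrightarrow> v - w \<in> \<Lambda>"
    and disc: "\<delta> > 0" "\<And>w. w \<in> \<Lambda> \<Longrightarrow> cmod w < \<delta> \<Longrightarrow> w = 0"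
    and not_line: "\<And>e. cmod e = 1 \<Longrightarrow> \<not> \<Lambda> \<subseteq> range (\<lambda>x. of_real x * e)"
  shows "lattice_rank2 \<Lambda>"
proof -
  note fin = discrete_subgroup_finite[OF diff disc]
  have minus: "- w \<in> \<Lambda>" if "w \<in> \<Lambda>" for w using diff[OF zero that] by simp
  have add: "v + w \<in> \<Lambda>" if "v \<in> \<Lambda>" "w \<in> \<Lambda>" for v w using diff[OF that(1) minus[OF that(2)]] by simp
  have nat_mult: "of_nat n * w \<in> \<Lambda>" if "w \<in> \<Lambda>" for n w
    by (induction n) (auto simp: zero that distrib_right intro!: add)
  have int_mult: "of_int n * w \<in> \<Lambda>" if "w \<in> \<Lambda>" for n w
  proof (cases n)
    case (nonneg k) then show ?thesis using nat_mult[OF that, of k] by simp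
  next
    case (neg k)
    then have "of_int n * w = - (of_nat (Suc k) * w)" by (simp only: of_int_minus of_int_of_nat_eq mult_minus_left)
    then show ?thesis using minus[OF nat_mult[OF that, of "Suc k"]] by (simp only:)
  qed
  \<comment> \<open>The trivial group also lies on a line, so \<open>not_line\<close> provides a
    nonzero element.\<close>
  obtain w0 where w0: "w0 \<in> \<Lambda>" "w0 \<noteq> 0" using not_line[of 1] zero by fastforce
  define A where "A = {w \<in> \<Lambda>. cmod w \<le> cmod w0} - {0}"
  have "finite A" "A \<noteq> {}" using fin w0 by (auto simp: A_def)
  then obtain w1 where w1: "w1 \<in> A" "\<And>w. w \<in> A \<Longrightarrow> cmod w1 \<le> cmod w"
    using finite_exists_minimal[of A cmod] by blast
  have w1\<Lambda>: "w1 \<in> \<Lambda>" "w1 \<noteq> 0" using w1(1) by (auto simp: A_def)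
  have w1_min: "w = 0" if "w \<in> \<Lambda>" "cmod w < cmod w1" for w
  proof (rule ccontr)
    assume "w \<noteq> 0"
    then have "w \<in> A" using that w1(1) by (auto simp: A_def)
    with w1(2) that(2) show False by fastforce
  qed
  have "\<exists>w\<in>\<Lambda>. Im (w / w1) \<noteq> 0"
  proof (rule ccontr)
    assume "\<not> ?thesis"
    then have re: "w = of_real (Re (w / w1)) * w1" if "w \<in> \<Lambda>" for w
    proof -
      have "w / w1 = of_real (Re (w / w1))" using that \<open>\<not> (\<exists>w\<in>\<Lambda>. Im (w / w1) \<noteq> 0)\<close> by (intro complex_eqI) auto
      then show ?thesis using w1\<Lambda>(2) by (metis nonzero_divide_eq_eq)
    qed
    define e where "e = w1 / of_real (cmod w1)"
    have "cmod e = 1" using w1\<Lambda>(2) by (simp add: e_def norm_divide)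
    moreover have "\<Lambda> \<subseteq> range (\<lambda>x. of_real x * e)"
    proof
      fix w assume "w \<in> \<Lambda>"
      then have "w = of_real (Re (w / w1) * cmod w1) * e"
        using re w1\<Lambda>(2) by (simp add: e_def)
      then show "w \<in> range (\<lambda>x. of_real x * e)" by blast
    qed
    ultimately show False using not_line by blast
  qed
  then obtain l0 where l0: "l0 \<in> \<Lambda>" "Im (l0 / w1) > 0"
  proof -
    obtain w where w: "w \<in> \<Lambda>" "Im (w / w1) \<noteq> 0" using \<open>\<exists>w\<in>\<Lambda>. Im (w / w1) \<noteq> 0\<close> by blast
    show thesis
    proof (cases "Im (w / w1) > 0")
      case False
      then show thesis using w that[of "- w"] minus by simp
    qed (use w that in blast)
  qed
  define h0 where "h0 = Im (l0 / w1)"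
  \<comment> \<open>Normalising the real part to \<open>[0, 1)\<close> and capping the height at
    that of a known element leaves finitely many candidates for \<open>w2\<close>.\<close>
  define F where "F = {w \<in> \<Lambda>. 0 \<le> Re (w / w1) \<and> Re (w / w1) < 1 \<and> 0 < Im (w / w1) \<and> Im (w / w1) \<le> h0}"
  have "F \<subseteq> {w \<in> \<Lambda>. cmod w \<le> (1 + h0) * cmod w1}"
  proof
    fix w assume w: "w \<in> F"
    then have "cmod (w / w1) \<le> 1 + h0" using cmod_le[of "w / w1"] by (auto simp: F_def)
    then have "cmod w \<le> (1 + h0) * cmod w1" using w1\<Lambda>(2) by (simp add: norm_divide pos_divide_le_eq)
    then show "w \<in> {w \<in> \<Lambda>. cmod w \<le> (1 + h0) * cmod w1}" using w by (simp add: F_def)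
  qed
  then have "finite F" using fin finite_subset by blast
  define red where "red w = w - of_int \<lfloor>Re (w / w1)\<rfloor> * w1" for w
  have red: "red w \<in> \<Lambda>" "0 \<le> Re (red w / w1)" "Re (red w / w1) < 1" "Im (red w / w1) = Im (w / w1)" if "w \<in> \<Lambda>" for w
  proof -
    have "red w / w1 = w / w1 - of_int \<lfloor>Re (w / w1)\<rfloor>" using w1\<Lambda>(2) by (simp add: red_def diff_divide_distrib)
    then have "Re (red w / w1) = Re (w / w1) - of_int \<lfloor>Re (w / w1)\<rfloor>" and im: "Im (red w / w1) = Im (w / w1)"
      by (simp_all only: minus_complex.sel complex_Re_of_int complex_Im_of_int diff_zero)
    then show "0 \<le> Re (red w / w1)" "Re (red w / w1) < 1" by linarith+
    show "Im (red w / w1) = Im (w / w1)" by (fact im)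
    show "red w \<in> \<Lambda>" unfolding red_def by (intro diff int_mult that w1\<Lambda>)
  qed
  have "red l0 \<in> F" using red[OF l0(1)] l0(2) by (simp add: F_def h0_def)
  with \<open>finite F\<close> obtain w2 where w2: "w2 \<in> F" "\<And>w. w \<in> F \<Longrightarrow> Im (w2 / w1) \<le> Im (w / w1)"
    using finite_exists_minimal[of F "\<lambda>w. Im (w / w1)"] by blast
  define h where "h = Im (w2 / w1)"
  have h: "h > 0" "h \<le> h0" and w2\<Lambda>: "w2 \<in> \<Lambda>" using w2(1) by (auto simp: F_def h_def)
  have decomp: "\<exists>m n. w = of_int m * w1 + of_int n * w2" if w: "w \<in> \<Lambda>" for w
  proof -
    define n where "n = \<lfloor>Im (w / w1) / h\<rfloor>"
    define w' where "w' = w - of_int n * w2"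
    have w': "w' \<in> \<Lambda>" unfolding w'_def by (intro diff int_mult w w2\<Lambda>)
    have "Im (w' / w1) = Im (w / w1) - of_int n * h"
      by (simp add: w'_def diff_divide_distrib h_def flip: times_divide_eq_right)
    moreover have "of_int n * h \<le> Im (w / w1)" "Im (w / w1) < (of_int n + 1) * h"
    proof -
      have "of_int n \<le> Im (w / w1) / h" "Im (w / w1) / h < of_int n + 1" unfolding n_def by linarith+
      then show "of_int n * h \<le> Im (w / w1)" "Im (w / w1) < (of_int n + 1) * h"
        using h(1) by (simp_all add: pos_le_divide_eq pos_divide_less_eq)
    qed
    ultimately have im: "0 \<le> Im (w' / w1)" "Im (w' / w1) < h" by (simp_all add: algebra_simps)
    note r = red[OF w']
    have "Im (red w' / w1) = 0"
    proof (rule ccontr)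
      assume "Im (red w' / w1) \<noteq> 0"
      then have "red w' \<in> F" using r im h by (auto simp: F_def)
      from w2(2)[OF this] show False using r(4) im by (simp add: h_def)
    qed
    then have "cmod (red w' / w1) < 1" using r(2,3) by (simp add: cmod_eq_Re)
    then have "cmod (red w') < cmod w1" using w1\<Lambda>(2) by (simp add: norm_divide)
    then have "red w' = 0" using w1_min r(1) by blast
    then have "w = of_int \<lfloor>Re (w' / w1)\<rfloor> * w1 + of_int n * w2" by (simp add: red_def w'_def)
    then show ?thesis by blast
  qed
  have notspan: "w2 \<notin> span {w1}"
  proof
    assume "w2 \<in> span {w1}"
    then obtain k where "w2 = k *\<^sub>R w1" by (auto simp: span_singleton)
    then have "w2 / w1 = of_real k" using w1\<Lambda>(2) by (simp add: scaleR_conv_of_real)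
    then show False using h(1) by (simp add: h_def)
  qed
  have "w1 \<noteq> w2" using notspan span_base[of w2 "{w1}"] by auto
  moreover have "independent {w1, w2}"
  proof -
    have "independent {w1}" using w1\<Lambda>(2) by simp
    then have "independent (insert w2 {w1})" using notspan by (rule independent_insertI[rotated])
    then show ?thesis by (simp add: insert_commute)
  qed
  moreover have "\<Lambda> = {of_int m * w1 + of_int n * w2 | m n. True}"
    using decomp by (auto intro!: add int_mult w1\<Lambda> w2\<Lambda>)
  ultimately show ?thesis unfolding lattice_rank2_def by blast
qed

subsection \<open>Sphere-valued holomorphic maps\<close>

text \<open>The Hausdorff property of the sphere, expressed in centred coordinates.\<close>

lemma sphere_param_separated:
  assumes "a \<noteq> b"
  shows "\<exists>e>0. \<forall>w w'. cmod w < e \<longrightarrow> cmod w' < e \<longrightarrow> sphere_param a w \<noteq> sphere_param b w'"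
proof -
  \<comment> \<open>The radius is chosen so that \<open>|1 / w| > |b| + 2\<close>, while
    \<open>|b + w'|\<close> stays below \<open>|b| + 2\<close>.\<close>
  have None_Some: "sphere_param None w \<noteq> sphere_param (Some b) w'"
    if "cmod w < 1 / (cmod b + 2)" "cmod w' < 1 / (cmod b + 2)" for b w w'
  proof
    assume eq: "sphere_param None w = sphere_param (Some b) w'"
    then have nz: "w \<noteq> 0" and w: "1 / w = b + w'" by (auto split: if_splits)
    have pos: "cmod b + 2 > 0" by (simp add: add_nonneg_pos)
    have "1 / (cmod b + 2) \<le> 1" using pos by (simp add: divide_le_eq)
    then have "cmod (b + w') < cmod b + 2" using that(2) norm_triangle_ineq[of b w'] by linarith
    moreover have "cmod b + 2 < 1 / cmod w" using that(1) nz pos by (simp add: pos_less_divide_eq mult.commute)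
    moreover have "1 / cmod w = cmod (b + w')" using w by (metis norm_divide norm_one)
    ultimately show False by simp
  qed
  show ?thesis
  proof (cases a)
    case None
    with assms obtain b' where "b = Some b'" by (cases b) auto
    with None None_Some[of _ b'] show ?thesis
      by (intro exI[of _ "1 / (cmod b' + 2)"]) (auto simp: add_nonneg_pos)
  next
    case (Some a')
    show ?thesis
    proof (cases b)
      case None
      show ?thesis unfolding Some None
      proof (intro exI[of _ "1 / (cmod a' + 2)"] conjI allI impI)
        fix w w' assume "cmod w < 1 / (cmod a' + 2)" "cmod w' < 1 / (cmod a' + 2)"
        from None_Some[OF this(2,1)] show "sphere_param (Some a') w \<noteq> sphere_param None w'" by (rule not_sym)
      qed (simp add: add_nonneg_pos)
    next
      case (Some b')
      have ab: "a' \<noteq> b'" using assms \<open>a = Some a'\<close> Some by simp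
      have "a' + w \<noteq> b' + w'" if "cmod w < cmod (a' - b') / 2" "cmod w' < cmod (a' - b') / 2" for w w'
      proof
        assume "a' + w = b' + w'"
        then have "a' - b' = w' - w" by (simp add: algebra_simps)
        then have "cmod (a' - b') \<le> cmod w' + cmod w" using norm_triangle_ineq4[of w' w] by simp
        with that show False by linarith
      qed
      with ab \<open>a = Some a'\<close> Some show ?thesis
        by (intro exI[of _ "cmod (a' - b') / 2"]) auto
    qed
  qed
qed

text \<open>The set where the germs agree is open and closed. At a limit point the values agree by
  separation; then both maps use the same centred coordinate, and the difference of their
  expressions has a non-isolated zero.\<close>

lemma sphere_identity:
  assumes h1: "\<And>z. sphere_analytic_at h1 z" and h2: "\<And>z. sphere_analytic_at h2 z"
    and ev: "\<forall>\<^sub>F t in nhds z0. h1 t = h2 t"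
  shows "h1 z = h2 z"
proof -
  define A where "A = {z. \<forall>\<^sub>F t in nhds z. h1 t = h2 t}"
  have Aeq: "h1 t = h2 t" if "t \<in> A" for t
    using eventually_nhds_x_imp_x[of "\<lambda>t. h1 t = h2 t" t] that unfolding A_def by blast
  have "open A"
  proof (subst open_subopen, intro ballI)
    fix z assume "z \<in> A"
    then have "\<forall>\<^sub>F t in nhds z. \<forall>\<^sub>F s in nhds t. h1 s = h2 s"
      unfolding A_def mem_Collect_eq by (subst eventually_eventually)
    then have "\<forall>\<^sub>F t in nhds z. t \<in> A" by (simp only: A_def mem_Collect_eq)
    then show "\<exists>T. open T \<and> z \<in> T \<and> T \<subseteq> A" unfolding eventually_nhds by blast
  qed
  moreover have "closed A"
    unfolding closed_limpt
  proof (intro allI impI, rule ccontr)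
    fix z assume lim: "z islimpt A" and "z \<notin> A"
    have freq: "\<not> (\<forall>\<^sub>F t in at z. t \<notin> A)" using lim by (simp add: islimpt_iff_eventually)
    obtain g1 where g1: "g1 analytic_on {z}" "g1 z = 0" "\<forall>\<^sub>F x in nhds z. h1 x = sphere_param (h1 z) (g1 x)"
      using sphere_analytic_atE[OF h1] .
    obtain g2 where g2: "g2 analytic_on {z}" "g2 z = 0" "\<forall>\<^sub>F x in nhds z. h2 x = sphere_param (h2 z) (g2 x)"
      using sphere_analytic_atE[OF h2] .
    have small: "\<forall>\<^sub>F t in nhds z. cmod (g t) < e" if "g analytic_on {z}" "g z = 0" "e > 0" for g e
    proof -
      have "\<forall>\<^sub>F w in nhds (g z). w \<in> ball 0 e" using that by (intro eventually_nhds_in_open) auto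
      from eventually_compose_analytic[OF this that(1)] show ?thesis by simp
    qed
    have "h1 z = h2 z"
    proof (rule ccontr)
      assume "h1 z \<noteq> h2 z"
      from sphere_param_separated[OF this] obtain e where e: "e > 0"
        "\<And>w w'. cmod w < e \<Longrightarrow> cmod w' < e \<Longrightarrow> sphere_param (h1 z) w \<noteq> sphere_param (h2 z) w'" by blast
      have "\<forall>\<^sub>F t in nhds z. t \<notin> A"
        using small[OF g1(1,2) e(1)] small[OF g2(1,2) e(1)] g1(3) g2(3)
        by eventually_elim (metis e(2) Aeq)
      then have "\<forall>\<^sub>F t in at z. t \<notin> A" by (simp add: eventually_nhds_conv_at)
      with freq show False ..
    qed
    have "(\<lambda>t. g1 t - g2 t) analytic_on {z}" by (intro analytic_intros g1 g2)
    moreover have "\<not> (\<forall>\<^sub>F t in nhds z. g1 t - g2 t = 0)"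
    proof
      assume "\<forall>\<^sub>F t in nhds z. g1 t - g2 t = 0"
      with g1(3) g2(3) have "\<forall>\<^sub>F t in nhds z. h1 t = h2 t"
        by eventually_elim (simp add: \<open>h1 z = h2 z\<close>)
      with \<open>z \<notin> A\<close> show False by (simp add: A_def)
    qed
    ultimately have "\<forall>\<^sub>F t in at z. g1 t - g2 t \<noteq> 0" by (rule analytic_isolated_zero)
    moreover have "\<forall>\<^sub>F t in at z. h1 t = sphere_param (h1 z) (g1 t)" "\<forall>\<^sub>F t in at z. h2 t = sphere_param (h2 z) (g2 t)"
      using g1(3) g2(3) by (simp_all add: eventually_nhds_conv_at)
    ultimately have "\<forall>\<^sub>F t in at z. t \<notin> A"
    proof eventually_elim
      case (elim t)
      have "h1 t \<noteq> h2 t"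
        using elim \<open>h1 z = h2 z\<close> inj_sphere_param[of "h2 z"] by (auto simp: inj_eq)
      then show ?case using Aeq by blast
    qed
    with freq show False ..
  qed
  moreover have "z0 \<in> A" using ev by (simp add: A_def)
  ultimately have "A = UNIV" using clopen[of A] by auto
  then have "z \<in> A" by simp
  then show ?thesis by (rule Aeq)
qed

lemma sphere_analytic_at_affine:
  assumes "sphere_analytic_at h (a * z + b)"
  shows "sphere_analytic_at (\<lambda>s. h (a * s + b)) z"
proof -
  obtain g where g: "g analytic_on {a * z + b}" "\<forall>\<^sub>F x in nhds (a * z + b). h x = sphere_param (h (a * z + b)) (g x)"
    using assms by (auto simp: sphere_analytic_at_def)
  have an: "(\<lambda>s. a * s + b) analytic_on {z}" by (intro analytic_intros)
  have "(\<lambda>s. g (a * s + b)) analytic_on {z}"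
    using analytic_on_compose[OF an, of g] g(1) by (simp add: o_def)
  moreover have "\<forall>\<^sub>F s in nhds z. h (a * s + b) = sphere_param (h (a * z + b)) (g (a * s + b))"
    by (rule eventually_compose_analytic[OF g(2) an])
  ultimately show ?thesis unfolding sphere_analytic_at_def by blast
qed


subsection \<open>Periods\<close>

locale flat_cover = unimodular_eigen_differential +
  fixes \<phi> :: "complex \<Rightarrow> riemann_sphere"
  assumes \<phi>_analytic: "\<And>z. sphere_analytic_at \<phi> z"
    and \<phi>_sol: "\<And>z. \<forall>\<^sub>F t in at z. pt_sol 1 \<phi> t"
begin

text \<open>Here \<open>\<phi>\<close> is a local isometry from the Euclidean metric to the flat
  metric \<open>|q|^(1/2) |dz|\<close>. The remaining points are isolated.\<close>

definition U :: "complex set" where "U = {z. pt_sol 1 \<phi> z}"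

definition g :: "complex \<Rightarrow> complex" where "g z = the (\<phi> z)"

lemma U_facts:
  assumes "z \<in> U"
  shows "g analytic_on {z}" "\<phi> z = Some (g z)" "poly N (g z) \<noteq> 0" "poly M (g z) \<noteq> 0"
    "qd (g z) * (deriv g z)\<^sup>2 = 1" "deriv g z \<noteq> 0"
proof -
  obtain g' where g': "g' analytic_on {z}" "\<forall>\<^sub>F s in nhds z. \<phi> s = Some (g' s)"
     "poly N (g' z) \<noteq> 0" "poly M (g' z) \<noteq> 0" "qd (g' z) * (deriv g' z)\<^sup>2 = 1"
    using assms by (auto simp: U_def pt_sol_def)
  have ev: "\<forall>\<^sub>F s in nhds z. g s = g' s" using g'(2) by eventually_elim (simp add: g_def)
  have e: "g z = g' z" using eventually_nhds_x_imp_x[OF ev] .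
  have d: "deriv g z = deriv g' z" using ev by (intro deriv_cong_ev) auto
  show "g analytic_on {z}" using g'(1) ev analytic_at_cong by blast
  show "\<phi> z = Some (g z)" using eventually_nhds_x_imp_x[OF g'(2)] e by simp
  show "poly N (g z) \<noteq> 0" "poly M (g z) \<noteq> 0" "qd (g z) * (deriv g z)\<^sup>2 = 1" using g' e d by auto
  then show "deriv g z \<noteq> 0" by auto
qed

lemma open_U: "open U"
proof (subst open_subopen, intro ballI)
  fix z assume "z \<in> U"
  moreover have "\<forall>\<^sub>F t in at z. t \<in> U" using \<phi>_sol[of z] by (simp add: U_def)
  ultimately have "\<forall>\<^sub>F t in nhds z. t \<in> U" by (simp add: eventually_nhds_conv_at)
  then show "\<exists>T. open T \<and> z \<in> T \<and> T \<subseteq> U" unfolding eventually_nhds by blast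
qed

lemma eventually_U: "z \<in> U \<Longrightarrow> \<forall>\<^sub>F t in nhds z. t \<in> U"
  using open_U by (rule eventually_nhds_in_open)

lemma countable_compl_U: "countable (- U)"
proof -
  have "finite (cball 0 (of_nat n) \<inter> - U)" for n
  proof (rule finite_not_islimpt_in_compact)
    fix z :: complex
    show "\<not> z islimpt - U"
      using \<phi>_sol[of z] by (simp add: islimpt_iff_eventually U_def)
  qed simp
  then have "countable (\<Union>n. cball 0 (of_nat n) \<inter> - U)" by (intro countable_UN) (auto intro: countable_finite)
  moreover have "- U \<subseteq> (\<Union>n. cball 0 (of_nat n) \<inter> - U)"
    using real_arch_simple by (auto simp: mem_cball_0)
  ultimately show ?thesis using countable_subset by blast
qed

lemma g_holomorphic: "g holomorphic_on U"
  using U_facts(1) analytic_imp_holomorphic analytic_on_analytic_at by blast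

lemma U_nonempty: "\<exists>z. z \<in> U"
proof (rule ccontr)
  assume "\<not> ?thesis"
  then have "- U = UNIV" by auto
  then show False using countable_compl_U uncountable_UNIV_complex by simp
qed

text \<open>The flat coordinate \<open>u = \<integral>\<surd>q\<close> shows that a point of the sphere determines \<open>\<phi>\<close> up to a
  translation or a half-turn of the plane.\<close>

lemma same_fibre:
  assumes z: "z1 \<in> U" "z2 \<in> U" and eq: "\<phi> z1 = \<phi> z2"
  shows "(\<forall>t. \<phi> (z2 + t) = \<phi> (z1 + t)) \<or> (\<forall>t. \<phi> (z2 + t) = \<phi> (z1 - t))"
proof -
  define y where "y = g z1"
  have y: "g z1 = y" "g z2 = y" using eq by (auto simp: y_def g_def)
  have nz: "poly N y \<noteq> 0" "poly M y \<noteq> 0" using U_facts(3,4)[OF z(1)] y by auto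
  have "qd y * (deriv g z1)\<^sup>2 = 1" "qd y * (deriv g z2)\<^sup>2 = 1"
    using U_facts(5)[OF z(1)] U_facts(5)[OF z(2)] y by auto
  then have "qd y * (deriv g z2)\<^sup>2 = qd y * (deriv g z1)\<^sup>2" by (simp only:)
  then have "(deriv g z2)\<^sup>2 = (deriv g z1)\<^sup>2" using nz by simp
  \<comment> \<open>The two derivatives are square roots of the same number \<open>1 / q(y)\<close>;
    the sign \<open>s\<close> decides between translation and half-turn.\<close>
  then obtain s :: complex where s: "s = 1 \<or> s = -1" "deriv g z2 = s * deriv g z1"
    by (metis power2_eq_iff mult_1 mult_minus1)
  have qan: "qd analytic_on {y}" using nz by (intro analytic_intros poly_analytic) auto
  obtain \<sigma> where \<sigma>: "\<sigma> analytic_on {y}" "\<forall>\<^sub>F w in nhds y. (\<sigma> w)\<^sup>2 = qd w"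
    using sqrt_germ[OF qan] nz by auto
  obtain u where u: "u analytic_on {y}" "u y = 0" "\<forall>\<^sub>F w in nhds y. deriv u w = \<sigma> w"
    using primitive_germ[OF \<sigma>(1)] by blast
  have \<sigma>y: "\<sigma> y \<noteq> 0" using eventually_nhds_x_imp_x[OF \<sigma>(2)] nz by auto
  have duy: "deriv u y \<noteq> 0" using eventually_nhds_x_imp_x[OF u(3)] \<sigma>y by simp
  define A where "A a z t = g (z + a * t)" for a z t :: complex
  have shift: "(\<lambda>t. z + a * t) analytic_on {0}" for z a :: complex by (intro analytic_intros)
  \<comment> \<open>Along \<open>z + a t\<close> the flat coordinate has a derivative of square 1,
    that is, a sign. The direction \<open>s\<close> at \<open>z1\<close> is chosen to match that
    sign with the one at \<open>z2\<close>.\<close>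
  have main: "(\<lambda>t. u (A a z t)) analytic_on {0} \<and> A a z analytic_on {0} \<and>
      (\<lambda>t. \<sigma> (A a z t) * (deriv g (z + a * t) * a)) analytic_on {0} \<and>
      (\<forall>\<^sub>F t in nhds 0. deriv (\<lambda>t. u (A a z t)) t = \<sigma> (A a z t) * (deriv g (z + a * t) * a)) \<and>
      (\<forall>\<^sub>F t in nhds 0. (\<sigma> (A a z t) * (deriv g (z + a * t) * a))\<^sup>2 = 1) \<and>
      (\<forall>\<^sub>F t in nhds 0. z + a * t \<in> U)"
    if z: "z \<in> U" "g z = y" and a: "a\<^sup>2 = 1" for z a
  proof -
    have A: "A a z analytic_on {0}"
      using analytic_on_compose[OF shift[of z a], of g] U_facts(1)[OF z(1)] by (simp add: o_def A_def[abs_def])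
    have A0: "A a z 0 = y" using z by (simp add: A_def)
    have uA: "(\<lambda>t. u (A a z t)) analytic_on {0}"
      using analytic_on_compose[OF A, of u] u(1) A0 by (simp add: o_def)
    have \<sigma>A: "(\<lambda>t. \<sigma> (A a z t)) analytic_on {0}"
      using analytic_on_compose[OF A, of \<sigma>] \<sigma>(1) A0 by (simp add: o_def)
    have "deriv g analytic_on {z}" using U_facts(1)[OF z(1)] by (rule analytic_deriv)
    then have dg: "(\<lambda>t. deriv g (z + a * t)) analytic_on {0}"
      using analytic_on_compose[OF shift[of z a], of "deriv g"] by (simp add: o_def)
    have "\<forall>\<^sub>F w in nhds (z + a * 0). w \<in> U" using eventually_U[OF z(1)] by simp
    from eventually_compose_analytic[OF this shift[of z a]]
    have evU: "\<forall>\<^sub>F t in nhds 0. z + a * t \<in> U" .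
    have e1: "\<forall>\<^sub>F t in nhds 0. (\<sigma> (A a z t))\<^sup>2 = qd (A a z t)"
      by (rule eventually_compose_analytic[OF _ A]) (simp only: A0 \<sigma>(2))
    have e2: "\<forall>\<^sub>F t in nhds 0. deriv u (A a z t) = \<sigma> (A a z t)"
      by (rule eventually_compose_analytic[OF _ A]) (simp only: A0 u(3))
    have e3: "\<forall>\<^sub>F t in nhds 0. u analytic_on {A a z t}"
      by (rule eventually_compose_analytic[OF _ A]) (simp only: A0 eventually_analytic_at[OF u(1)])
    have "\<forall>\<^sub>F t in nhds 0. deriv (\<lambda>t. u (A a z t)) t = \<sigma> (A a z t) * (deriv g (z + a * t) * a)"
      using evU e2 e3
    proof eventually_elim
      case (elim t)
      have "(g has_field_derivative deriv g (z + a * t)) (at (z + a * t))"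
        using U_facts(1)[OF elim(1)] by (metis analytic_on_imp_differentiable_at DERIV_deriv_iff_field_differentiable singletonI)
      then have "(A a z has_field_derivative deriv g (z + a * t) * a) (at t)"
        unfolding A_def[abs_def] by (rule DERIV_chain2) (auto intro!: derivative_eq_intros)
      moreover have "(u has_field_derivative deriv u (A a z t)) (at (A a z t))"
        using elim(3) by (metis analytic_on_imp_differentiable_at DERIV_deriv_iff_field_differentiable singletonI)
      ultimately have "((\<lambda>t. u (A a z t)) has_field_derivative deriv u (A a z t) * (deriv g (z + a * t) * a)) (at t)"
        by (rule DERIV_chain2[rotated])
      then show ?case using elim(2) by (simp add: DERIV_imp_deriv)
    qed
    moreover have "\<forall>\<^sub>F t in nhds 0. (\<sigma> (A a z t) * (deriv g (z + a * t) * a))\<^sup>2 = 1"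
      using evU e1
    proof eventually_elim
      case (elim t)
      have "(\<sigma> (A a z t) * (deriv g (z + a * t) * a))\<^sup>2 = (\<sigma> (A a z t))\<^sup>2 * (deriv g (z + a * t))\<^sup>2"
        using a by (simp add: power_mult_distrib)
      also have "\<dots> = 1" using elim(2) U_facts(5)[OF elim(1)] by (simp add: A_def)
      finally show ?case .
    qed
    ultimately show ?thesis using A uA evU by (auto intro!: analytic_intros \<sigma>A dg)
  qed
  have s2: "s\<^sup>2 = 1" using s(1) by auto
  note m1 = main[OF z(1) y(1) s2] and m2 = main[OF z(2) y(2), of 1, simplified]
  have an: "A s z1 analytic_on {0}" "A 1 z2 analytic_on {0}" using m1 m2 by blast+
  have uan: "(\<lambda>t. u (A s z1 t)) analytic_on {0}" "(\<lambda>t. u (A 1 z2 t)) analytic_on {0}" using m1 m2 by blast+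
  have dan: "(\<lambda>t. \<sigma> (A s z1 t) * (deriv g (z1 + s * t) * s)) analytic_on {0}"
    "(\<lambda>t. \<sigma> (A 1 z2 t) * deriv g (z2 + t)) analytic_on {0}" using m1 m2 by blast+
  have d: "\<forall>\<^sub>F t in nhds 0. deriv (\<lambda>t. u (A s z1 t)) t = \<sigma> (A s z1 t) * (deriv g (z1 + s * t) * s)"
    "\<forall>\<^sub>F t in nhds 0. deriv (\<lambda>t. u (A 1 z2 t)) t = \<sigma> (A 1 z2 t) * deriv g (z2 + t)" using m1 m2 by blast+
  have sq: "\<forall>\<^sub>F t in nhds 0. (\<sigma> (A s z1 t) * (deriv g (z1 + s * t) * s))\<^sup>2 = 1"
    "\<forall>\<^sub>F t in nhds 0. (\<sigma> (A 1 z2 t) * deriv g (z2 + t))\<^sup>2 = 1" using m1 m2 by blast+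
  have evU: "\<forall>\<^sub>F t in nhds 0. z1 + s * t \<in> U" "\<forall>\<^sub>F t in nhds 0. z2 + t \<in> U" using m1 m2 by blast+
  have A0: "A s z1 0 = y" "A 1 z2 0 = y" using y by (simp_all add: A_def)
  have "\<forall>\<^sub>F t in nhds 0. \<sigma> (A 1 z2 t) * deriv g (z2 + t) = \<sigma> (A s z1 t) * (deriv g (z1 + s * t) * s)"
  proof (rule square_germ_unique)
    show "\<forall>\<^sub>F t in nhds 0. (\<sigma> (A 1 z2 t) * deriv g (z2 + t))\<^sup>2 = (\<sigma> (A s z1 t) * (deriv g (z1 + s * t) * s))\<^sup>2"
      using sq by eventually_elim (simp only:)
    show "isCont (\<lambda>t. \<sigma> (A 1 z2 t) * deriv g (z2 + t)) 0" "isCont (\<lambda>t. \<sigma> (A s z1 t) * (deriv g (z1 + s * t) * s)) 0"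
      using dan by (auto intro: analytic_at_imp_isCont)
    show "\<sigma> (A 1 z2 0) * deriv g (z2 + 0) = \<sigma> (A s z1 0) * (deriv g (z1 + s * 0) * s)"
      using s(2) by (simp add: A0 mult.commute)
    show "\<sigma> (A 1 z2 0) * deriv g (z2 + 0) \<noteq> 0" using \<sigma>y U_facts(6)[OF z(2)] by (simp add: A0)
  qed
  with d have dd: "\<forall>\<^sub>F t in nhds 0. deriv (\<lambda>t. u (A 1 z2 t)) t = deriv (\<lambda>t. u (A s z1 t)) t"
    by eventually_elim (simp only:)
  have uu: "\<forall>\<^sub>F t in nhds 0. u (A 1 z2 t) = u (A s z1 t)"
    by (rule holomorphic_germ_eq[OF uan(2,1) dd]) (simp only: A0)
  \<comment> \<open>Near \<open>y\<close> the coordinate \<open>u\<close> is injective, so equal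
    flat coordinates mean equal points; the identity theorem then removes the restriction to small
    \<open>t\<close>.\<close>
  obtain e where e: "e > 0" "inj_on u (ball y e)"
    using local_inverse[OF u(1) duy] by metis
  have "\<forall>\<^sub>F w in nhds y. w \<in> ball y e" using e(1) by (intro eventually_nhds_in_open) auto
  then have near: "\<forall>\<^sub>F t in nhds 0. A a z t \<in> ball y e" if "A a z analytic_on {0}" "A a z 0 = y" for a z
    by (intro eventually_compose_analytic[OF _ that(1)]) (simp only: that(2))
  have "\<forall>\<^sub>F t in nhds 0. \<phi> (1 * t + z2) = \<phi> (s * t + z1)"
    using uu near[OF an(2) A0(2)] near[OF an(1) A0(1)] evU
  proof eventually_elim
    case (elim t)
    then have "A 1 z2 t = A s z1 t" using e(2) by (auto simp: inj_on_def)
    then have "g (z2 + t) = g (z1 + s * t)" by (simp add: A_def)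
    then show ?case using U_facts(2)[OF elim(4)] U_facts(2)[OF elim(5)] by (simp add: add.commute)
  qed
  then have "\<phi> (1 * t + z2) = \<phi> (s * t + z1)" for t
    by (rule sphere_identity[rotated 2]) (intro sphere_analytic_at_affine \<phi>_analytic)+
  then show ?thesis using s(1) by (auto simp: add.commute)
qed

definition \<Lambda> :: "complex set" where "\<Lambda> = {w. \<forall>z. \<phi> (z + w) = \<phi> z}"

lemma \<Lambda>_zero: "0 \<in> \<Lambda>" by (simp add: \<Lambda>_def)

lemma \<Lambda>_diff: "v \<in> \<Lambda> \<Longrightarrow> w \<in> \<Lambda> \<Longrightarrow> v - w \<in> \<Lambda>"
  unfolding \<Lambda>_def by clarsimp (metis add.commute add_diff_cancel_left' diff_add_cancel add_diff_eq)

lemma \<Lambda>_discrete: "\<exists>\<delta>>0. \<forall>w\<in>\<Lambda>. cmod w < \<delta> \<longrightarrow> w = 0"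
proof -
  obtain z where z: "z \<in> U" using U_nonempty by blast
  obtain r where r: "r > 0" "ball z r \<subseteq> U" "inj_on g (ball z r)"
    using has_complex_derivative_locally_injective[OF g_holomorphic z open_U U_facts(6)[OF z]] by metis
  have "w = 0" if w: "w \<in> \<Lambda>" "cmod w < r" for w
  proof -
    have "z + w \<in> ball z r" "z \<in> ball z r" using w(2) r(1) by (auto simp: dist_norm)
    moreover have "g (z + w) = g z" using w(1) by (simp add: \<Lambda>_def g_def)
    ultimately have "z + w = z" using inj_onD[OF r(3)] by blast
    then show ?thesis by simp
  qed
  with r(1) show ?thesis by blast
qed


end

section \<open>Area and rank of the group of periods\<close>

context flat_cover
begin

lemma \<Lambda>_iff: "w \<in> \<Lambda> \<longleftrightarrow> (\<forall>z. \<phi> (z + w) = \<phi> z)" by (simp add: \<Lambda>_def)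

lemma translation_period:
  assumes "\<And>t. \<phi> (x' + t) = \<phi> (x + t)"
  shows "x' - x \<in> \<Lambda>"
  unfolding \<Lambda>_iff
proof
  fix z show "\<phi> (z + (x' - x)) = \<phi> z" using assms[of "z - x"] by (simp add: algebra_simps)
qed

text \<open>Incongruent points of a fibre are related by half-turns, and two half-turns compose to a
  translation: \<open>\<phi> (x3 + t) = \<phi> (x1 - t) = \<phi> (x2 + t)\<close>. So among three
  such points two would be congruent.\<close>

lemma fibre_card_le_2:
  assumes S: "\<And>x x'. x \<in> S \<Longrightarrow> x' \<in> S \<Longrightarrow> x' - x \<in> \<Lambda> \<Longrightarrow> x = x'"
  shows "finite {x \<in> S \<inter> U. g x = y} \<and> card {x \<in> S \<inter> U. g x = y} \<le> 2"
proof -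
  let ?A = "{x \<in> S \<inter> U. g x = y}"
  have no3: False if x: "x1 \<in> ?A" "x2 \<in> ?A" "x3 \<in> ?A" and d: "x1 \<noteq> x2" "x1 \<noteq> x3" "x2 \<noteq> x3" for x1 x2 x3
  proof -
    have reflect: "\<phi> (b + t) = \<phi> (a - t)" if "a \<in> ?A" "b \<in> ?A" "a \<noteq> b" for a b t
    proof -
      have "\<phi> a = \<phi> b" using that U_facts(2) by simp
      with same_fibre[of a b] that(1,2)
      have "(\<forall>t. \<phi> (b + t) = \<phi> (a + t)) \<or> (\<forall>t. \<phi> (b + t) = \<phi> (a - t))" by simp
      moreover have "\<not> (\<forall>t. \<phi> (b + t) = \<phi> (a + t))"
      proof
        assume "\<forall>t. \<phi> (b + t) = \<phi> (a + t)"
        then have "b - a \<in> \<Lambda>" by (intro translation_period) blast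
        with S that show False by blast
      qed
      ultimately show ?thesis by blast
    qed
    have "\<phi> (x3 + t) = \<phi> (x2 + t)" for t
      using reflect[OF x(1,3) d(2), of t] reflect[OF x(1,2) d(1), of t] by simp
    then have "x3 - x2 \<in> \<Lambda>" by (rule translation_period)
    with S[of x2 x3] x d(3) show False by blast
  qed
  show ?thesis
  proof (rule ccontr)
    assume neg: "\<not> (finite ?A \<and> card ?A \<le> 2)"
    have "\<exists>T. T \<subseteq> ?A \<and> finite T \<and> card T = 3"
    proof (cases "finite ?A")
      case True
      with neg have "3 \<le> card ?A" by linarith
      then obtain T where "T \<subseteq> ?A" "card T = 3" "finite T" by (rule obtain_subset_with_card_n)
      then show ?thesis by blast
    qed (metis infinite_arbitrarily_large)
    then obtain T where T: "T \<subseteq> ?A" "card T = 3" by blast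
    then obtain x1 x2 x3 where "T = {x1, x2, x3}" "x1 \<noteq> x2" "x1 \<noteq> x3" "x2 \<noteq> x3"
      by (auto simp: card_3_iff)
    with T(1) no3[of x1 x2 x3] show False by blast
  qed
qed

text \<open>On \<open>U\<close> the density \<open>|q|\<close> pulls back to Lebesgue measure, and a
  set without congruent points covers each value at most twice; its area is therefore at most twice
  that of \<open>q\<close>.\<close>

lemma emeasure_injective_region_finite:
  assumes S: "\<And>x x'. x \<in> S \<Longrightarrow> x' \<in> S \<Longrightarrow> x' - x \<in> \<Lambda> \<Longrightarrow> x = x'" and op: "open S"
  shows "emeasure lborel S < \<infinity>"
proof -
  define T where "T = S \<inter> U"
  have T: "open T" "T \<subseteq> U" using op open_U by (auto simp: T_def)
  have Tb: "T \<in> sets borel" using T(1) by simp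
  have "S - U \<in> null_sets lborel"
    using countable_compl_U countable_subset[of "S - U" "- U"] by (intro countable_imp_null_set_lborel) auto
  moreover have "S = T \<union> (S - U)" by (auto simp: T_def)
  ultimately have "emeasure lborel S = emeasure lborel T"
    using Tb emeasure_Un_null_set[of T lborel "S - U"] by simp
  also have "\<dots> < \<infinity>"
  proof -
    define h where "h x = ennreal (cmod (qd (indicator U x *\<^sub>R g x)))" for x
    have [measurable]: "(\<lambda>x. indicator U x *\<^sub>R g x) \<in> borel_measurable borel"
      using open_U g_holomorphic by (intro borel_measurable_continuous_on_indicator holomorphic_on_imp_continuous_on) auto
    have hm: "h \<in> borel_measurable borel" unfolding h_def by measurable
    have "emeasure lborel T = (\<integral>\<^sup>+x. indicator T x \<partial>lborel)" using Tb by simp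
    also have "\<dots> = (\<integral>\<^sup>+x. h x * ennreal ((cmod (deriv g x))\<^sup>2) * indicator T x \<partial>lborel)"
    proof (intro nn_integral_cong)
      fix x
      show "indicator T x = h x * ennreal ((cmod (deriv g x))\<^sup>2) * indicator T x"
      proof (cases "x \<in> T")
        case True
        then have x: "x \<in> U" using T by blast
        have "cmod (qd (g x)) * (cmod (deriv g x))\<^sup>2 = cmod (qd (g x) * (deriv g x)\<^sup>2)"
          by (simp only: norm_mult norm_power)
        also have "\<dots> = 1" unfolding U_facts(5)[OF x] by simp
        finally have "h x * ennreal ((cmod (deriv g x))\<^sup>2) = 1"
          using x by (simp add: h_def ennreal_mult[symmetric] del: norm_divide)
        then show ?thesis using True by simp
      qed simp
    qed
    also have "\<dots> = (\<integral>\<^sup>+y. fibre_integral T g h y \<partial>lborel)"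
      by (rule nn_integral_fibre_integral(1)[OF g_holomorphic open_U U_facts(6) Tb T(2) hm])
    also have "\<dots> \<le> (\<integral>\<^sup>+y. 2 * ennreal (cmod (qd y)) \<partial>lborel)"
    proof (intro nn_integral_mono)
      fix y
      define A where "A = {x \<in> S \<inter> U. g x = y}"
      have A: "finite A" "card A \<le> 2" using fibre_card_le_2[of S y] S by (auto simp: A_def)
      have "fibre_integral T g h y = (\<integral>\<^sup>+x. ennreal (cmod (qd y)) * indicator A x \<partial>count_space UNIV)"
        unfolding fibre_integral_def
        by (intro nn_integral_cong) (auto simp: h_def A_def T_def indicator_def)
      also have "\<dots> = ennreal (cmod (qd y)) * emeasure (count_space UNIV) A"
        by (subst nn_integral_cmult_indicator) auto
      also have "\<dots> = ennreal (cmod (qd y)) * of_nat (card A)"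
        using A(1) by (simp add: emeasure_count_space_finite)
      also have "\<dots> \<le> ennreal (cmod (qd y)) * of_nat 2"
        using A(2) by (intro mult_left_mono) (auto simp del: of_nat_numeral)
      finally show "fibre_integral T g h y \<le> 2 * ennreal (cmod (qd y))" by (simp add: mult.commute)
    qed
    also have "\<dots> = 2 * (\<integral>\<^sup>+y. ennreal (cmod (qd y)) \<partial>lborel)"
      by (rule nn_integral_cmult) measurable
    also have "\<dots> < \<infinity>" using qd_finite by (simp add: ennreal_mult_less_top)
    finally show ?thesis .
  qed
  finally show ?thesis .
qed

lemma open_strip: "open {z. 0 < Re (z * cnj e) \<and> Re (z * cnj e) < \<delta>}"
proof -
  have "continuous_on UNIV (\<lambda>z. Re (z * cnj e))"
    by (intro continuous_on_Re continuous_on_mult continuous_on_id continuous_on_const)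
  then show ?thesis
    by (intro open_Collect_conj open_Collect_less continuous_on_const)
qed

text \<open>Disjoint discs of radius \<open>\<delta> / 2\<close>, strung along the strip at distance
  \<open>\<delta>\<close>, all fit inside.\<close>

lemma emeasure_strip_infinite:
  assumes e: "cmod e = 1" and \<delta>: "\<delta> > 0"
  shows "emeasure lborel {z. 0 < Re (z * cnj e) \<and> Re (z * cnj e) < \<delta>} = \<infinity>"
proof (rule ccontr)
  let ?S = "{z. 0 < Re (z * cnj e) \<and> Re (z * cnj e) < \<delta>}"
  assume fin: "emeasure lborel ?S \<noteq> \<infinity>"
  have ee: "e * cnj e = 1" using e by (simp add: complex_norm_square[symmetric])
  define b where "b k = e * Complex (\<delta> / 2) (\<delta> * of_nat k)" for k :: nat
  define v where "v = measure lborel (ball (0::complex) (\<delta> / 2))"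
  have ball_v: "emeasure lborel (ball c (\<delta> / 2)) = ennreal v" for c :: complex
  proof -
    have "measure lborel (ball c (\<delta> / 2)) = v"
      unfolding v_def
      using content_ball_conv_unit_ball[of "\<delta> / 2" c] content_ball_conv_unit_ball[of "\<delta> / 2" "0::complex"] \<delta> by simp
    then show ?thesis
      using emeasure_lborel_ball_finite[of c "\<delta> / 2"] by (simp add: emeasure_eq_ennreal_measure less_top[symmetric])
  qed
  have "v > 0" unfolding v_def using content_ball_pos[of "\<delta> / 2" "0::complex"] \<delta> by simp
  have sub: "ball (b k) (\<delta> / 2) \<subseteq> ?S" for k
  proof
    fix z assume "z \<in> ball (b k) (\<delta> / 2)"
    then have "cmod ((z - b k) * cnj e) < \<delta> / 2" using e by (simp add: dist_norm norm_minus_commute norm_mult)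
    then have "\<bar>Re ((z - b k) * cnj e)\<bar> < \<delta> / 2" using abs_Re_le_cmod[of "(z - b k) * cnj e"] by linarith
    moreover have "b k * cnj e = Complex (\<delta> / 2) (\<delta> * of_nat k)"
      using ee unfolding b_def by (metis mult.commute mult.left_commute mult_1)
    then have "Re ((z - b k) * cnj e) = Re (z * cnj e) - \<delta> / 2" unfolding left_diff_distrib by simp
    ultimately have "0 < Re (z * cnj e)" "Re (z * cnj e) < \<delta>" by linarith+
    then show "z \<in> ?S" by blast
  qed
  have disj: "disjoint_family (\<lambda>k. ball (b k) (\<delta> / 2))"
    unfolding disjoint_family_on_def
  proof (intro ballI impI)
    fix j k :: nat assume "j \<noteq> k"
    then have "1 \<le> \<bar>real j - real k\<bar>" by linarith
    then have "\<delta> \<le> \<delta> * \<bar>real j - real k\<bar>" using \<delta> by simp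
    also have "\<dots> = dist (b j) (b k)"
    proof -
      have "b j - b k = e * Complex 0 (\<delta> * (real j - real k))" by (simp add: b_def complex_eq_iff algebra_simps)
      moreover have "cmod (Complex 0 x) = \<bar>x\<bar>" for x by (simp add: cmod_def)
      ultimately show ?thesis using e \<delta> by (simp add: dist_norm norm_mult abs_mult)
    qed
    finally show "ball (b j) (\<delta> / 2) \<inter> ball (b k) (\<delta> / 2) = {}"
      by (intro disjoint_ballI) simp
  qed
  obtain m where m: "emeasure lborel ?S = ennreal m" "m \<ge> 0" using fin by (cases "emeasure lborel ?S") auto
  obtain n :: nat where n: "m / v < of_nat n" using reals_Archimedean2 by blast
  have Sb: "?S \<in> sets borel" using open_strip by (rule borel_open)
  have "ennreal (of_nat n * v) = (\<Sum>k<n. emeasure lborel (ball (b k) (\<delta> / 2)))"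
    using \<open>v > 0\<close> by (simp add: ball_v ennreal_mult ennreal_of_nat_eq_real_of_nat)
  also have "\<dots> = emeasure lborel (\<Union>k<n. ball (b k) (\<delta> / 2))"
    using disj by (intro sum_emeasure) (auto simp: disjoint_family_on_def)
  also have "\<dots> \<le> emeasure lborel ?S" using sub Sb by (intro emeasure_mono) auto
  finally have "of_nat n * v \<le> m" using m by simp
  then show False using n \<open>v > 0\<close> by (simp add: pos_divide_less_eq)
qed

text \<open>If all periods lay on the line through \<open>e\<close>, a strip transverse to it of
  width \<open>\<delta>\<close> would contain no two congruent points: their difference would be a
  period shorter than \<open>\<delta>\<close>. But the strip has infinite area.\<close>

theorem \<Lambda>_lattice: "lattice_rank2 \<Lambda>"
proof -
  obtain \<delta> where \<delta>: "\<delta> > 0" "\<And>w. w \<in> \<Lambda> \<Longrightarrow> cmod w < \<delta> \<Longrightarrow> w = 0" using \<Lambda>_discrete by blast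
  show ?thesis
  proof (rule discrete_subgroup_lattice[OF \<Lambda>_zero \<Lambda>_diff \<delta>])
    fix e assume e: "cmod e = 1"
    show "\<not> \<Lambda> \<subseteq> range (\<lambda>x. of_real x * e)"
    proof
      assume line: "\<Lambda> \<subseteq> range (\<lambda>x. of_real x * e)"
      let ?S = "{z. 0 < Re (z * cnj e) \<and> Re (z * cnj e) < \<delta>}"
      have "emeasure lborel ?S < \<infinity>"
      proof (rule emeasure_injective_region_finite)
        fix x x' assume x: "x \<in> ?S" "x' \<in> ?S" "x' - x \<in> \<Lambda>"
        then obtain r where r: "x' - x = of_real r * e" using line by blast
        have "(x' - x) * cnj e = of_real r"
          unfolding r using e by (simp add: mult.assoc complex_norm_square[symmetric])
        from arg_cong[OF this, of Re] have "Re (x' * cnj e) - Re (x * cnj e) = r"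
          unfolding left_diff_distrib minus_complex.sel(1) Re_complex_of_real .
        moreover have "0 < Re (x * cnj e)" "Re (x * cnj e) < \<delta>" "0 < Re (x' * cnj e)" "Re (x' * cnj e) < \<delta>"
          using x(1,2) by blast+
        ultimately have "\<bar>r\<bar> < \<delta>" by linarith
        then have "cmod (x' - x) < \<delta>" unfolding r using e by (simp add: norm_mult)
        then show "x = x'" using \<delta>(2)[OF x(3)] by simp
      next
        show "open ?S" by (rule open_strip)
      qed
      with emeasure_strip_infinite[OF e \<delta>(1)] show False by simp
    qed
  qed
qed


section \<open>Surjectivity and the quotient torus\<close>

lemma fundamental_parallelogram:
  obtains para where "compact para" "\<forall>z. \<exists>p\<in>para. \<exists>w\<in>\<Lambda>. z = p + w"
proof -
  obtain u v where uv: "u \<noteq> v" "independent {u, v}" and L: "\<Lambda> = {of_int m * u + of_int n * v | m n. True}"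
    using \<Lambda>_lattice unfolding lattice_rank2_def by blast
  have "dim {u, v} = card {u, v}" using uv(2) by (rule dim_eq_card_independent)
  then have "dim {u, v} = DIM(complex)" using uv(1) by simp
  then have span: "span {u, v} = UNIV" using dim_eq_full by blast
  define para where "para = (\<lambda>p. of_real (fst p) * u + of_real (snd p) * v) ` ({0..1} \<times> {0..1::real})"
  show thesis
  proof (rule that)
    show "compact para" unfolding para_def
      by (intro compact_continuous_image compact_Times compact_Icc continuous_intros)
    show "\<forall>z. \<exists>p\<in>para. \<exists>w\<in>\<Lambda>. z = p + w"
    proof
    fix z
    have "z \<in> span {u, v}" using span by simp
    then obtain x where "z - x *\<^sub>R u \<in> span {v}" using span_breakdown_eq by blast
    then obtain y where "z - x *\<^sub>R u = y *\<^sub>R v" by (auto simp: span_singleton)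
    then have z: "z = of_real x * u + of_real y * v" by (simp add: scaleR_conv_of_real algebra_simps)
    define p where "p = of_real (frac x) * u + of_real (frac y) * v"
    have "p \<in> para" unfolding para_def p_def
      using frac_ge_0 frac_lt_1 by (intro image_eqI[of _ _ "(frac x, frac y)"]) (auto intro: less_imp_le)
    moreover have "of_int \<lfloor>x\<rfloor> * u + of_int \<lfloor>y\<rfloor> * v \<in> \<Lambda>" unfolding L by blast
    moreover have "z = p + (of_int \<lfloor>x\<rfloor> * u + of_int \<lfloor>y\<rfloor> * v)"
      unfolding z p_def frac_def by (simp add: algebra_simps)
    ultimately show "\<exists>p\<in>para. \<exists>w\<in>\<Lambda>. z = p + w" by blast
    qed
  qed
qed

lemma \<phi>_not_constant: "\<not> (\<forall>\<^sub>F t in nhds z. \<phi> t = \<phi> z)"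
  by (rule sol_not_constant[OF \<phi>_sol]) simp

text \<open>If \<open>\<phi>\<close> omitted \<open>y\<close>, a coordinate with pole at \<open>y\<close> would give a bounded entire function.\<close>

fun coord_away :: "riemann_sphere \<Rightarrow> riemann_sphere \<Rightarrow> complex" where
  "coord_away None (Some a) = a"
| "coord_away None None = 0"
| "coord_away (Some b) (Some a) = 1 / (a - b)"
| "coord_away (Some b) None = 0"

lemma coord_away_inj: "x \<noteq> y \<Longrightarrow> x' \<noteq> y \<Longrightarrow> coord_away y x = coord_away y x' \<Longrightarrow> x = x'"
  by (cases y; cases x; cases x') auto

lemma coord_away_analytic:
  assumes omit: "\<And>z. \<phi> z \<noteq> y"
  shows "(\<lambda>t. coord_away y (\<phi> t)) analytic_on {z}"
proof -
  obtain k where k: "k analytic_on {z}" "k z = 0" "\<forall>\<^sub>F t in nhds z. \<phi> t = sphere_param (\<phi> z) (k t)"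
    using sphere_analytic_atE[OF \<phi>_analytic] .
  show ?thesis
  proof (cases "\<phi> z")
    case (Some a)
    show ?thesis
    proof (cases y)
      case None
      have "\<forall>\<^sub>F t in nhds z. coord_away y (\<phi> t) = a + k t"
        using k(3) by eventually_elim (simp add: Some None)
      moreover have "(\<lambda>t. a + k t) analytic_on {z}" by (intro analytic_intros k)
      ultimately show ?thesis by (rule analytic_at_cong[THEN iffD2, OF _ refl])
    next
      case (Some b)
      have "\<forall>\<^sub>F t in nhds z. coord_away y (\<phi> t) = 1 / (a + k t - b)"
        using k(3) by eventually_elim (simp add: Some \<open>\<phi> z = Some a\<close>)
      moreover have "(\<lambda>t. 1 / (a + k t - b)) analytic_on {z}"
        using omit[of z] Some \<open>\<phi> z = Some a\<close> k(2) by (intro analytic_intros k) auto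
      ultimately show ?thesis by (rule analytic_at_cong[THEN iffD2, OF _ refl])
    qed
  next
    case None
    then obtain b where y: "y = Some b" using omit[of z] by (cases y) auto
    \<comment> \<open>This is \<open>1 / (1 / k - b)\<close> cleared of its inner fraction; the new
      form is also correct where \<open>k t = 0\<close>.\<close>
    have "\<forall>\<^sub>F t in nhds z. coord_away y (\<phi> t) = k t / (1 - b * k t)"
      using k(3)
    proof eventually_elim
      case (elim t)
      show ?case
      proof (cases "k t = 0")
        case False
        then have "\<phi> t = Some (1 / k t)" using elim None by simp
        moreover from this have "1 / k t \<noteq> b" using omit[of t] y by auto
        moreover have "1 / (1 / k t - b) = k t / (1 - b * k t)"
          using False by (cases "1 - b * k t = 0") (auto simp: field_simps)
        ultimately show ?thesis by (simp add: y)
      qed (use elim None y in simp)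
    qed
    moreover have "(\<lambda>t. k t / (1 - b * k t)) analytic_on {z}"
      using k(2) by (intro analytic_intros k) auto
    ultimately show ?thesis by (rule analytic_at_cong[THEN iffD2, OF _ refl])
  qed
qed

lemma \<phi>_surj: "\<exists>z. \<phi> z = y"
proof (rule ccontr)
  assume "\<not> ?thesis"
  then have omit: "\<phi> z \<noteq> y" for z by blast
  define h where "h t = coord_away y (\<phi> t)" for t
  have "h analytic_on UNIV"
    unfolding h_def[abs_def] using coord_away_analytic[OF omit] analytic_on_analytic_at by blast
  then have hol: "h holomorphic_on UNIV" by (simp add: analytic_on_open)
  obtain para where para: "compact para" "\<forall>z. \<exists>p\<in>para. \<exists>w\<in>\<Lambda>. z = p + w" by (rule fundamental_parallelogram)
  \<comment> \<open>By periodicity all values are taken on a compact parallelogram, which bounds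
    \<open>h\<close>.\<close>
  have "range h \<subseteq> h ` para"
  proof
    fix x assume "x \<in> range h"
    then obtain z where z: "x = h z" by blast
    obtain p w where "p \<in> para" "w \<in> \<Lambda>" "z = p + w" using para(2) by blast
    then have "p \<in> para" "h z = h p" by (auto simp: h_def \<Lambda>_iff)
    then show "x \<in> h ` para" using z by blast
  qed
  moreover have "compact (h ` para)"
    using para(1) holomorphic_on_imp_continuous_on[OF hol] continuous_on_subset by (blast intro: compact_continuous_image)
  ultimately have "bounded (range h)" using compact_imp_bounded bounded_subset by blast
  from Liouville_theorem[OF hol this] obtain c' where c': "\<And>z. h z = c'" by (auto simp: constant_on_def)
  have "\<phi> t = \<phi> 0" for t
    using coord_away_inj[OF omit omit, of t 0] c'[of t] c'[of 0] by (simp add: h_def)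
  then have "\<forall>\<^sub>F t in nhds 0. \<phi> t = \<phi> 0" by (intro always_eventually) blast
  with \<phi>_not_constant show False by blast
qed

lemma finite_fibre_compact:
  assumes "compact para"
  shows "finite (para \<inter> {z. \<phi> z = y})"
proof (rule finite_not_islimpt_in_compact[OF assms])
  fix z
  have "\<forall>\<^sub>F t in at z. \<phi> t \<notin> {y}"
    by (rule sphere_analytic_avoids[OF \<phi>_analytic \<phi>_not_constant]) simp
  then show "\<not> z islimpt {z. \<phi> z = y}" by (simp add: islimpt_iff_eventually)
qed

lemma torus_proj_eq_iff: "torus_proj \<Lambda> z = torus_proj \<Lambda> z' \<longleftrightarrow> z - z' \<in> \<Lambda>"
proof
  assume "torus_proj \<Lambda> z = torus_proj \<Lambda> z'"
  moreover have "z \<in> torus_proj \<Lambda> z" unfolding torus_proj_def using \<Lambda>_zero by force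
  ultimately have "z \<in> torus_proj \<Lambda> z'" by simp
  then show "z - z' \<in> \<Lambda>" by (auto simp: torus_proj_def)
next
  assume *: "z - z' \<in> \<Lambda>"
  have sub: "torus_proj \<Lambda> a \<subseteq> torus_proj \<Lambda> b" if "a - b \<in> \<Lambda>" for a b
  proof
    fix x assume "x \<in> torus_proj \<Lambda> a"
    then obtain w where w: "w \<in> \<Lambda>" "x = a + w" by (auto simp: torus_proj_def)
    have "w - (b - a) \<in> \<Lambda>"
      using \<Lambda>_diff[OF w(1) \<Lambda>_diff[OF \<Lambda>_zero that]] by simp
    moreover have "x = b + (w - (b - a))" using w(2) by simp
    ultimately show "x \<in> torus_proj \<Lambda> b" unfolding torus_proj_def by blast
  qed
  have "z' - z \<in> \<Lambda>" using \<Lambda>_diff[OF \<Lambda>_zero *] by simp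
  with sub * show "torus_proj \<Lambda> z = torus_proj \<Lambda> z'" by blast
qed

text \<open>\<open>\<phi>\<close> descends to the torus of its periods. Multiplication by
  \<open>\<rho>\<close> preserves these since
  \<open>\<phi> (z + \<rho> w) = f (\<phi> (z / \<rho> + w))\<close>, and so it descends to the
  affine map with translation part 0.\<close>

theorem lattes_if_semiconjugate:
  assumes semi: "\<And>z. \<phi> (\<rho> * z) = f (\<phi> z)" and \<rho>: "\<rho> \<noteq> 0"
  shows "lattes_map f" "\<And>w. w \<in> \<Lambda> \<Longrightarrow> \<rho> * w \<in> \<Lambda>"
proof -
  show inv: "\<rho> * w \<in> \<Lambda>" if w: "w \<in> \<Lambda>" for w
    unfolding \<Lambda>_iff
  proof
    fix z
    have "\<phi> (z + \<rho> * w) = \<phi> (\<rho> * (z / \<rho> + w))" using \<rho> by (simp add: distrib_left)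
    also have "\<dots> = f (\<phi> (z / \<rho>))" using w by (simp only: semi \<Lambda>_iff)
    also have "\<dots> = \<phi> z" using semi[of "z / \<rho>"] \<rho> by simp
    finally show "\<phi> (z + \<rho> * w) = \<phi> z" .
  qed
  \<comment> \<open>Cosets are given chosen representatives; periodicity of \<open>\<phi>\<close>
    and invariance of \<open>\<Lambda>\<close> make \<open>\<Theta>\<close> and \<open>L\<close>
    independent of the choice.\<close>
  define rep where "rep t = (SOME z. torus_proj \<Lambda> z = t)" for t
  have rep: "torus_proj \<Lambda> (rep (torus_proj \<Lambda> z)) = torus_proj \<Lambda> z" for z
    unfolding rep_def by (rule someI_ex) blast
  define \<Theta> where "\<Theta> t = \<phi> (rep t)" for t
  have \<Theta>: "\<Theta> (torus_proj \<Lambda> z) = \<phi> z" for z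
  proof -
    have "rep (torus_proj \<Lambda> z) - z \<in> \<Lambda>" using rep[of z] by (simp add: torus_proj_eq_iff)
    then have "\<phi> (z + (rep (torus_proj \<Lambda> z) - z)) = \<phi> z" unfolding \<Lambda>_iff by blast
    then show ?thesis by (simp add: \<Theta>_def)
  qed
  define L where "L t = torus_proj \<Lambda> (\<rho> * rep t)" for t
  have L: "L (torus_proj \<Lambda> z) = torus_proj \<Lambda> (\<rho> * z)" for z
  proof -
    have "\<rho> * (rep (torus_proj \<Lambda> z) - z) \<in> \<Lambda>" using rep[of z] by (intro inv) (simp add: torus_proj_eq_iff)
    then show ?thesis by (simp add: L_def torus_proj_eq_iff right_diff_distrib)
  qed
  have "torus_affine \<Lambda> L"
    unfolding torus_affine_def by (intro exI[of _ \<rho>] exI[of _ 0]) (simp add: L)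
  moreover have "torus_branched_cover \<Lambda> \<Theta>"
    unfolding torus_branched_cover_def
  proof (intro conjI allI)
    have "\<Theta> \<circ> torus_proj \<Lambda> = \<phi>" by (simp add: fun_eq_iff \<Theta>)
    then show "holomorphic_to_sphere (\<Theta> \<circ> torus_proj \<Lambda>)"
      using \<phi>_analytic by (simp add: holomorphic_to_sphere_def sphere_analytic_at_def)
    show "\<Theta> ` torus \<Lambda> = UNIV"
    proof -
      have "y \<in> \<Theta> ` torus \<Lambda>" for y
      proof -
        obtain z where "\<phi> z = y" using \<phi>_surj by blast
        then show ?thesis by (intro image_eqI[of _ _ "torus_proj \<Lambda> z"]) (auto simp: \<Theta> torus_def)
      qed
      then show ?thesis by blast
    qed
    fix y
    obtain para where para: "compact para" "\<forall>z. \<exists>p\<in>para. \<exists>w\<in>\<Lambda>. z = p + w" by (rule fundamental_parallelogram)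
    have "{t \<in> torus \<Lambda>. \<Theta> t = y} \<subseteq> torus_proj \<Lambda> ` (para \<inter> {z. \<phi> z = y})"
    proof
      fix t assume "t \<in> {t \<in> torus \<Lambda>. \<Theta> t = y}"
      then obtain z where z: "t = torus_proj \<Lambda> z" "\<phi> z = y" by (auto simp: torus_def \<Theta>)
      obtain p w where p: "p \<in> para" "w \<in> \<Lambda>" "z = p + w" using para(2) by blast
      then have "\<phi> p = y" using z(2) by (simp add: \<Lambda>_iff)
      moreover have "t = torus_proj \<Lambda> p" unfolding z(1) torus_proj_eq_iff using p by simp
      ultimately show "t \<in> torus_proj \<Lambda> ` (para \<inter> {z. \<phi> z = y})" using p(1) by blast
    qed
    then show "finite {t \<in> torus \<Lambda>. \<Theta> t = y}"
      by (rule finite_subset[OF _ finite_imageI[OF finite_fibre_compact[OF para(1)]]])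
  qed
  moreover have "\<Theta> (L t) = f (\<Theta> t)" if "t \<in> torus \<Lambda>" for t
    using that by (auto simp: torus_def L \<Theta> semi)
  ultimately show "lattes_map f"
    unfolding lattes_map_def using \<Lambda>_lattice
    by (intro exI[of _ \<Lambda>] exI[of _ L] exI[of _ \<Theta>]) simp
qed

end

subsection \<open>Multipliers of lattices\<close>


text \<open>As \<open>c\<close> is not real and solves a rational quadratic, \<open>g\<close> has
  degree 2. Comparing imaginary parts identifies it as a multiple of \<open>X^2 - s X + 1\<close>,
  and its leading coefficient is a unit, so \<open>s\<close> is integral.\<close>

lemma rational_trace_integer:
  fixes c :: complex
  assumes c: "c \<notin> \<real>" and s: "s \<in> \<rat>" "c\<^sup>2 - of_real s * c + 1 = 0"
    and g: "g \<noteq> 0" "\<bar>lead_coeff g\<bar> = 1" "poly (map_poly of_int g) c = 0"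
    and min: "\<And>h :: int poly. h \<noteq> 0 \<Longrightarrow> poly (map_poly of_int h) c = 0 \<Longrightarrow> degree g \<le> degree h"
  shows "s \<in> \<int>"
proof -
  obtain a b :: int where ab: "b \<noteq> 0" "s = of_int a / of_int b"
  proof -
    obtain a b :: int where "b > 0" "s = of_int a / of_int b" using s(1) by (rule Rats_cases')
    then show thesis by (intro that[of b a]) auto
  qed
  \<comment> \<open>The quadratic equation with the denominator of \<open>s\<close> cleared.\<close>
  have "poly (map_poly of_int [:b, - a, b:]) c = of_int b * (c\<^sup>2 - of_real s * c + 1)"
    using ab(1) by (simp add: ab(2) map_poly_pCons power2_eq_square field_simps)
  then have "degree g \<le> degree [:b, - a, b:]" using s(2) ab(1) by (intro min) auto
  then have deg: "degree g \<le> 2" using ab(1) by simp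
  define x y z where "x = coeff g 0" and "y = coeff g 1" and "z = coeff g 2"
  have g_eq: "g = [:x, y, z:]"
  proof (rule poly_eqI)
    fix i
    show "coeff g i = coeff [:x, y, z:] i"
      using deg coeff_eq_0[of g i]
      by (auto simp: x_def y_def z_def coeff_pCons numeral_2_eq_2 not_less split: nat.split)
  qed
  have eq: "of_int x + of_int y * c + of_int z * c\<^sup>2 = 0"
    using g(3) unfolding g_eq by (simp add: map_poly_pCons power2_eq_square algebra_simps)
  have c2: "c\<^sup>2 = of_real s * c - 1" using s(2) by (simp add: algebra_simps eq_diff_eq add_eq_0_iff)
  have "of_int x + of_int y * c + of_int z * (of_real s * c - 1) = 0"
    using eq c2 by simp
  then have lin: "of_real (of_int x - of_int z) + of_real (of_int y + of_int z * s) * c = 0"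
    by (simp add: algebra_simps)
  have Im: "Im c \<noteq> 0" using c complex_is_Real_iff by blast
  have "(of_int y + of_int z * s) * Im c = 0" using arg_cong[OF lin, of Im] by simp
  then have yz: "of_int y + of_int z * s = 0" using Im by simp
  have "z \<noteq> 0"
  proof
    assume "z = 0"
    with yz lin have "g = 0" by (simp add: g_eq)
    with g(1) show False ..
  qed
  then have "lead_coeff g = z" by (simp add: g_eq)
  then have "z = 1 \<or> z = -1" using g(2) by linarith
  then have "s = of_int (- y) \<or> s = of_int y" using yz by auto
  then show ?thesis by (metis Ints_of_int)
qed

text \<open>In the basis \<open>u\<close>, \<open>v\<close> multiplication by \<open>\<rho>\<close>
  has an integer matrix, and \<open>\<rho>\<close> is a root of its characteristic
  polynomial.\<close>

lemma lattice_multiplier_quadratic: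
  assumes "lattice_rank2 \<Lambda>" "\<And>w. w \<in> \<Lambda> \<Longrightarrow> \<rho> * w \<in> \<Lambda>"
  obtains t n :: int where "\<rho>\<^sup>2 - of_int t * \<rho> + of_int n = 0"
proof -
  obtain u v where uv: "u \<noteq> v" "independent {u, v}" "\<Lambda> = {of_int m * u + of_int n * v | m n. True}"
    using assms(1) unfolding lattice_rank2_def by blast
  have u0: "u \<noteq> 0" using uv(2) dependent_zero by auto
  have "u = of_int 1 * u + of_int 0 * v" "v = of_int 0 * u + of_int 1 * v" by simp_all
  then have "u \<in> \<Lambda>" "v \<in> \<Lambda>" unfolding uv(3) by blast+
  then have "\<rho> * u \<in> \<Lambda>" "\<rho> * v \<in> \<Lambda>" using assms(2) by blast+
  then obtain a b a' b' :: int where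
    *: "\<rho> * u = of_int a * u + of_int b * v" "\<rho> * v = of_int a' * u + of_int b' * v"
    unfolding uv(3) by blast
  have "((\<rho> - of_int a) * (\<rho> - of_int b') - of_int b * of_int a') * u = 0"
  proof -
    have "(\<rho> - of_int a) * u = of_int b * v" "(\<rho> - of_int b') * v = of_int a' * u"
      using * by (simp_all add: algebra_simps)
    then show ?thesis by algebra
  qed
  then have "(\<rho> - of_int a) * (\<rho> - of_int b') - of_int b * of_int a' = 0" using u0 by simp
  then have "\<rho>\<^sup>2 - of_int (a + b') * \<rho> + of_int (a * b' - b * a') = 0"
    by (simp add: algebra_simps power2_eq_square)
  then show ?thesis using that by blast
qed

lemma nonreal_quadratic_root_trace:
  fixes \<rho> :: complex
  assumes "\<rho> \<notin> \<real>" "\<rho>\<^sup>2 - of_int t * \<rho> + of_int n = 0"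
  shows "2 * Re \<rho> = of_int t"
proof -
  have "Im \<rho> \<noteq> 0" using assms(1) complex_is_Real_iff by blast
  moreover have "(2 * Re \<rho> - of_int t) * Im \<rho> = 0"
    using arg_cong[OF assms(2), of Im] by (simp add: power2_eq_square algebra_simps)
  ultimately show ?thesis by simp
qed

text \<open>The integer \<open>2 Re c\<close> lies strictly between -2 and 2; the values 1, 0, -1
  give the primitive sixth, fourth and third roots of unity.\<close>

lemma unimodular_with_integral_trace:
  assumes "cmod c = 1" "c \<notin> \<real>" "2 * Re c \<in> \<int>"
  shows "c \<in> {\<i>, -\<i>, 1/2 + \<i> * (sqrt 3 / 2), 1/2 - \<i> * (sqrt 3 / 2),
              -1/2 + \<i> * (sqrt 3 / 2), -1/2 - \<i> * (sqrt 3 / 2)}"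
proof -
  have Im: "Im c \<noteq> 0" using assms(2) complex_is_Real_iff by blast
  have sq: "(Re c)\<^sup>2 + (Im c)\<^sup>2 = 1" using assms(1) by (simp add: cmod_def)
  then have "(Re c)\<^sup>2 < 1" using zero_less_power2[of "Im c"] Im by linarith
  then have Re: "\<bar>Re c\<bar> < 1" by (simp add: abs_square_less_1)
  obtain k :: int where k: "2 * Re c = of_int k" using assms(3) by (auto elim: Ints_cases)
  have "of_int k < (2::real)" "of_int k > (-2::real)" using k Re by linarith+
  then have "k = -1 \<or> k = 0 \<or> k = 1" by linarith
  then have "Re c = -1/2 \<or> Re c = 0 \<or> Re c = 1/2" using k by auto
  moreover have "Im c = 1 \<or> Im c = -1" if "Re c = 0"
    using sq that by (simp add: power2_eq_1_iff)
  moreover have "Im c = sqrt 3 / 2 \<or> Im c = - (sqrt 3 / 2)" if "\<bar>Re c\<bar> = 1/2"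
  proof -
    have "(Re c)\<^sup>2 = 1/4" using arg_cong[OF that, of "\<lambda>x. x\<^sup>2"] by (simp add: power2_eq_square)
    then have "(Im c)\<^sup>2 = (sqrt 3 / 2)\<^sup>2" using sq by (simp add: power_divide)
    then show ?thesis by (simp only: power2_eq_iff)
  qed
  ultimately show ?thesis by (auto simp: complex_eq_iff)
qed

text \<open>For \<open>c\<close> not real, \<open>\<rho>^2 = D cnj c\<close> and the integrality of
  \<open>t = 2 Re \<rho>\<close> give \<open>D (2 Re c) = t^2 - 2 D\<close>. So the trace of
  \<open>c\<close> is rational, and integral because \<open>c\<close> is an algebraic
  integer.\<close>

lemma unimodular_multiplier_cases:
  assumes D: "D > 0" and \<rho>: "cmod (\<rho>\<^sup>2) = of_nat D" "\<rho>\<^sup>2 = of_nat D / c"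
    and c: "cmod c = 1"
    and \<Lambda>: "lattice_rank2 \<Lambda>" "\<And>w. w \<in> \<Lambda> \<Longrightarrow> \<rho> * w \<in> \<Lambda>"
    and g: "g \<noteq> 0" "\<bar>lead_coeff g\<bar> = 1" "poly (map_poly of_int g) c = 0"
    and min: "\<And>h :: int poly. h \<noteq> 0 \<Longrightarrow> poly (map_poly of_int h) c = 0 \<Longrightarrow> degree g \<le> degree h"
  shows "c \<in> {1, -1, \<i>, -\<i>, 1/2 + \<i> * (sqrt 3 / 2), 1/2 - \<i> * (sqrt 3 / 2),
              -1/2 + \<i> * (sqrt 3 / 2), -1/2 - \<i> * (sqrt 3 / 2)}"
proof (cases "c \<in> \<real>")
  case True
  then obtain r where r: "c = of_real r" by (auto elim: Reals_cases)
  then have "\<bar>r\<bar> = 1" using c by simp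
  then have "r = 1 \<or> r = -1" by linarith
  then show ?thesis using r by auto
next
  case False
  have c0: "c \<noteq> 0" using c by auto
  have c_eq: "c = of_nat D / \<rho>\<^sup>2" unfolding \<rho>(2) using c0 D by simp
  have "\<rho> \<notin> \<real>" using False unfolding c_eq by (auto intro: Reals_divide Reals_power Reals_of_nat)
  obtain t n :: int where "\<rho>\<^sup>2 - of_int t * \<rho> + of_int n = 0"
    using lattice_multiplier_quadratic[OF \<Lambda>] by blast
  then have t: "2 * Re \<rho> = of_int t" by (rule nonreal_quadratic_root_trace[OF \<open>\<rho> \<notin> \<real>\<close>])
  have cc: "c * cnj c = 1" using c by (simp add: complex_norm_square[symmetric])
  have nn: "(cmod \<rho>)\<^sup>2 = of_nat D" using \<rho>(1) by (simp add: norm_power)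
  have "Re (\<rho>\<^sup>2) = of_nat D * Re c"
  proof -
    have "\<rho>\<^sup>2 = of_nat D * cnj c" using \<rho>(2) inverse_unique[OF cc] by (simp add: divide_inverse)
    then show ?thesis by simp
  qed
  moreover have "Re (\<rho>\<^sup>2) = 2 * (Re \<rho>)\<^sup>2 - (cmod \<rho>)\<^sup>2"
    unfolding cmod_power2 by (simp add: power2_eq_square)
  ultimately have "of_nat D * (2 * Re c) = (of_int t)\<^sup>2 - 2 * of_nat D"
    unfolding nn t[symmetric] by (simp add: power2_eq_square)
  then have "2 * Re c = ((of_int t)\<^sup>2 - 2 * of_nat D) / of_nat D" using D by (simp add: field_simps)
  then have rat: "2 * Re c \<in> \<rat>" by simp
  have "c\<^sup>2 - of_real (2 * Re c) * c + 1 = 0"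
  proof -
    have "of_real (2 * Re c) = c + cnj c" by (simp add: complex_add_cnj)
    then show ?thesis using cc by (simp add: power2_eq_square algebra_simps)
  qed
  then have "2 * Re c \<in> \<int>" by (rule rational_trace_integer[OF False rat _ g min])
  then show ?thesis using unimodular_with_integral_trace[OF c False] by blast
qed

subsection \<open>Reduction to coprime fractions\<close>


lemma coprime_qd: "coprime (qd_numer q) (qd_denom q)"
  unfolding qd_numer_def qd_denom_def by (rule coprime_quot_of_fract)

lemma qd_denom_nonzero: "qd_denom q \<noteq> 0"
  by (simp add: qd_denom_def)

lemma qd_numer_nonzero:
  assumes "q \<noteq> 0"
  shows "qd_numer q \<noteq> 0"
proof
  assume "qd_numer q = 0"
  then have "Fract 0 (qd_denom q) = q" using Fract_quot_of_fract[of q] by (simp add: qd_numer_def qd_denom_def)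
  with assms show False by (simp add: Zero_fract_def[symmetric] fract_collapse)
qed

text \<open>In a reduced fraction no zero cancels a pole, so the bound on the order bounds the
  multiplicity of each root of the denominator.\<close>

lemma qd_denom_rsquarefree:
  assumes "\<And>x. qd_order q x \<ge> -1"
  shows "rsquarefree (qd_denom q)"
  unfolding rsquarefree_def
proof (intro conjI allI)
  fix z
  have "order z (qd_denom q) \<le> order z (qd_numer q) + 1" using assms[of "Some z"] by simp
  moreover have "order z (qd_denom q) = 0 \<or> order z (qd_numer q) = 0"
  proof (rule ccontr)
    assume "\<not> ?thesis"
    then have "poly (qd_denom q) z = 0" "poly (qd_numer q) z = 0" by (metis order_0I)+
    then show False using coprime_poly_0[OF coprime_qd] by blast
  qed
  ultimately show "order z (qd_denom q) = 0 \<or> order z (qd_denom q) = 1" by linarith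
qed (rule qd_denom_nonzero)

text \<open>The scaled fraction is reduced anew, for \<open>c = 0\<close> even to denominator 1, so
  the values are compared where both denominators are nonzero.\<close>

lemma qd_eval_scale: "\<forall>\<^sub>F y in cofinite. qd_eval (qd_scale c q) y = c * qd_eval q y"
proof -
  let ?r = "qd_scale c q"
  have repr: "Fract (qd_numer t) (qd_denom t) = t" for t
    by (simp add: qd_numer_def qd_denom_def Fract_quot_of_fract)
  have "?r = Fract [:c:] 1 * Fract (qd_numer q) (qd_denom q)"
    unfolding repr by (simp add: qd_scale_def to_fract_def)
  then have "Fract (qd_numer ?r) (qd_denom ?r) = Fract ([:c:] * qd_numer q) (1 * qd_denom q)"
    unfolding mult_fract repr[of ?r] .
  then have eq: "qd_numer ?r * qd_denom q = [:c:] * qd_numer q * qd_denom ?r"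
    by (simp add: eq_fract qd_denom_nonzero)
  have ev: "\<forall>\<^sub>F y in cofinite. poly (qd_denom t) y \<noteq> 0" for t
    using poly_roots_finite[OF qd_denom_nonzero[of t]] by (simp add: eventually_cofinite)
  show ?thesis
    using ev[of ?r] ev[of q]
  proof eventually_elim
    case (elim y)
    have "poly (qd_numer ?r) y * poly (qd_denom q) y = c * poly (qd_numer q) y * poly (qd_denom ?r) y"
      using arg_cong[OF eq, of "\<lambda>p. poly p y"] by simp
    with elim show ?case by (simp add: qd_eval_def frac_eq_eq)
  qed
qed

context coprime_fraction
begin

lemma finite_preimage: "{x. sphere_quotient P Q (Some x) = Some y} = fibre y"
  by (auto simp: fibre_iff ratio_def)

lemma finite_deriv_sphere_quotient:
  assumes "poly Q x \<noteq> 0"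
  shows "finite_deriv (sphere_quotient P Q) x = poly W x / (poly Q x)\<^sup>2"
proof -
  have "open {z. poly Q z \<noteq> 0}" by (intro open_Collect_neq continuous_intros)
  then have "\<forall>\<^sub>F z in nhds x. poly Q z \<noteq> 0" using assms by (simp add: eventually_nhds_in_open[of "{z. poly Q z \<noteq> 0}", simplified])
  then have "\<forall>\<^sub>F z in nhds x. the (sphere_quotient P Q (Some z)) = ratio z"
    by eventually_elim (simp add: ratio_def)
  then have "finite_deriv (sphere_quotient P Q) x = deriv ratio x"
    unfolding finite_deriv_def by (rule deriv_cong_ev) simp
  also have "\<dots> = poly W x / (poly Q x)\<^sup>2"
    by (rule DERIV_imp_deriv) (rule ratio_derivative[OF assms])
  finally show ?thesis .
qed

text \<open>The order at infinity is \<open>degree M - degree N - 4\<close>, because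
  \<open>dz^2\<close> has a pole of order 4 there; this is where the degree gap 3 comes
  from.\<close>

lemma eigen_differentialI:
  assumes "q \<noteq> 0" "q \<in> Q_space (sphere_quotient P Q)"
    and push: "has_pushforward (sphere_quotient P Q) q (qd_scale c q)"
  shows "eigen_differential P Q (qd_numer q) (qd_denom q) c"
proof
  have ord: "qd_order q x \<ge> -1" for x using assms(1,2) by (simp add: Q_space_def)
  show "qd_numer q \<noteq> 0" by (rule qd_numer_nonzero[OF assms(1)])
  show "rsquarefree (qd_denom q)" by (rule qd_denom_rsquarefree[OF ord])
  show "degree (qd_numer q) + 3 \<le> degree (qd_denom q)" using ord[of None] by simp
  show "\<forall>\<^sub>F y in cofinite. c * (poly (qd_numer q) y / poly (qd_denom q) y)
      = (\<Sum>x\<in>fibre y. push_weight (qd_numer q) (qd_denom q) x)"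
    using qd_eval_scale[of c q] push[unfolded has_pushforward_def]
  proof eventually_elim
    case (elim y)
    have "(\<Sum>x\<in>fibre y. qd_eval q x / (finite_deriv (sphere_quotient P Q) x)\<^sup>2)
        = (\<Sum>x\<in>fibre y. push_weight (qd_numer q) (qd_denom q) x)"
      by (rule sum.cong[OF refl])
        (simp add: push_weight_def qd_eval_def finite_deriv_sphere_quotient fibre_iff)
    then show ?case using elim unfolding finite_preimage by (simp add: qd_eval_def)
  qed
qed

end

theorem (in unimodular_eigen_differential) lattes_classification:
  assumes "algebraic_int c"
  shows "lattes_map f \<and> c \<in> {1, -1, \<i>, -\<i>, 1/2 + \<i> * (sqrt 3 / 2), 1/2 - \<i> * (sqrt 3 / 2),
              -1/2 + \<i> * (sqrt 3 / 2), -1/2 - \<i> * (sqrt 3 / 2)}"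
proof -
  obtain \<rho> \<phi> where \<rho>: "\<rho>\<^sup>2 = R" and \<phi>: "\<And>z. sphere_analytic_at \<phi> z"
    and semi: "\<And>z. \<phi> (\<rho> * z) = f (\<phi> z)" and sol: "\<And>z. \<forall>\<^sub>F t in at z. pt_sol 1 \<phi> t"
    using flat_parametrization by metis
  interpret cover: flat_cover P Q N M c \<phi>
    by unfold_locales (fact \<phi>, fact sol)
  have "\<rho> \<noteq> 0" using \<rho> R_nonzero by auto
  note lattes = cover.lattes_if_semiconjugate[OF semi this]
  obtain g :: "int poly" where g: "g \<noteq> 0" "\<bar>lead_coeff g\<bar> = 1" "poly (map_poly of_int g) c = 0"
    and min: "\<And>h :: int poly. h \<noteq> 0 \<Longrightarrow> poly (map_poly of_int h) c = 0 \<Longrightarrow> degree g \<le> degree h"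
    using algebraic_int_minimal_poly[OF assms] by metis
  have "D > 0" using D_ge_2 by simp
  show ?thesis
  proof
    show "lattes_map f" by (rule lattes(1))
    show "c \<in> {1, -1, \<i>, -\<i>, 1/2 + \<i> * (sqrt 3 / 2), 1/2 - \<i> * (sqrt 3 / 2),
              -1/2 + \<i> * (sqrt 3 / 2), -1/2 - \<i> * (sqrt 3 / 2)}"
      by (rule unimodular_multiplier_cases[OF \<open>D > 0\<close> _ _ cmod_c cover.\<Lambda>_lattice lattes(2) g min])
        (simp_all add: \<rho> cmod_R, simp add: R_def)
  qed
qed

theorem theorem2:
  fixes D :: nat and f :: "riemann_sphere \<Rightarrow> riemann_sphere"
  assumes "D \<ge> 2"
    and "rational_map D f"
    and "postcritically_finite f"
  shows "\<forall>c\<in>pushforward_eigenvalues f.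
           algebraic c \<and>
           (algebraic_int c \<longrightarrow>
              c = 0 \<or>
              (lattes_map f \<and>
               c \<in> {1, -1, \<i>, -\<i>,
                    1/2 + \<i> * (sqrt 3 / 2), 1/2 - \<i> * (sqrt 3 / 2),
                    -1/2 + \<i> * (sqrt 3 / 2), -1/2 - \<i> * (sqrt 3 / 2)}))"
proof
  fix c assume "c \<in> pushforward_eigenvalues f"
  then obtain q where q: "q \<in> Q_space f" "q \<noteq> 0" "has_pushforward f q (qd_scale c q)"
    unfolding pushforward_eigenvalues_def by blast
  obtain P Q where PQ: "coprime P Q" "Q \<noteq> 0" "D = max (degree P) (degree Q)" "f = sphere_quotient P Q"
    using assms(2) unfolding rational_map_def by blast
  interpret coprime_fraction P Q
    using PQ assms(1) by unfold_locales auto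
  interpret eigen_differential P Q "qd_numer q" "qd_denom q" c
    using q unfolding PQ(4) by (intro eigen_differentialI)
  show "algebraic c \<and>
           (algebraic_int c \<longrightarrow>
              c = 0 \<or>
              (lattes_map f \<and>
               c \<in> {1, -1, \<i>, -\<i>,
                    1/2 + \<i> * (sqrt 3 / 2), 1/2 - \<i> * (sqrt 3 / 2),
                    -1/2 + \<i> * (sqrt 3 / 2), -1/2 - \<i> * (sqrt 3 / 2)}))"
  proof (intro conjI impI)
    show "algebraic c" by (rule eigenvalue_algebraic(1))
    assume int: "algebraic_int c"
    show "c = 0 \<or> (lattes_map f \<and>
               c \<in> {1, -1, \<i>, -\<i>,
                    1/2 + \<i> * (sqrt 3 / 2), 1/2 - \<i> * (sqrt 3 / 2),
                    -1/2 + \<i> * (sqrt 3 / 2), -1/2 - \<i> * (sqrt 3 / 2)})"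
    proof (cases "c = 0")
      case False
      then have "cmod c = 1" by (rule eigenvalue_algebraic(2)[OF int])
      then interpret unimodular_eigen_differential P Q "qd_numer q" "qd_denom q" c
        using assms(1) by unfold_locales (simp_all add: D_def PQ(3))
      show ?thesis using lattes_classification[OF int] by (simp only: PQ(4) simp_thms)
    qed simp
  qed
qed

end
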